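(* For every integer $k\ge 2$, let $\mathbf{obs}_{\preceq}(\mathcal{G}[\mathbf{cmms},k])$ be the set of all connected graphs $G$ (up to isomorphism) such that $\mathbf{cmms}(G)>k$ and $\mathbf{cmms}(H)\le k$ for every proper contraction $H$ of $G$. Then $\mathbf{obs}_{\preceq}(\mathcal{G}[\mathbf{cmms},k])$ contains at least $$\frac{4}{3}\Big(\frac{5}{2}\Big)^{3\cdot 2^{k-2}}$$ pairwise non-isomorphic graphs.
   Context: All graphs are finite, without loops or multiple edges. A graph $H$ is a contraction of $G$, written $H\preceq G$, if there is a surjection $\phi:V(G)\to V(H)$ such that $G[\phi^{-1}(v)]$ is connected for every $v\in V(H)$ and, for all distinct $u,v\in V(H)$, $\{u,v\}\in E(H)$ if and only if $G[\phi^{-1}(u)\cup\phi^{-1}(v)]$ is connected. It is a proper contraction if moreover $H$ is not isomorphic to $G$. A (mixed) search strategy on $G$ is a finite sequence $\mathcal{S}$ of moves, starting with no searchers on the graph, each of one of the types: placing a new searcher on a vertex $v$; deleting a searcher from a vertex $v$; sliding a searcher from $v$ along an edge $\{v,u\}$ and placing it on $u$. Set $E(\mathcal{S},0)=\emptyset$. For $i>0$, let $E^{(i)}$ be the set of edges cleaned by the $i$-th move, i.e. edges both of whose endpoints become occupied by searchers, and the edge along which a searcher slides in that move. Let $Q_i=E(\mathcal{S},i-1)\cup E^{(i)}$. Then $E(\mathcal{S},i)$ (the set of clean edges after $i$ moves) is $Q_i$ minus those edges $e$ for which there is a path starting from $e$ and finishing in an edge not in $Q_i$ such that no two consecutive edges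 of it meet at a vertex occupied by a searcher after the $i$-th move. The $i$-th move is a recontamination move if $E(\mathcal{S},i)\subsetneq Q_i$. The strategy is complete if $E(\mathcal{S},i)=E(G)$ for some $i$, monotone if it has no recontamination moves, and connected if for every $i$ the subgraph of $G$ formed by the edges in $E(\mathcal{S},i)$ and their endpoints is connected (the empty graph counts as connected). The number of searchers used by $\mathcal{S}$ is the maximum number of searchers on the graph during any move. For a connected graph $G$, $\mathbf{cmms}(G)$ is the minimum number of searchers used by a complete connected monotone search strategy on $G$ (it is $0$ if $G$ has no edges). *)

theory Defs
  imports Complex_Main "HOL-Library.Multiset"
begin

section \<open>Finite simple graphs\<close>

record 'a graph =
  verts :: "'a set"
  edges :: "'a set set"

definition simple_graph :: "'a graph \<Rightarrow> bool" where
  "simple_graph G \<longleftrightarrow>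
     finite (verts G) \<and> (\<forall>e\<in>edges G. e \<subseteq> verts G \<and> card e = 2)"

definition graph_iso :: "'a graph \<Rightarrow> 'b graph \<Rightarrow> bool" where
  "graph_iso G H \<longleftrightarrow>
     (\<exists>f. bij_betw f (verts G) (verts H) \<and>
          (\<forall>u\<in>verts G. \<forall>v\<in>verts G. {u, v} \<in> edges G \<longleftrightarrow> {f u, f v} \<in> edges H))"

definition induced_subgraph :: "'a graph \<Rightarrow> 'a set \<Rightarrow> 'a graph" where
  "induced_subgraph G X = \<lparr>verts = X, edges = {e \<in> edges G. e \<subseteq> X}\<rparr>"

definition graph_path :: "'a graph \<Rightarrow> 'a list \<Rightarrow> bool" where
  "graph_path G p \<longleftrightarrow>
     p \<noteq> [] \<and> distinct p \<and> set p \<subseteq> verts G \<and> successively (\<lambda>u v. {u, v} \<in> edges G) p"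

text \<open>The graph without vertices counts as connected.\<close>

definition graph_connected :: "'a graph \<Rightarrow> bool" where
  "graph_connected G \<longleftrightarrow>
     (\<forall>u\<in>verts G. \<forall>v\<in>verts G. \<exists>p. graph_path G p \<and> hd p = u \<and> last p = v)"

definition contraction :: "'b graph \<Rightarrow> 'a graph \<Rightarrow> bool" where
  "contraction H G \<longleftrightarrow>
     (\<exists>\<phi>. \<phi> ` verts G = verts H \<and>
        (\<forall>v\<in>verts H. graph_connected (induced_subgraph G {x \<in> verts G. \<phi> x = v})) \<and>
        (\<forall>u\<in>verts H. \<forall>v\<in>verts H. u \<noteq> v \<longrightarrow>
           ({u, v} \<in> edges H \<longleftrightarrow>
            graph_connected
              (induced_subgraph G ({x \<in> verts G. \<phi> x = u} \<union> {x \<in> verts G. \<phi> x = v})))))"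

definition proper_contraction :: "'b graph \<Rightarrow> 'a graph \<Rightarrow> bool" where
  "proper_contraction H G \<longleftrightarrow> contraction H G \<and> \<not> graph_iso H G"


section \<open>Mixed search strategies\<close>

datatype 'a move = Place 'a | Delete 'a | Slide 'a 'a

text \<open>A position is a multiset: several searchers may stand on the same vertex.\<close>

fun legal_move :: "'a graph \<Rightarrow> 'a multiset \<Rightarrow> 'a move \<Rightarrow> bool" where
  "legal_move G C (Place v) \<longleftrightarrow> v \<in> verts G"
| "legal_move G C (Delete v) \<longleftrightarrow> v \<in># C"
| "legal_move G C (Slide v u) \<longleftrightarrow> v \<in># C \<and> {v, u} \<in> edges G"

fun make_move :: "'a move \<Rightarrow> 'a multiset \<Rightarrow> 'a multiset" where
  "make_move (Place v) C = add_mset v C"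
| "make_move (Delete v) C = C - {#v#}"
| "make_move (Slide v u) C = add_mset u (C - {#v#})"

definition searchers :: "'a move list \<Rightarrow> nat \<Rightarrow> 'a multiset" where
  "searchers S i = fold make_move (take i S) {#}"

definition search_strategy :: "'a graph \<Rightarrow> 'a move list \<Rightarrow> bool" where
  "search_strategy G S \<longleftrightarrow> (\<forall>i<length S. legal_move G (searchers S i) (S ! i))"

definition occupied :: "'a move list \<Rightarrow> nat \<Rightarrow> 'a set" where
  "occupied S i = set_mset (searchers S i)"

text \<open>
  Moves are numbered from 1, so the \<open>i\<close>-th move is \<open>S ! (i - 1)\<close>. An edge both of whose
  endpoints were occupied already before the move is clean at that time and cannot be
  recontaminated by the move, so listing it again is harmless.
\<close>

definition cleaned_edges :: "'a graph \<Rightarrow> 'a move list \<Rightarrow> nat \<Rightarrow> 'a set set" where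
  "cleaned_edges G S i =
     {e \<in> edges G. e \<subseteq> occupied S i} \<union>
     (case S ! (i - 1) of Slide v u \<Rightarrow> {{v, u}} | _ \<Rightarrow> {})"

text \<open>
  \<open>contaminated G X Q e\<close>: some path starts with the edge \<open>e\<close>, ends with an edge outside \<open>Q\<close>,
  and has no inner vertex (these are the vertices where consecutive edges meet) in \<open>X\<close>.
\<close>

definition contaminated :: "'a graph \<Rightarrow> 'a set \<Rightarrow> 'a set set \<Rightarrow> 'a set \<Rightarrow> bool" where
  "contaminated G X Q e \<longleftrightarrow>
     (\<exists>p. graph_path G p \<and> 2 \<le> length p \<and>
          {p ! 0, p ! 1} = e \<and>
          {p ! (length p - 2), p ! (length p - 1)} \<notin> Q \<and>
          (\<forall>j. 0 < j \<and> j < length p - 1 \<longrightarrow> p ! j \<notin> X))"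

fun clean_edges :: "'a graph \<Rightarrow> 'a move list \<Rightarrow> nat \<Rightarrow> 'a set set" where
  "clean_edges G S 0 = {}"
| "clean_edges G S (Suc i) =
     (let Q = clean_edges G S i \<union> cleaned_edges G S (Suc i)
      in {e \<in> Q. \<not> contaminated G (occupied S (Suc i)) Q e})"

definition recontamination_move :: "'a graph \<Rightarrow> 'a move list \<Rightarrow> nat \<Rightarrow> bool" where
  "recontamination_move G S i \<longleftrightarrow>
     clean_edges G S i \<subset> clean_edges G S (i - 1) \<union> cleaned_edges G S i"

definition complete_strategy :: "'a graph \<Rightarrow> 'a move list \<Rightarrow> bool" where
  "complete_strategy G S \<longleftrightarrow> (\<exists>i\<le>length S. clean_edges G S i = edges G)"

definition monotone_strategy :: "'a graph \<Rightarrow> 'a move list \<Rightarrow> bool" where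
  "monotone_strategy G S \<longleftrightarrow> (\<forall>i\<in>{1..length S}. \<not> recontamination_move G S i)"

definition connected_strategy :: "'a graph \<Rightarrow> 'a move list \<Rightarrow> bool" where
  "connected_strategy G S \<longleftrightarrow>
     (\<forall>i\<le>length S.
        graph_connected \<lparr>verts = \<Union> (clean_edges G S i), edges = clean_edges G S i\<rparr>)"

definition searchers_used :: "'a move list \<Rightarrow> nat" where
  "searchers_used S = Max ((\<lambda>i. size (searchers S i)) ` {..length S})"

text \<open>
  Used for connected graphs only, where such strategies always exist. The empty strategy
  gives the value 0 if there are no edges.
\<close>

definition cmms :: "'a graph \<Rightarrow> nat" where
  "cmms G = (LEAST n. \<exists>S. search_strategy G S \<and> complete_strategy G S \<and>
                 connected_strategy G S \<and> monotone_strategy G S \<and> searchers_used S = n)"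


section \<open>Contraction obstructions\<close>

text \<open>Every finite graph is isomorphic to one whose vertices are natural numbers.\<close>

definition obs_cmms :: "nat \<Rightarrow> nat graph set" where
  "obs_cmms k =
     {G. simple_graph G \<and> graph_connected G \<and> cmms G > k \<and>
         (\<forall>H :: nat graph. simple_graph H \<and> proper_contraction H G \<longrightarrow> cmms H \<le> k)}"

end

theory Submission
  imports Defs
begin

text \<open>
  Call a rooted graph a block of level \<open>k\<close> if \<open>k\<close> searchers can clean it from its root outwards, and
  from some other place towards the root, but cannot clean it from the root while a searcher has
  to stay on the root, and if this last task becomes possible as soon as an edge is contracted.

  Glue three blocks of level \<open>k\<close> at their roots. The first clean edge lies in one block, so the other
  two are entered through the common root. Until one of these two is finished, some searcher
  stands on the root or inside the other unfinished block, and for the block that is finished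
  first this searcher is as good as a guard on the root (\<open>two_blocks\<close>). Hence \<open>k\<close> searchers do not
  suffice. If an edge of one block is contracted, they do suffice: clean a second block towards the root,
  then the contracted block while the root is guarded, then the third block outwards
  (\<open>star_contract\<close>). So the graph is an obstruction (\<open>star_obstruction\<close>).

  The same argument shows that two blocks of level \<open>k\<close> with a common root, hung by one edge from a new
  root, form a block of level \<open>k + 1\<close> (\<open>block_graft\<close>). There are at least five blocks of level \<open>2\<close>,
  so their number satisfies \<open>N (k + 1) \<ge> N k ^ 2 / 2\<close>, which is doubly exponential, and the
  unordered triples of blocks contribute another factor \<open>N k ^ 3 / 6\<close>.

  Different triples give non-isomorphic graphs. A block cannot contain another block of the same
  level at a different root, because contracting an edge outside the smaller one would leave
  the larger one as hard as before; so the centre of the graph is determined (\<open>star_centre\<close>).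
  Blocks do not fall apart at their root, so they are determined by the centre (\<open>fan_unique\<close>), and
  recursively each block determines how it was built (\<open>tree_unique\<close>).

  Strategies are not a convenient tool for these arguments, since a move may clean many edges. After
  a contraction it may even clean edges too early, and these can become recontaminated later.
  They are replaced by searches that clean one edge at a time (apart from the situation described at
  \<open>ok_pend\<close>) and in which only the size of the frontier between clean and contaminated edges
  counts. For at least two searchers, both notions are equivalent
  (\<open>search_strategy_exists\<close>, \<open>strategy_search\<close>), and searches pass to contractions
  (\<open>search_img\<close>).
\<close>

section \<open>Searches that clean one edge at a time\<close>

definition edge_set :: "'a set set \<Rightarrow> bool" where
  "edge_set E \<longleftrightarrow> finite E \<and> (\<forall>e\<in>E. card e = 2)"

text \<open>
  \<open>T\<close> and \<open>D\<close> describe the surroundings of \<open>E\<close>: the vertices of \<open>T\<close> also meet clean edges outside \<open>E\<close>, and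
  those of \<open>D\<close> also meet contaminated ones. For a root \<open>r\<close>, the search starts at \<open>r\<close> if
  \<open>T = {r}\<close> and \<open>D = {}\<close>, it has to keep \<open>r\<close> once it is reached if \<open>T = {}\<close> and \<open>D = {r}\<close>, and \<open>r\<close> is
  guarded all the time if \<open>T = D = {r}\<close>.
\<close>

definition frontier :: "'a set set \<Rightarrow> 'a set \<Rightarrow> 'a set \<Rightarrow> 'a set set \<Rightarrow> 'a set" where
  "frontier E T D A = (\<Union>A \<union> T) \<inter> (\<Union>(E - A) \<union> D)"

definition touches :: "'a set \<Rightarrow> 'a set set \<Rightarrow> 'a set \<Rightarrow> bool" where
  "touches T A e \<longleftrightarrow> e \<inter> (\<Union>A \<union> T) \<noteq> {} \<or> A = {} \<and> T = {}"

definition ok_add :: "'a set set \<Rightarrow> 'a set \<Rightarrow> 'a set \<Rightarrow> nat \<Rightarrow> 'a set set \<Rightarrow> 'a set \<Rightarrow> bool" where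
  "ok_add E T D k A e \<longleftrightarrow>
     e \<in> E \<and> e \<notin> A \<and> touches T A e \<and> card (frontier E T D A \<union> e) \<le> k"

text \<open>
  After the move all other edges at \<open>u\<close> are clean, so the searcher that slides along \<open>e\<close> may leave \<open>u\<close>.
\<close>

definition ok_slide ::
  "'a set set \<Rightarrow> 'a set \<Rightarrow> 'a set \<Rightarrow> nat \<Rightarrow> 'a set set \<Rightarrow> 'a set \<Rightarrow> 'a \<Rightarrow> bool" where
  "ok_slide E T D k A e u \<longleftrightarrow>
     e \<in> E \<and> e \<notin> A \<and> u \<in> e \<and> u \<in> frontier E T D A \<and> u \<notin> frontier E T D (insert e A) \<and>
     card (frontier E T D A \<union> e - {u}) \<le> k"

text \<open>
  A slide from a pendant vertex to \<open>u\<close> cleans the pendant edge \<open>e\<close> and, in the same move, all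
  edges from \<open>u\<close> to occupied vertices. The pendant edge then costs nothing, but it is
  connected to the clean part only through another edge \<open>f\<close>. This is the one kind of move
  that cannot be divided into moves cleaning a single edge.
\<close>

definition ok_pend ::
  "'a set set \<Rightarrow> 'a set \<Rightarrow> 'a set \<Rightarrow> nat \<Rightarrow> 'a set set \<Rightarrow> 'a set \<Rightarrow> 'a set \<Rightarrow> 'a \<Rightarrow> bool" where
  "ok_pend E T D k A e f u \<longleftrightarrow>
     e \<in> E \<and> e \<notin> A \<and> f \<in> E \<and> f \<notin> A \<and> e \<noteq> f \<and> u \<in> e \<and> u \<in> f \<and> u \<notin> \<Union>A \<union> T \<and>
     f \<inter> (\<Union>A \<union> T) \<noteq> {} \<and> (e - {u}) \<inter> (T \<union> D) = {} \<and>
     (\<forall>g\<in>E. g \<inter> (e - {u}) \<noteq> {} \<longrightarrow> g = e) \<and> card (frontier E T D A \<union> f) \<le> k"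

inductive step ::
  "'a set set \<Rightarrow> 'a set \<Rightarrow> 'a set \<Rightarrow> nat \<Rightarrow> 'a set set \<Rightarrow> 'a set set \<Rightarrow> bool"
  for E T D k where
  add: "ok_add E T D k A e \<Longrightarrow> step E T D k A (insert e A)"
| slide: "ok_slide E T D k A e u \<Longrightarrow> step E T D k A (insert e A)"
| pend: "ok_pend E T D k A e f u \<Longrightarrow> step E T D k A (insert e (insert f A))"

abbreviation steps :: "'a set set \<Rightarrow> 'a set \<Rightarrow> 'a set \<Rightarrow> nat \<Rightarrow> 'a set set \<Rightarrow> 'a set set \<Rightarrow> bool" where
  "steps E T D k \<equiv> (step E T D k)\<^sup>*\<^sup>*"

definition search :: "'a set set \<Rightarrow> 'a set \<Rightarrow> 'a set \<Rightarrow> nat \<Rightarrow> bool" where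
  "search E T D k \<longleftrightarrow> steps E T D k {} E"

lemma edge_setD: "edge_set E \<Longrightarrow> finite E" "edge_set E \<Longrightarrow> e \<in> E \<Longrightarrow> card e = 2"
  "edge_set E \<Longrightarrow> e \<in> E \<Longrightarrow> finite e"
  unfolding edge_set_def by (auto intro: card_ge_0_finite)

lemma edge_set_finite_Union: "edge_set E \<Longrightarrow> finite (\<Union>E)"
  using edge_setD by blast

lemma edge_other:
  assumes "card e = 2" "u \<in> e"
  obtains w where "e = {u, w}" "u \<noteq> w"
  using assms by (metis card_2_iff doubleton_eq_iff insert_iff singletonD)

lemma step_edges: "step E T D k A A' \<Longrightarrow> A \<subseteq> E \<Longrightarrow> A' \<subseteq> E"
  by (induction rule: step.cases) (auto simp: ok_add_def ok_slide_def ok_pend_def)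

lemma steps_edges: "steps E T D k A A' \<Longrightarrow> A \<subseteq> E \<Longrightarrow> A' \<subseteq> E"
  by (induction rule: rtranclp_induct) (auto dest: step_edges)

lemma step_mono: "step E T D k A A' \<Longrightarrow> A \<subseteq> A'"
  by (induction rule: step.cases) auto

lemma frontier_subset: "A \<subseteq> E \<Longrightarrow> frontier E T D A \<subseteq> \<Union>E \<union> T"
  unfolding frontier_def by auto

lemma frontier_insert: "frontier E T D (insert e A) \<subseteq> frontier E T D A \<union> e"
  unfolding frontier_def by auto

text \<open>
  Searching \<open>E\<close> inside a larger graph \<open>E'\<close> in which \<open>B\<close> is already clean: what \<open>E\<close> sees of the rest is
  recorded in \<open>T\<close> and \<open>D\<close>, and only the frontier vertices \<open>S\<close> away from \<open>E\<close> cost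
  additional searchers.
\<close>

lemma step_embed:
  assumes st: "step E T D k A A'" and A: "A \<subseteq> E"
    and E: "edge_set E" and sub: "E \<subseteq> E'" and B: "B \<subseteq> E' - E"
    and T: "T \<inter> \<Union>E = (\<Union>B \<union> T') \<inter> \<Union>E"
    and D: "D \<inter> \<Union>E = (\<Union>(E' - E - B) \<union> D') \<inter> \<Union>E"
    and start: "T = {} \<Longrightarrow> B = {} \<and> T' = {}" and finT: "finite T"
    and S: "(\<Union>B \<union> T') \<inter> (\<Union>(E' - E - B) \<union> D') - \<Union>E \<subseteq> T \<inter> D \<union> S"
    and fin: "finite S" and k: "k + card S \<le> k'"
  shows "step E' T' D' k' (A \<union> B) (A' \<union> B)"
proof -
  have fr: "frontier E' T' D' (C \<union> B) \<inter> \<Union>E = frontier E T D C \<inter> \<Union>E"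
    "frontier E' T' D' (C \<union> B) \<subseteq> frontier E T D C \<union> S" if "C \<subseteq> E" for C
  proof -
    have *: "E' - (C \<union> B) = (E - C) \<union> (E' - E - B)" using sub B that by auto
    have "x \<in> \<Union>C \<union> T \<longleftrightarrow> x \<in> \<Union>(C \<union> B) \<union> T'" if "x \<in> \<Union>E" for x using T that by blast
    moreover have "x \<in> \<Union>(E - C) \<union> D \<longleftrightarrow> x \<in> \<Union>(E' - (C \<union> B)) \<union> D'" if "x \<in> \<Union>E" for x
      unfolding * using D that by blast
    ultimately show 1: "frontier E' T' D' (C \<union> B) \<inter> \<Union>E = frontier E T D C \<inter> \<Union>E"
      unfolding frontier_def by blast
    have "frontier E' T' D' (C \<union> B) - \<Union>E \<subseteq> (\<Union>B \<union> T') \<inter> (\<Union>(E' - E - B) \<union> D') - \<Union>E"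
      unfolding frontier_def * using that by blast
    then show "frontier E' T' D' (C \<union> B) \<subseteq> frontier E T D C \<union> S"
      using S 1 unfolding frontier_def by blast
  qed
  have fin': "finite (frontier E T D C)" if "C \<subseteq> E" for C
    using frontier_subset[OF that] edge_set_finite_Union[OF E] finT
    by (meson finite_UnI finite_subset)
  have card: "card Y \<le> k'" if "card X \<le> k" "Y \<subseteq> X \<union> S" "finite X" for X Y
  proof -
    have "card Y \<le> card (X \<union> S)" using that fin by (intro card_mono) auto
    then show ?thesis using card_Un_le[of X S] k that by linarith
  qed
  have tch: "touches T' (A \<union> B) e" if te: "touches T A e" "e \<in> E" for e
  proof (cases "A = {} \<and> T = {}")
    case True then show ?thesis using start unfolding touches_def by simp
  next
    case False
    then obtain x where x: "x \<in> e" "x \<in> \<Union>A \<union> T" using te unfolding touches_def by blast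
    then have "x \<in> \<Union>A \<or> x \<in> T \<inter> \<Union>E" using te by blast
    then have "x \<in> \<Union>(A \<union> B) \<union> T'" using T by blast
    then show ?thesis using x unfolding touches_def by blast
  qed
  have notB: "e \<notin> B" if "e \<in> E" for e using B that by auto
  from st show ?thesis
  proof cases
    case (add e)
    then have e: "e \<in> E" "e \<notin> A" "touches T A e" "card (frontier E T D A \<union> e) \<le> k"
      unfolding ok_add_def by auto
    have "card (frontier E' T' D' (A \<union> B) \<union> e) \<le> k'"
      by (rule card[OF e(4)]) (use fr(2)[OF A] fin'[OF A] edge_setD(3)[OF E e(1)] in auto)
    then have "ok_add E' T' D' k' (A \<union> B) e"
      using tch e notB[of e] sub unfolding ok_add_def by blast
    then show ?thesis using add step.add by fastforce
  next
    case (slide e u)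
    then have e: "e \<in> E" "e \<notin> A" "u \<in> e" "u \<in> frontier E T D A"
      "u \<notin> frontier E T D (insert e A)" "card (frontier E T D A \<union> e - {u}) \<le> k"
      unfolding ok_slide_def by auto
    have *: "insert e (A \<union> B) = insert e A \<union> B" "insert e A \<subseteq> E" using e A by auto
    have uE: "u \<in> \<Union>E" using e by auto
    have "card (frontier E' T' D' (A \<union> B) \<union> e - {u}) \<le> k'"
      by (rule card[OF e(6)]) (use fr(2)[OF A] fin'[OF A] edge_setD(3)[OF E e(1)] in auto)
    moreover have "u \<in> frontier E' T' D' (A \<union> B)" using fr(1)[OF A] e(4) uE by blast
    moreover have "u \<notin> frontier E' T' D' (insert e (A \<union> B))"
      unfolding * using fr(1)[OF *(2)] e(5) uE by blast
    ultimately have "ok_slide E' T' D' k' (A \<union> B) e u"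
      using e notB[of e] sub unfolding ok_slide_def by blast
    then show ?thesis using slide step.slide by fastforce
  next
    case (pend e f u)
    then have p: "e \<in> E" "e \<notin> A" "f \<in> E" "f \<notin> A" "e \<noteq> f" "u \<in> e" "u \<in> f" "u \<notin> \<Union>A \<union> T"
     "f \<inter> (\<Union>A \<union> T) \<noteq> {}" "(e - {u}) \<inter> (T \<union> D) = {}"
     "\<And>g. g\<in>E \<Longrightarrow> g \<inter> (e - {u}) \<noteq> {} \<Longrightarrow> g = e" "card (frontier E T D A \<union> f) \<le> k"
      unfolding ok_pend_def by auto
    have u: "u \<notin> \<Union>(A \<union> B) \<union> T'" using p(1,6,8) T by blast
    have ff: "f \<inter> (\<Union>(A \<union> B) \<union> T') \<noteq> {}" using p(3,9) T by blast
    have eE: "e \<subseteq> \<Union>E" using p(1) by auto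
    have e1: "(e - {u}) \<inter> (T' \<union> D') = {}" using p(10) eE T D by blast
    have e2: "g = e" if g: "g \<in> E'" "g \<inter> (e - {u}) \<noteq> {}" for g
    proof (cases "g \<in> E")
      case True then show ?thesis using p(11) g by auto
    next
      case False
      then have "g \<inter> (e - {u}) \<subseteq> T \<union> D" using g eE T D by blast
      then show ?thesis using g p(10) by blast
    qed
    have "card (frontier E' T' D' (A \<union> B) \<union> f) \<le> k'"
      by (rule card[OF p(12)]) (use fr(2)[OF A] fin'[OF A] edge_setD(3)[OF E p(3)] in auto)
    then have "ok_pend E' T' D' k' (A \<union> B) e f u"
      unfolding ok_pend_def using p(1-7) notB sub u ff e1 e2 by blast
    then show ?thesis using pend step.pend by fastforce
  qed
qed

lemma phase:
  assumes "search E T D k" "edge_set E" "E \<subseteq> E'" "B \<subseteq> E' - E"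
    "T \<inter> \<Union>E = (\<Union>B \<union> T') \<inter> \<Union>E" "D \<inter> \<Union>E = (\<Union>(E' - E - B) \<union> D') \<inter> \<Union>E"
    "T = {} \<Longrightarrow> B = {} \<and> T' = {}" "finite T"
    "(\<Union>B \<union> T') \<inter> (\<Union>(E' - E - B) \<union> D') - \<Union>E \<subseteq> T \<inter> D \<union> S"
    "finite S" "k + card S \<le> k'"
  shows "steps E' T' D' k' B (E \<union> B)"
proof -
  have "steps E T D k {} E" using assms(1) unfolding search_def .
  then have "steps E' T' D' k' ({} \<union> B) (E \<union> B)"
  proof (induction rule: rtranclp_induct)
    case (step A A')
    from steps_edges[OF step(1)] have "A \<subseteq> E" by blast
    from step_embed[OF step(2) this assms(2-11)]
    have "step E' T' D' k' (A \<union> B) (A' \<union> B)" .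
    with step(3) show ?case by (rule rtranclp.rtrancl_into_rtrancl)
  qed simp
  then show ?thesis by simp
qed

text \<open>
  One more searcher can stay on the root for the whole search. Slides that leave the root
  turn into placements.
\<close>

lemma guard_root:
  assumes "search E {r} {} k" "edge_set E"
  shows "search E {r} {r} (Suc k)"
proof -
  have fr: "frontier E {r} {r} A = insert r (frontier E {r} {} A)" for A
    unfolding frontier_def by auto
  have c: "card (insert r X) \<le> Suc k" if "card X \<le> k" for X
    using card_insert_le_m1[of "Suc k" X r] that by simp
  have "step E {r} {r} (Suc k) A A'" if "step E {r} {} k A A'" for A A'
    using that
  proof cases
    case (add e)
    then have "ok_add E {r} {r} (Suc k) A e"
      unfolding ok_add_def fr by (auto intro: c)
    then show ?thesis using add step.add by fastforce
  next
    case (slide e u)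
    show ?thesis
    proof (cases "u = r")
      case True
      have "frontier E {r} {r} A \<union> e = insert r (frontier E {r} {} A \<union> e - {u})"
        using slide True unfolding fr ok_slide_def by auto
      then have "ok_add E {r} {r} (Suc k) A e"
        using slide c[of "frontier E {r} {} A \<union> e - {u}"] True
        unfolding ok_slide_def ok_add_def touches_def by auto
      then show ?thesis using slide step.add by fastforce
    next
      case False
      have "frontier E {r} {r} A \<union> e - {u} = insert r (frontier E {r} {} A \<union> e - {u})"
        using slide False unfolding fr ok_slide_def by auto
      moreover have "card (frontier E {r} {} A \<union> e - {u}) \<le> k"
        using slide unfolding ok_slide_def by blast
      ultimately have "card (frontier E {r} {r} A \<union> e - {u}) \<le> Suc k" using c by metis
      moreover have "u \<in> frontier E {r} {r} A" "u \<notin> frontier E {r} {r} (insert e A)"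
        using slide False unfolding ok_slide_def fr by blast+
      ultimately have "ok_slide E {r} {r} (Suc k) A e u"
        using slide unfolding ok_slide_def by blast
      then show ?thesis using slide step.slide by fastforce
    qed
  next
    case (pend e f u)
    then have "ok_pend E {r} {r} (Suc k) A e f u"
      unfolding ok_pend_def fr by (auto intro: c)
    then show ?thesis using pend step.pend by fastforce
  qed
  then have "step E {r} {} k \<le> step E {r} {r} (Suc k)" by blast
  from rtranclp_mono[OF this] assms(1) show ?thesis unfolding search_def by blast
qed

section \<open>Searches and contractions\<close>

definition img :: "('a \<Rightarrow> 'b) \<Rightarrow> 'a set set \<Rightarrow> 'b set set" where
  "img \<phi> E = {e'. \<exists>e\<in>E. e' = \<phi> ` e \<and> card (\<phi> ` e) = 2}"

text \<open>
  The fibres of \<open>\<phi>\<close> are connected. The set \<open>X\<close> brings in vertices that need not lie on an edge.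
\<close>

definition fibres :: "('a \<Rightarrow> 'b) \<Rightarrow> 'a set set \<Rightarrow> 'a set \<Rightarrow> bool" where
  "fibres \<phi> E X \<longleftrightarrow>
     (\<forall>x\<in>\<Union>E \<union> X. \<forall>y\<in>\<Union>E \<union> X. \<phi> x = \<phi> y \<longrightarrow> (x, y) \<in> {(s, t). {s, t} \<in> E \<and> \<phi> s = \<phi> t}\<^sup>*)"

lemma img_empty [simp]: "img \<phi> {} = {}"
  unfolding img_def by auto

lemma img_insert: "img \<phi> (insert e A) = (if card (\<phi> ` e) = 2 then insert (\<phi> ` e) (img \<phi> A) else img \<phi> A)"
  unfolding img_def by auto

lemma img_Un: "img \<phi> (A \<union> B) = img \<phi> A \<union> img \<phi> B"
  unfolding img_def by auto

lemma img_mono: "A \<subseteq> B \<Longrightarrow> img \<phi> A \<subseteq> img \<phi> B"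
  unfolding img_def by auto

lemma edge_set_img: "edge_set E \<Longrightarrow> edge_set (img \<phi> E)"
proof -
  assume "edge_set E"
  then have "finite ((`) \<phi> ` E)" unfolding edge_set_def by auto
  moreover have "img \<phi> E \<subseteq> (`) \<phi> ` E" unfolding img_def by auto
  ultimately show ?thesis unfolding edge_set_def using finite_subset by (auto simp: img_def)
qed

lemma Union_img: "\<Union>(img \<phi> E) \<subseteq> \<phi> ` \<Union>E"
  unfolding img_def by auto

text \<open>
  On a path inside a fibre that leads from a vertex meeting a clean edge to one meeting
  a contaminated edge, some vertex meets both. Connectedness of the fibres is used here and for pendant vertices.
\<close>

lemma frontier_img:
  assumes fib: "fibres \<phi> E (T \<union> D)" and A: "A \<subseteq> E"
  shows "frontier (img \<phi> E) (\<phi> ` T) (\<phi> ` D) (img \<phi> A) \<subseteq> \<phi> ` frontier E T D A"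
proof
  fix w assume w: "w \<in> frontier (img \<phi> E) (\<phi> ` T) (\<phi> ` D) (img \<phi> A)"
  from w have "w \<in> \<Union>(img \<phi> A) \<union> \<phi> ` T" unfolding frontier_def by auto
  then obtain x where x: "x \<in> \<Union>A \<union> T" "\<phi> x = w" unfolding img_def by auto
  from w have "w \<in> \<Union>(img \<phi> E - img \<phi> A) \<union> \<phi> ` D" unfolding frontier_def by auto
  then obtain y where y: "y \<in> \<Union>(E - A) \<union> D" "\<phi> y = w"
    unfolding img_def by auto
  have "x \<in> \<Union>E \<union> (T \<union> D)" "y \<in> \<Union>E \<union> (T \<union> D)" using x y A by auto
  from fib[unfolded fibres_def, rule_format, OF this]
  have "(x, y) \<in> {(s, t). {s, t} \<in> E \<and> \<phi> s = \<phi> t}\<^sup>*" using x(2) y(2) by simp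
  then have "x \<in> \<Union>A \<union> T \<longrightarrow> (\<exists>z. z \<in> frontier E T D A \<and> \<phi> z = w)"
  proof (induction rule: converse_rtrancl_induct)
    case base
    then show ?case using y unfolding frontier_def by auto
  next
    case (step s t)
    show ?case
    proof
      assume s: "s \<in> \<Union>A \<union> T"
      show "\<exists>z. z \<in> frontier E T D A \<and> \<phi> z = w"
      proof (cases "{s, t} \<in> A")
        case True
        then have "t \<in> \<Union>A \<union> T" by auto
        then show ?thesis using step by auto
      next
        case False
        have "(t, y) \<in> {(s, t). {s, t} \<in> E \<and> \<phi> s = \<phi> t}\<^sup>*" using step by auto
        then have "\<phi> t = \<phi> y" by (induction rule: rtrancl_induct) auto
        then have "\<phi> s = w" using step y by auto
        moreover have "s \<in> frontier E T D A" using s False step unfolding frontier_def by auto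
        ultimately show ?thesis by auto
      qed
    qed
  qed
  then show "w \<in> \<phi> ` frontier E T D A" using x(1) by blast
qed

text \<open>
  Contracted edges disappear, so a vertex reached through them could fail to meet any clean
  edge of the image. This only happens at the very beginning, as long as the whole clean part
  lies in a single fibre.
\<close>

definition seen_img :: "('a \<Rightarrow> 'b) \<Rightarrow> 'a set \<Rightarrow> 'a set set \<Rightarrow> bool" where
  "seen_img \<phi> T A \<longleftrightarrow> (\<forall>x\<in>\<Union>A \<union> T. \<phi> x \<in> \<Union>(img \<phi> A) \<union> \<phi> ` T) \<or>
     img \<phi> A = {} \<and> T = {} \<and> (\<exists>c. \<forall>x\<in>\<Union>A. \<phi> x = c)"

lemma image_edge:
  assumes "card e = 2"
  shows "card (\<phi> ` e) = 2 \<or> (\<exists>c. \<phi> ` e = {c})"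
proof -
  obtain x y where "e = {x, y}" "x \<noteq> y" using assms by (meson card_2_iff)
  then show ?thesis by (cases "\<phi> x = \<phi> y") (auto simp: card_2_iff)
qed

lemma seen_img_insert:
  assumes J: "seen_img \<phi> T A" and t: "touches T A e" and e: "card e = 2"
  shows "seen_img \<phi> T (insert e A)"
proof (cases "\<forall>x\<in>\<Union>A \<union> T. \<phi> x \<in> \<Union>(img \<phi> A) \<union> \<phi> ` T")
  case True
  show ?thesis
  proof (cases "card (\<phi> ` e) = 2")
    case 2: True
    then show ?thesis using True unfolding seen_img_def img_insert by auto
  next
    case False
    then obtain c where c: "\<phi> ` e = {c}" using image_edge[OF e, of \<phi>] by auto
    then have c': "\<phi> z = c" if "z \<in> e" for z using that by auto
    show ?thesis
    proof (cases "e \<inter> (\<Union>A \<union> T) = {}")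
      case True
      then have "A = {}" "T = {}" using t unfolding touches_def by auto
      then show ?thesis using False c' unfolding seen_img_def img_insert by auto
    next
      case ne: False
      then obtain x where x: "x \<in> e" "x \<in> \<Union>A \<union> T" by auto
      have "\<phi> z \<in> \<Union>(img \<phi> A) \<union> \<phi> ` T" if "z \<in> e" for z
        using c'[OF that] c'[OF x(1)] True x(2) by metis
      then show ?thesis using True False unfolding seen_img_def img_insert by auto
    qed
  qed
next
  case False
  then obtain c where c: "img \<phi> A = {}" "T = {}" "\<forall>x\<in>\<Union>A. \<phi> x = c"
    using J unfolding seen_img_def by blast
  show ?thesis
  proof (cases "card (\<phi> ` e) = 2")
    case True
    have "\<phi> z \<in> \<phi> ` e" if z: "z \<in> \<Union>A" for z
    proof -
      obtain x where "x \<in> e" "x \<in> \<Union>A" using t c z unfolding touches_def by auto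
      then show ?thesis using c z by force
    qed
    then have "\<forall>x\<in>\<Union>(insert e A) \<union> T. \<phi> x \<in> \<Union>(img \<phi> (insert e A)) \<union> \<phi> ` T"
      using True c(2) unfolding img_insert by auto
    then show ?thesis unfolding seen_img_def by blast
  next
    case F: False
    then obtain d where d: "\<phi> ` e = {d}" using image_edge[OF e, of \<phi>] by auto
    have "\<phi> z = d" if z: "z \<in> \<Union>(insert e A)" for z
    proof (cases "z \<in> e")
      case True then show ?thesis using d by auto
    next
      case zz: False
      then obtain x where "x \<in> e" "x \<in> \<Union>A" using t c z unfolding touches_def by auto
      then have "\<phi> x = d" "\<phi> x = c" using c d by blast+
      then have "d = c" by simp
      then show ?thesis using c zz z by auto
    qed
    then show ?thesis using F c unfolding seen_img_def img_insert by auto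
  qed
qed

lemma touches_img:
  assumes J: "seen_img \<phi> T A" and t: "touches T A e"
  shows "touches (\<phi> ` T) (img \<phi> A) (\<phi> ` e)"
proof (cases "\<forall>x\<in>\<Union>A \<union> T. \<phi> x \<in> \<Union>(img \<phi> A) \<union> \<phi> ` T")
  case True
  show ?thesis
  proof (cases "e \<inter> (\<Union>A \<union> T) = {}")
    case True
    then have "A = {}" "T = {}" using t unfolding touches_def by auto
    then show ?thesis unfolding touches_def by auto
  next
    case False
    then obtain x where "x \<in> e" "x \<in> \<Union>A \<union> T" by auto
    then have "\<phi> x \<in> \<phi> ` e \<inter> (\<Union>(img \<phi> A) \<union> \<phi> ` T)" using True by blast
    then show ?thesis unfolding touches_def by blast
  qed
next
  case False
  then show ?thesis using J unfolding seen_img_def touches_def by blast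
qed

lemma img_add:
  assumes E: "edge_set E" and A: "A \<subseteq> E" and J: "seen_img \<phi> T A" and e: "e \<in> E"
    and t: "touches T A e"
    and c: "card (frontier (img \<phi> E) (\<phi> ` T) (\<phi> ` D) (img \<phi> A) \<union> \<phi> ` e) \<le> k"
  shows "steps (img \<phi> E) (\<phi> ` T) (\<phi> ` D) k (img \<phi> A) (img \<phi> (insert e A))"
proof (cases "card (\<phi> ` e) = 2 \<and> \<phi> ` e \<notin> img \<phi> A")
  case True
  then have "ok_add (img \<phi> E) (\<phi> ` T) (\<phi> ` D) k (img \<phi> A) (\<phi> ` e)"
    unfolding ok_add_def using touches_img[OF J t] c e by (auto simp: img_def)
  then show ?thesis using True step.add by (fastforce simp: img_insert)
next
  case False
  then show ?thesis by (auto simp: img_insert insert_absorb)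
qed

text \<open>
  A step cleaning \<open>e\<close> becomes a step cleaning the image of \<open>e\<close>, or nothing if that image is
  contracted or already clean. A slide may turn into a placement: if its origin stays on the
  frontier of the image, then another vertex of the same fibre lies on the old frontier, and this saves
  one searcher.
\<close>

lemma step_img:
  assumes E: "edge_set E" and fib: "fibres \<phi> E (T \<union> D)" and A: "A \<subseteq> E"
    and T: "finite T" and k: "2 \<le> k"
    and J: "seen_img \<phi> T A" and st: "step E T D k A A'"
  shows "steps (img \<phi> E) (\<phi> ` T) (\<phi> ` D) k (img \<phi> A) (img \<phi> A') \<and> seen_img \<phi> T A'"
proof -
  let ?S = "steps (img \<phi> E) (\<phi> ` T) (\<phi> ` D) k"
  let ?F = "frontier E T D"
  let ?FH = "\<lambda>A. frontier (img \<phi> E) (\<phi> ` T) (\<phi> ` D) (img \<phi> A)"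
  have FH: "?FH B \<subseteq> \<phi> ` ?F B" if "B \<subseteq> E" for B
    using frontier_img[OF fib that] .
  have finF: "finite (?F B)" if "B \<subseteq> E" for B
    using frontier_subset[OF that, of T D] T edge_set_finite_Union[OF E]
    by (meson finite_UnI finite_subset)
  have le: "card X \<le> k" if "X \<subseteq> \<phi> ` Y" "finite Y" "card Y \<le> k" for X Y
    using that by (meson card_image_le card_mono finite_imageI le_trans)
  from st show ?thesis
  proof cases
    case (add e)
    then have e: "e \<in> E" "touches T A e" "card (?F A \<union> e) \<le> k" unfolding ok_add_def by auto
    have "card (?FH A \<union> \<phi> ` e) \<le> k"
      by (rule le[OF _ _ e(3)]) (use FH[OF A] finF[OF A] edge_setD(3)[OF E e(1)] in auto)
    from img_add[OF E A J e(1,2) this] seen_img_insert[OF J e(2)] edge_setD(2)[OF E e(1)]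
    show ?thesis using add by auto
  next
    case (slide e u)
    then have e: "e \<in> E" "e \<notin> A" "u \<in> e" "u \<in> ?F A" "u \<notin> ?F (insert e A)" "card (?F A \<union> e - {u}) \<le> k"
      unfolding ok_slide_def by auto
    have fine: "finite e" "card e = 2" using edge_setD[OF E] e by auto
    have t: "touches T A e" using e unfolding touches_def frontier_def by auto
    have J': "seen_img \<phi> T A'" using seen_img_insert[OF J t fine(2)] slide by auto
    let ?e = "\<phi> ` e" let ?u = "\<phi> u"
    have "?S (img \<phi> A) (img \<phi> A')"
    proof (cases "card ?e = 2 \<and> ?e \<notin> img \<phi> A")
      case False
      then show ?thesis using slide by (auto simp: img_insert insert_absorb)
    next
      case True
      then have eH: "?e \<in> img \<phi> E" "?e \<notin> img \<phi> A" using e by (auto simp: img_def)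
      have A': "img \<phi> A' = insert ?e (img \<phi> A)" using True slide by (simp add: img_insert)
      show ?thesis
      proof (cases "card (?FH A \<union> ?e) \<le> k")
        case True
        then show ?thesis using img_add[OF E A J e(1) t] slide by auto
      next
        case big: False
        have "?u \<in> ?FH A"
        proof -
          have "u \<in> \<Union>A \<union> T" using e unfolding frontier_def by auto
          moreover have "\<not> (img \<phi> A = {} \<and> T = {})"
          proof
            assume "img \<phi> A = {} \<and> T = {}"
            then have "?FH A = {}" unfolding frontier_def by auto
            then show False using big True k by auto
          qed
          ultimately have "?u \<in> \<Union>(img \<phi> A) \<union> \<phi> ` T" using J unfolding seen_img_def by blast
          then show ?thesis using eH e(3) unfolding frontier_def by blast
        qed
        moreover have "?u \<notin> ?FH A'"
        proof
          assume "?u \<in> ?FH A'"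
          moreover have "A' \<subseteq> E" using A e slide by auto
          ultimately have "?u \<in> \<phi> ` ?F A'" using FH by blast
          then obtain z where z: "z \<in> ?F A'" "\<phi> z = ?u" by auto
          then have "z \<in> ?F A \<union> e - {u}" using frontier_insert e slide by fastforce
          then have "?u \<in> \<phi> ` (?F A \<union> e - {u})" using z(2) by (metis image_eqI)
          then have "\<phi> ` (?F A \<union> e) \<subseteq> \<phi> ` (?F A \<union> e - {u})" by blast
          then have "?FH A \<union> ?e \<subseteq> \<phi> ` (?F A \<union> e - {u})" using FH[OF A] by blast
          from le[OF this _ e(6)] big finF[OF A] fine show False by auto
        qed
        moreover have "card (?FH A \<union> ?e - {?u}) \<le> k"
          by (rule le[OF _ _ e(6)]) (use FH[OF A] finF[OF A] fine in auto)
        ultimately have "ok_slide (img \<phi> E) (\<phi> ` T) (\<phi> ` D) k (img \<phi> A) ?e ?u"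
          using eH e(3) unfolding ok_slide_def A' by auto
        then show ?thesis unfolding A' using step.slide by fastforce
      qed
    qed
    then show ?thesis using J' by auto
  next
    case (pend e f u)
    then have p: "e \<in> E" "e \<notin> A" "f \<in> E" "f \<notin> A" "e \<noteq> f" "u \<in> e" "u \<in> f" "u \<notin> \<Union>A \<union> T"
     "f \<inter> (\<Union>A \<union> T) \<noteq> {}" "(e - {u}) \<inter> (T \<union> D) = {}"
     "\<And>g. g\<in>E \<Longrightarrow> g \<inter> (e - {u}) \<noteq> {} \<Longrightarrow> g = e" "card (?F A \<union> f) \<le> k"
      unfolding ok_pend_def by auto
    obtain p where ep: "e = {u, p}" "u \<noteq> p" using edge_other edge_setD(2)[OF E p(1)] p(6) by metis
    obtain y where fy: "f = {u, y}" "u \<noteq> y" using edge_other edge_setD(2)[OF E p(3)] p(7) by metis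
    have y: "y \<in> \<Union>A \<union> T" using p(8,9) fy by auto
    have yF: "y \<in> ?F A" using y p(3,4) fy unfolding frontier_def by auto
    have uF: "u \<notin> ?F A" using p(8) unfolding frontier_def by auto
    have pT: "p \<notin> T" "p \<notin> D" using p(10) ep by auto
    have only: "g = e" if "g \<in> E" "p \<in> g" for g using p(11)[OF that(1)] that ep by auto
    have cF: "card (?F A) < k"
      using p(12) yF uF fy finF[OF A] by (auto simp: insert_absorb)
    have fins: "finite (?F A)" by (rule finF[OF A])
    have tf: "touches T A f" using y fy unfolding touches_def by auto
    have Jf: "seen_img \<phi> T (insert f A)" using seen_img_insert[OF J tf] edge_setD(2)[OF E p(3)] by auto
    have te: "touches T (insert f A) e" using ep fy unfolding touches_def by auto
    have Je: "seen_img \<phi> T A'" using seen_img_insert[OF Jf te] edge_setD(2)[OF E p(1)] pend by auto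
    have fA: "insert f A \<subseteq> E" using A p by auto
    have cost: "card X \<le> k" if "X \<subseteq> insert z (\<phi> ` ?F A)" for X z
    proof -
      have "card X \<le> card (insert z (\<phi> ` ?F A))" using that fins by (intro card_mono) auto
      also have "\<dots> \<le> Suc (card (\<phi> ` ?F A))" by (simp add: card_insert_if fins)
      also have "\<dots> \<le> k" using card_image_le[OF fins, of \<phi>] cF by linarith
      finally show ?thesis .
    qed
    have stepf: "?S (img \<phi> A) (img \<phi> (insert f A))"
      by (rule img_add[OF E A J p(3) tf]) (rule cost[of _ "\<phi> u"], use FH[OF A] yF fy in auto)
    have FHf: "?FH (insert f A) \<subseteq> ?FH A \<union> \<phi> ` f"
      unfolding frontier_def img_insert by auto
    have stepe: "?S (img \<phi> (insert f A)) (img \<phi> A')" if "\<phi> u \<in> \<phi> ` ?F A"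
      unfolding pend(1)
      by (rule img_add[OF E fA Jf p(1) te], rule cost[of _ "\<phi> p"])
        (use FHf FH[OF A] yF fy ep that in auto)
    have "?S (img \<phi> A) (img \<phi> A')"
    proof (cases "\<phi> u = \<phi> p")
      case True
      then have "img \<phi> A' = img \<phi> (insert f A)" using ep pend by (auto simp: img_insert)
      then show ?thesis using stepf by simp
    next
      case up: False
      have pV: "p \<in> \<Union>E" using p(1) ep by auto
      have fibp: "x = p" if "\<phi> x = \<phi> p" "x \<in> \<Union>E \<union> (T \<union> D)" for x
      proof -
        have "(p, x) \<in> {(s, t). {s, t} \<in> E \<and> \<phi> s = \<phi> t}\<^sup>*"
          using fib[unfolded fibres_def, rule_format, OF UnI1[OF pV] that(2)] that(1) by simp
        then show ?thesis
        proof (cases rule: converse_rtranclE)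
          case (step t)
          then have "{p, t} \<in> E" "\<phi> p = \<phi> t" by auto
          then show ?thesis using only[of "{p, t}"] ep up by (auto simp: doubleton_eq_iff)
        qed auto
      qed
      have c2: "card (\<phi> ` e) = 2" using up ep by simp
      have eH: "\<phi> ` e \<in> img \<phi> E" using p(1) c2 by (auto simp: img_def)
      have onlyH: "g = \<phi> ` e" if g: "g \<in> img \<phi> E" "\<phi> p \<in> g" for g
      proof -
        obtain g' where g': "g' \<in> E" "g = \<phi> ` g'" using g by (auto simp: img_def)
        then obtain x where "x \<in> g'" "\<phi> x = \<phi> p" using g by force
        then show ?thesis using g' fibp[of x] only[of g'] by auto
      qed
      have enA: "\<phi> ` e \<notin> img \<phi> A"
      proof
        assume "\<phi> ` e \<in> img \<phi> A"
        then obtain g' where g': "g' \<in> A" "\<phi> ` e = \<phi> ` g'" by (auto simp: img_def)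
        then obtain x where "x \<in> g'" "\<phi> x = \<phi> p" using ep by force
        then show False using g' fibp[of x] only[of g'] A p(2) by auto
      qed
      show ?thesis
      proof (cases "\<phi> u \<in> \<phi> ` ?F A")
        case True
        then show ?thesis using stepf stepe by auto
      next
        case uu: False
        then have uy: "\<phi> u \<noteq> \<phi> y" using yF by auto
        then have c2f: "card (\<phi> ` f) = 2" using fy by simp
        have uN: "\<phi> u \<notin> \<Union>(img \<phi> A) \<union> \<phi> ` T"
        proof
          assume "\<phi> u \<in> \<Union>(img \<phi> A) \<union> \<phi> ` T"
          then have "\<phi> u \<in> ?FH A" using eH enA ep unfolding frontier_def by auto
          then show False using FH[OF A] uu by auto
        qed
        have fN: "\<phi> ` f \<notin> img \<phi> A" using uN fy by auto
        have fH: "\<phi> ` f \<in> img \<phi> E" using p(3) c2f by (auto simp: img_def)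
        have ne: "\<phi> ` e \<noteq> \<phi> ` f"
        proof
          assume "\<phi> ` e = \<phi> ` f"
          then have "\<phi> y = \<phi> p" using ep fy up uy by (auto simp: doubleton_eq_iff)
          then have "y = p" using fibp[of y] p(3) fy by auto
          then show False using only[of f] p(3,5) fy by auto
        qed
        have A'eq: "img \<phi> A' = insert (\<phi> ` e) (insert (\<phi> ` f) (img \<phi> A))"
          using pend c2 c2f by (simp add: img_insert)
        have pN: "\<phi> p \<notin> \<phi> ` T" "\<phi> p \<notin> \<phi> ` D" using fibp pT by (metis UnI1 UnI2 imageE)+
        show ?thesis
        proof (cases "\<phi> y \<in> \<Union>(img \<phi> A) \<union> \<phi> ` T")
          case True
          have e1: "\<phi> ` e - {\<phi> u} = {\<phi> p}" using ep up by auto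
          have "ok_pend (img \<phi> E) (\<phi> ` T) (\<phi> ` D) k (img \<phi> A) (\<phi> ` e) (\<phi> ` f) (\<phi> u)"
            unfolding ok_pend_def e1
          proof (intro conjI)
            show "\<forall>g\<in>img \<phi> E. g \<inter> {\<phi> p} \<noteq> {} \<longrightarrow> g = \<phi> ` e" using onlyH by auto
            show "card (?FH A \<union> \<phi> ` f) \<le> k"
              by (rule cost[of _ "\<phi> u"]) (use FH[OF A] yF fy in auto)
            show "\<phi> ` f \<inter> (\<Union> (img \<phi> A) \<union> \<phi> ` T) \<noteq> {}" using True fy by auto
          qed (use eH enA fH fN ne p(6,7) uN pN in auto)
          then show ?thesis unfolding A'eq using step.pend by fastforce
        next
          case False
          \<comment> \<open>Nothing is clean in the image yet, so the pendant edge may be cleaned first.\<close>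
          then have em: "img \<phi> A = {}" "T = {}" using J y unfolding seen_img_def by auto
          have "?FH A = {}" using em unfolding frontier_def by auto
          then have "ok_add (img \<phi> E) (\<phi> ` T) (\<phi> ` D) k (img \<phi> A) (\<phi> ` e)"
            using em eH c2 k unfolding ok_add_def touches_def by auto
          then have 1: "step (img \<phi> E) (\<phi> ` T) (\<phi> ` D) k (img \<phi> A) {\<phi> ` e}"
            using step.add em by fastforce
          have "\<phi> p \<notin> \<Union>(img \<phi> E - {\<phi> ` e})" using onlyH by auto
          then have "frontier (img \<phi> E) (\<phi> ` T) (\<phi> ` D) {\<phi> ` e} \<subseteq> {\<phi> u}"
            using ep pN em unfolding frontier_def by auto
          then have "frontier (img \<phi> E) (\<phi> ` T) (\<phi> ` D) {\<phi> ` e} \<union> \<phi> ` f = \<phi> ` f" using fy by auto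
          then have "ok_add (img \<phi> E) (\<phi> ` T) (\<phi> ` D) k {\<phi> ` e} (\<phi> ` f)"
            using fH ne c2f k ep fy unfolding ok_add_def touches_def by auto
          then have "step (img \<phi> E) (\<phi> ` T) (\<phi> ` D) k {\<phi> ` e} {\<phi> ` f, \<phi> ` e}"
            using step.add by fastforce
          moreover have "img \<phi> A' = {\<phi> ` f, \<phi> ` e}" using A'eq em by auto
          ultimately show ?thesis using 1 by (metis converse_rtranclp_into_rtranclp r_into_rtranclp)
        qed
      qed
    qed
    then show ?thesis using Je by auto
  qed
qed

text \<open>
  Contractions need no more searchers than the graph itself; the same lemma allows blocks to be renamed.
\<close>

lemma search_img:
  assumes "search E T D k" "edge_set E" "fibres \<phi> E (T \<union> D)" "finite T" "2 \<le> k"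
  shows "search (img \<phi> E) (\<phi> ` T) (\<phi> ` D) k"
proof -
  have "steps E T D k {} E" using assms(1) unfolding search_def .
  moreover have "steps E T D k {} A \<Longrightarrow>
    steps (img \<phi> E) (\<phi> ` T) (\<phi> ` D) k (img \<phi> {}) (img \<phi> A) \<and> seen_img \<phi> T A" for A
  proof (induction rule: rtranclp_induct)
    case base then show ?case unfolding seen_img_def by auto
  next
    case (step A A')
    have "A \<subseteq> E" using steps_edges[OF step(1)] by blast
    from step_img[OF assms(2,3) this assms(4,5) _ step(2)] step(3)
    show ?case by (meson rtranclp_trans)
  qed
  ultimately show ?thesis unfolding search_def by simp
qed

lemma fibres_inj: "inj_on \<phi> (\<Union>E \<union> X) \<Longrightarrow> fibres \<phi> E X"
  unfolding fibres_def inj_on_def by auto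

lemma img_inj:
  assumes "edge_set E" "inj_on \<phi> (\<Union>E)"
  shows "img \<phi> E = (`) \<phi> ` E"
proof -
  have "card (\<phi> ` e) = 2" if "e \<in> E" for e
    using card_image[of \<phi> e] inj_on_subset[OF assms(2), of e] edge_setD(2)[OF assms(1) that] that by auto
  then show ?thesis unfolding img_def by auto
qed

lemma img_comp: "edge_set E \<Longrightarrow> img \<psi> (img \<phi> E) = img (\<psi> \<circ> \<phi>) E"
proof -
  assume E: "edge_set E"
  have *: "card (\<phi> ` e) = 2" if "e \<in> E" "card (\<psi> ` \<phi> ` e) = 2" for e
    using image_edge[OF edge_setD(2)[OF E that(1)], of \<phi>] that(2) by force
  show ?thesis
  proof (intro set_eqI iffI)
    fix x assume "x \<in> img \<psi> (img \<phi> E)"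
    then obtain e where "e \<in> E" "x = \<psi> ` \<phi> ` e" "card x = 2" unfolding img_def by blast
    then show "x \<in> img (\<psi> \<circ> \<phi>) E" unfolding img_def image_comp by blast
  next
    fix x assume "x \<in> img (\<psi> \<circ> \<phi>) E"
    then obtain e where e: "e \<in> E" "x = \<psi> ` \<phi> ` e" "card (\<psi> ` \<phi> ` e) = 2"
      unfolding img_def image_comp by blast
    then show "x \<in> img \<psi> (img \<phi> E)" using *[OF e(1,3)] unfolding img_def by blast
  qed
qed

lemma img_cong: "(\<And>x. x \<in> \<Union>E \<Longrightarrow> \<phi> x = \<psi> x) \<Longrightarrow> img \<phi> E = img \<psi> E"
proof -
  assume a: "\<And>x. x \<in> \<Union>E \<Longrightarrow> \<phi> x = \<psi> x"
  have "\<phi> ` e = \<psi> ` e" if "e \<in> E" for e by (rule image_cong) (use that a in auto)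
  then show ?thesis unfolding img_def by auto
qed

lemma img_id: "edge_set E \<Longrightarrow> (\<And>x. x \<in> \<Union>E \<Longrightarrow> \<phi> x = x) \<Longrightarrow> img \<phi> E = E"
proof -
  assume E: "edge_set E" and a: "\<And>x. x \<in> \<Union>E \<Longrightarrow> \<phi> x = x"
  have "img \<phi> E = img id E" by (rule img_cong) (use a in auto)
  also have "\<dots> = E" using E unfolding img_def edge_set_def by auto
  finally show ?thesis .
qed

lemma search_inj:
  assumes inj: "inj_on \<phi> (\<Union>E \<union> (T \<union> D))" and E: "edge_set E" and T: "finite T" and k: "2 \<le> k"
  shows "search (img \<phi> E) (\<phi> ` T) (\<phi> ` D) k \<longleftrightarrow> search E T D k"
proof
  show "search E T D k \<Longrightarrow> search (img \<phi> E) (\<phi> ` T) (\<phi> ` D) k"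
    using search_img[OF _ E fibres_inj[OF inj] T k] .
next
  assume s: "search (img \<phi> E) (\<phi> ` T) (\<phi> ` D) k"
  let ?g = "inv_into (\<Union>E \<union> (T \<union> D)) \<phi>"
  have "inj_on \<phi> (\<Union>E)" using inj inj_on_subset by blast
  then have U: "\<Union>(img \<phi> E) = \<phi> ` \<Union>E" using img_inj[OF E, of \<phi>] by auto
  have g: "?g (\<phi> x) = x" if "x \<in> \<Union>E \<union> (T \<union> D)" for x using inv_into_f_f[OF inj that] .
  have "inj_on ?g (\<Union>(img \<phi> E) \<union> (\<phi> ` T \<union> \<phi> ` D))" unfolding U by (rule inj_on_inv_into) auto
  then have "search (img ?g (img \<phi> E)) (?g ` \<phi> ` T) (?g ` \<phi> ` D) k"
    using search_img[OF s edge_set_img[OF E] fibres_inj _ k] T by blast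
  moreover have "img ?g (img \<phi> E) = E"
    unfolding img_comp[OF E] by (rule img_id[OF E]) (simp add: g)
  moreover have "?g ` \<phi> ` X = X" if "X \<subseteq> T \<union> D" for X
  proof -
    have "?g ` \<phi> ` X = (\<lambda>x. x) ` X" unfolding image_image by (rule image_cong) (use that g in auto)
    then show ?thesis by simp
  qed
  ultimately show "search E T D k" by simp
qed

section \<open>Restricting a search to a part hanging at one vertex\<close>

text \<open>
  The root is not a cut vertex of the block.
\<close>

definition indecomposable :: "'a set set \<Rightarrow> 'a \<Rightarrow> bool" where
  "indecomposable B r \<longleftrightarrow> (\<forall>A. A \<subseteq> B \<and> A \<noteq> {} \<and> A \<noteq> B \<longrightarrow> \<not> \<Union>A \<inter> \<Union>(B - A) \<subseteq> {r})"

text \<open>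
  Excludes pendant edges at the root, so a pendant slide never crosses the root from one
  block into another.
\<close>

definition no_pendant :: "'a set set \<Rightarrow> 'a \<Rightarrow> bool" where
  "no_pendant B r \<longleftrightarrow> (\<forall>g\<in>B. r \<in> g \<longrightarrow> (\<exists>h\<in>B. h \<noteq> g \<and> h \<inter> (g - {r}) \<noteq> {}))"

definition rooted_block :: "'a set set \<Rightarrow> 'a \<Rightarrow> bool" where
  "rooted_block B r \<longleftrightarrow> edge_set B \<and> r \<in> \<Union>B \<and> indecomposable B r \<and> no_pendant B r"

definition part_of :: "'a set set \<Rightarrow> 'a \<Rightarrow> 'a set set \<Rightarrow> bool" where
  "part_of B w E \<longleftrightarrow> B \<subseteq> E \<and> \<Union>B \<inter> \<Union>(E - B) \<subseteq> {w}"

lemma no_pendant_root: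
  assumes "no_pendant B w" "e \<in> B" "w \<in> e" "B \<subseteq> E"
  shows "\<not> (\<forall>g\<in>E. g \<inter> (e - {w}) \<noteq> {} \<longrightarrow> g = e)"
  using assms unfolding no_pendant_def by (meson subsetD)

lemma project_seen:
  assumes part: "part_of B w E" and TD: "(T \<union> D) \<inter> \<Union>B \<subseteq> {w}" and A: "A \<subseteq> E"
    and x: "x \<in> \<Union>B" "x \<noteq> w"
  shows "x \<in> \<Union>A \<union> T \<longleftrightarrow> x \<in> \<Union>(A \<inter> B)"
    "x \<in> \<Union>(E - A) \<union> D \<longleftrightarrow> x \<in> \<Union>(B - A \<inter> B)"
  using assms unfolding part_of_def by blast+

lemma project_frontier:
  assumes part: "part_of B w E" and TD: "(T \<union> D) \<inter> \<Union>B \<subseteq> {w}" and A: "A \<subseteq> E"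
  shows "frontier B {w} {w} (A \<inter> B) = insert w (frontier E T D A \<inter> (\<Union>B - {w}))"
  using project_seen[OF assms] unfolding frontier_def by blast

lemma project_inv:
  assumes E: "edge_set E" and part: "part_of B w E" and TD: "(T \<union> D) \<inter> \<Union>B \<subseteq> {w}"
    and np: "no_pendant B w" and T: "T \<noteq> {}" and A: "A \<subseteq> E"
    and inv: "A \<inter> B = {} \<or> w \<in> \<Union>(A \<inter> B)" and st: "step E T D k A A'"
  shows "A' \<inter> B = {} \<or> w \<in> \<Union>(A' \<inter> B)"
proof (cases "A \<inter> B = {}")
  case False
  then show ?thesis using inv step_mono[OF st] by blast
next
  case True
  have seen: "x = w" if "x \<in> \<Union>B" "x \<in> \<Union>A \<union> T" for x
    using project_seen(1)[OF part TD A that(1)] that True by auto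
  from st show ?thesis
  proof cases
    case (add e)
    then have "e \<inter> (\<Union>A \<union> T) \<noteq> {}" using T unfolding ok_add_def touches_def by auto
    then show ?thesis using seen True add by blast
  next
    case (slide e u)
    then have "e \<inter> (\<Union>A \<union> T) \<noteq> {}" unfolding ok_slide_def frontier_def by auto
    then show ?thesis using seen True slide by blast
  next
    case (pend e f u)
    then have p: "e \<in> E" "f \<in> E" "u \<in> e" "u \<in> f" "f \<inter> (\<Union>A \<union> T) \<noteq> {}"
     "\<forall>g\<in>E. g \<inter> (e - {u}) \<noteq> {} \<longrightarrow> g = e"
      unfolding ok_pend_def by auto
    show ?thesis
    proof (cases "f \<in> B")
      case True then show ?thesis using seen p(5) pend by blast
    next
      case False
      then have "e \<notin> B" using p part np no_pendant_root[OF np, of e E] unfolding part_of_def by blast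
      then show ?thesis using False True pend by auto
    qed
  qed
qed

text \<open>
  The searchers on \<open>K\<close> and one more searcher outside the part \<open>B\<close> contribute nothing to
  the cleaning of \<open>B\<close>. The latter can be replaced by a guard on the attaching vertex \<open>w\<close>. After a slide that
  leaves \<open>w\<close>, it is the frontier after the move that has to contain such a searcher.
\<close>

lemma project_step:
  assumes E: "edge_set E" and part: "part_of B w E" and TD: "(T \<union> D) \<inter> \<Union>B \<subseteq> {w}"
    and np: "no_pendant B w" and T: "T \<noteq> {}" "finite T" and A: "A \<subseteq> E"
    and inv: "A \<inter> B = {} \<or> w \<in> \<Union>(A \<inter> B)"
    and K: "K \<subseteq> T \<inter> D" "K \<inter> \<Union>B = {}" "w \<notin> K"
    and G: "A \<inter> B \<noteq> {} \<Longrightarrow> \<exists>z\<in>frontier E T D A. z \<notin> \<Union>B - {w} \<and> z \<notin> K"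
    and G': "A' \<inter> B \<noteq> {} \<Longrightarrow> \<exists>z\<in>frontier E T D A'. z \<notin> \<Union>B - {w} \<and> z \<notin> K"
    and st: "step E T D (k + card K) A A'"
  shows "A' \<inter> B = A \<inter> B \<or> step B {w} {w} k (A \<inter> B) (A' \<inter> B)"
proof -
  let ?F = "frontier E T D" let ?H = "\<lambda>A. frontier B {w} {w} (A \<inter> B)"
  let ?I = "\<Union>B - {w}"
  note fr = project_frontier[OF part TD]
  have BE: "B \<subseteq> E" using part unfolding part_of_def by auto
  have finF: "finite (?F C)" if "C \<subseteq> E" for C
    using frontier_subset[OF that, of T D] T(2) edge_set_finite_Union[OF E]
    by (meson finite_UnI finite_subset)
  have KF: "K \<subseteq> ?F C" for C using K unfolding frontier_def by auto
  have finK: "finite K" using K T finite_subset by blast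
  have cost: "card (insert w (X \<inter> ?I)) \<le> k"
    if "finite X" "card X \<le> k + card K" "K \<subseteq> X" "z \<in> X" "z \<notin> ?I" "z \<notin> K" for X z
  proof -
    have "card (X \<inter> ?I) + card K + 1 = card ((X \<inter> ?I) \<union> K \<union> {z})"
      using that K finK by (subst card_Un_disjoint, auto)+
    also have "\<dots> \<le> card X" using that by (intro card_mono) auto
    finally have "card (X \<inter> ?I) + 1 \<le> k" using that by auto
    then show ?thesis using that(1) by (simp add: card_insert_if)
  qed
  have seen: "x = w \<or> x \<in> \<Union>(A \<inter> B)" if "x \<in> \<Union>B" "x \<in> \<Union>A \<union> T" for x
    using project_seen(1)[OF part TD A that(1)] that by auto
  from st show ?thesis
  proof cases
    case (add e)
    show ?thesis
    proof (cases "e \<in> B")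
      case False
      then show ?thesis using add by auto
    next
      case True
      have e: "e \<in> E" "e \<notin> A" "e \<inter> (\<Union>A \<union> T) \<noteq> {}" "card (?F A \<union> e) \<le> k + card K"
        using add T unfolding ok_add_def touches_def by auto
      then obtain x where x: "x \<in> e" "x \<in> \<Union>A \<union> T" by blast
      then have x': "x = w \<or> x \<in> \<Union>(A \<inter> B)" using seen True by auto
      have "\<exists>z\<in>?F A \<union> e. z \<notin> ?I \<and> z \<notin> K"
      proof (cases "A \<inter> B = {}")
        case True then show ?thesis using x x' K by auto
      next
        case False then show ?thesis using G by blast
      qed
      then obtain z where z: "z \<in> ?F A \<union> e" "z \<notin> ?I" "z \<notin> K" by auto
      have "finite (?F A \<union> e)" "K \<subseteq> ?F A \<union> e" using finF[OF A] edge_setD(3)[OF E e(1)] KF by auto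
      from cost[OF this(1) e(4) this(2) z]
      have "card (?H A \<union> e) \<le> k"
        unfolding fr[OF A] using True by (auto simp: Int_Un_distrib2 insert_absorb elim!: back_subst[of "\<lambda>X. card X \<le> k"])
      then have "ok_add B {w} {w} k (A \<inter> B) e"
        using True e x x' unfolding ok_add_def touches_def by auto
      then show ?thesis using add True step.add by fastforce
    qed
  next
    case (slide e u)
    show ?thesis
    proof (cases "e \<in> B")
      case False
      then show ?thesis using slide by auto
    next
      case True
      have e: "e \<in> E" "e \<notin> A" "u \<in> e" "u \<in> ?F A" "u \<notin> ?F (insert e A)" "card (?F A \<union> e - {u}) \<le> k + card K"
        using slide unfolding ok_slide_def by auto
      have uB: "u \<in> \<Union>B" using True e by auto
      have eA: "insert e A \<subseteq> E" "insert e A \<inter> B = insert e (A \<inter> B)" using e A True by auto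
      have us: "u = w \<or> u \<in> \<Union>(A \<inter> B)" using seen[OF uB] e(4) unfolding frontier_def by auto
      have fK: "finite (?F A \<union> e - {u})" "K \<subseteq> ?F A \<union> e - {u}"
        using finF[OF A] edge_setD(3)[OF E e(1)] KF K uB by auto
      show ?thesis
      proof (cases "u = w")
        case False
        then have "A \<inter> B \<noteq> {}" using us by auto
        then obtain z where z: "z \<in> ?F A" "z \<notin> ?I" "z \<notin> K" using G by auto
        then have "z \<in> ?F A \<union> e - {u}" using uB False by auto
        from cost[OF fK(1) e(6) fK(2) this z(2,3)]
        have "card (insert w ((?F A \<union> e - {u}) \<inter> ?I)) \<le> k" .
        also have "insert w ((?F A \<union> e - {u}) \<inter> ?I) = ?H A \<union> e - {u}"
          unfolding fr[OF A] using True False by auto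
        finally have "ok_slide B {w} {w} k (A \<inter> B) e u"
          unfolding ok_slide_def using True e uB False fr[OF A] fr[OF eA(1)] eA(2) by auto
        then show ?thesis using slide True step.slide eA by fastforce
      next
        case uw: True
        obtain z where z: "z \<in> ?F A'" "z \<notin> ?I" "z \<notin> K" using G' True slide by auto
        then have "z \<in> ?F A \<union> e - {u}" using frontier_insert e(5) slide by fastforce
        from cost[OF fK(1) e(6) fK(2) this z(2,3)]
        have "card (insert w ((?F A \<union> e - {u}) \<inter> ?I)) \<le> k" .
        also have "insert w ((?F A \<union> e - {u}) \<inter> ?I) = ?H A \<union> e"
          unfolding fr[OF A] using True uw e by auto
        finally have "ok_add B {w} {w} k (A \<inter> B) e"
          unfolding ok_add_def touches_def using True e uw by auto
        then show ?thesis using slide True step.add eA by fastforce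
      qed
    qed
  next
    case (pend e f u)
    then have p: "e \<in> E" "e \<notin> A" "f \<in> E" "f \<notin> A" "e \<noteq> f" "u \<in> e" "u \<in> f" "u \<notin> \<Union>A \<union> T"
     "f \<inter> (\<Union>A \<union> T) \<noteq> {}"
     "\<forall>g\<in>E. g \<inter> (e - {u}) \<noteq> {} \<longrightarrow> g = e" "card (?F A \<union> f) \<le> k + card K"
      unfolding ok_pend_def by auto
    show ?thesis
    proof (cases "f \<in> B")
      case False
      then have "e \<notin> B" using p part np no_pendant_root[OF np, of e E] unfolding part_of_def by blast
      then show ?thesis using False pend by auto
    next
      case fB: True
      obtain y where fy: "f = {u, y}" "u \<noteq> y" using edge_other edge_setD(2)[OF E p(3)] p(7) by metis
      have y: "y \<in> \<Union>A \<union> T" using p(8,9) fy by auto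
      have y': "y = w \<or> y \<in> \<Union>(A \<inter> B)" using seen[OF _ y] fB fy by auto
      have uw: "u \<noteq> w"
      proof
        assume u: "u = w"
        show False
        proof (cases "A \<inter> B = {}")
          case True then show ?thesis using y' u fy by auto
        next
          case False then show ?thesis using inv u p(8) by auto
        qed
      qed
      have eB: "e \<in> B" using uw p(1,6,7) fB part unfolding part_of_def by auto
      obtain q where eq: "e = {u, q}" "u \<noteq> q" using edge_other edge_setD(2)[OF E p(1)] p(6) by metis
      have only: "g = e" if "g \<in> E" "q \<in> g" for g using p(10) that eq by auto
      have qw: "q \<noteq> w"
      proof
        assume q: "q = w"
        show False
        proof (cases "A \<inter> B = {}")
          case True then have "y = q" using y' q by auto
          then show ?thesis using only[of f] p(3,5) fy by auto
        next
          case False then obtain g where "g \<in> A" "w \<in> g" using inv by auto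
          then show ?thesis using only[of g] q p(2) A by auto
        qed
      qed
      have "\<exists>z\<in>?F A \<union> f. z \<notin> ?I \<and> z \<notin> K"
      proof (cases "A \<inter> B = {}")
        case True then show ?thesis using y' fy K by auto
      next
        case False then show ?thesis using G by blast
      qed
      then obtain z where z: "z \<in> ?F A \<union> f" "z \<notin> ?I" "z \<notin> K" by auto
      have "finite (?F A \<union> f)" "K \<subseteq> ?F A \<union> f" using finF[OF A] edge_setD(3)[OF E p(3)] KF by auto
      from cost[OF this(1) p(11) this(2) z]
      have "card (insert w ((?F A \<union> f) \<inter> ?I)) \<le> k" .
      also have "insert w ((?F A \<union> f) \<inter> ?I) = ?H A \<union> f \<union> {w}"
        unfolding fr[OF A] using fB by auto
      also have "\<dots> = ?H A \<union> f" unfolding fr[OF A] by auto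
      finally have c: "card (?H A \<union> f) \<le> k" .
      have "ok_pend B {w} {w} k (A \<inter> B) e f u"
        unfolding ok_pend_def
      proof (intro conjI)
        show "\<forall>g\<in>B. g \<inter> (e - {u}) \<noteq> {} \<longrightarrow> g = e" using p(10) BE by auto
        show "f \<inter> (\<Union> (A \<inter> B) \<union> {w}) \<noteq> {}" using y' fy by auto
        show "u \<notin> \<Union> (A \<inter> B) \<union> {w}" using p(8) uw by auto
        show "(e - {u}) \<inter> ({w} \<union> {w}) = {}" unfolding eq(1) using qw by blast
        show "e \<notin> A \<inter> B" "f \<notin> A \<inter> B" using p(2,4) by blast+
      qed (fact eB fB p(5) p(6) p(7) c)+
      moreover have "A' \<inter> B = insert e (insert f (A \<inter> B))" using pend eB fB by auto
      ultimately show ?thesis using step.pend by fastforce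
    qed
  qed
qed

text \<open>
  The guard on the root \<open>v\<close> of \<open>E\<close> is the searcher outside \<open>B\<close>, or already the guard on \<open>w\<close>.
\<close>

lemma one_block:
  assumes E: "edge_set E" and part: "part_of B w E" and B: "no_pendant B w" and v: "v \<notin> \<Union>B - {w}"
    and s: "search E {v} {v} k"
  shows "search B {w} {w} k"
proof -
  have BE: "B \<subseteq> E" using part unfolding part_of_def by auto
  have TD: "({v} \<union> {v}) \<inter> \<Union>B \<subseteq> {w}" using v by auto
  have "steps E {v} {v} k {} A \<Longrightarrow>
     (A \<inter> B = {} \<or> w \<in> \<Union>(A \<inter> B)) \<and> steps B {w} {w} k {} (A \<inter> B)" for A
  proof (induction rule: rtranclp_induct)
    case (step A A')
    have A: "A \<subseteq> E" using steps_edges[OF step(1)] by blast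
    have vF: "v \<in> frontier E {v} {v} C" for C unfolding frontier_def by auto
    have "A' \<inter> B = A \<inter> B \<or> step B {w} {w} k (A \<inter> B) (A' \<inter> B)"
      by (rule project_step[OF E part TD B _ _ A, where K = "{}"])
        (use step vF v in auto)
    moreover have "A' \<inter> B = {} \<or> w \<in> \<Union>(A' \<inter> B)"
      by (rule project_inv[OF E part TD B _ A _ step(2)]) (use step in auto)
    ultimately show ?case using step(3) by (metis rtranclp.rtrancl_into_rtrancl)
  qed simp
  from this[of E] s BE show ?thesis unfolding search_def by (simp add: Int_absorb1)
qed

text \<open>
  As long as \<open>C\<close> is unfinished and \<open>w\<close> meets a clean edge, either \<open>w\<close> or an inner vertex of \<open>C\<close> lies
  on the frontier. So the search of \<open>B\<close> can be carried out with a guard on \<open>w\<close>, and vice versa;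
  the argument stops when the first of the two blocks is finished.
\<close>

lemma two_blocks:
  assumes E: "edge_set E" and B: "rooted_block B w" "part_of B w E" and C: "rooted_block C w" "part_of C w E"
    and BC: "B \<inter> C = {}" and T: "T \<noteq> {}" "finite T"
    and TD: "(T \<union> D) \<inter> \<Union>B \<subseteq> {w}" "(T \<union> D) \<inter> \<Union>C \<subseteq> {w}"
    and K: "K \<subseteq> T \<inter> D" "K \<inter> \<Union>B = {}" "K \<inter> \<Union>C = {}"
    and s: "search E T D (k + card K)"
  shows "search B {w} {w} k \<or> search C {w} {w} k"
proof (rule ccontr)
  assume no: "\<not> ?thesis"
  let ?F = "frontier E T D"
  have guard: "\<exists>z\<in>?F A. z \<notin> \<Union>B - {w} \<and> z \<notin> K"
    if that': "rooted_block B w" "part_of B w E" "rooted_block C w" "part_of C w E" "B \<inter> C = {}" "K \<inter> \<Union>B = {}" "K \<inter> \<Union>C = {}"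
     "A \<subseteq> E" "w \<in> \<Union>A" "\<not> C \<subseteq> A" for A B C
  proof (cases "w \<in> ?F A")
    case True
    moreover have "w \<notin> K" using that'(1,6) unfolding rooted_block_def by auto
    ultimately show ?thesis by auto
  next
    case False
    then have nd: "w \<notin> \<Union>(E - A)" using that'(9) unfolding frontier_def by auto
    obtain g where g: "g \<in> C" "w \<in> g" using that'(3) unfolding rooted_block_def by auto
    have CE: "C \<subseteq> E" using that'(4) unfolding part_of_def by auto
    then have "g \<in> A" using g nd by auto
    then have "\<not> \<Union>(C \<inter> A) \<inter> \<Union>(C - C \<inter> A) \<subseteq> {w}"
      using that'(3,10) g unfolding rooted_block_def indecomposable_def by (metis Int_iff Int_lower1 empty_iff inf.absorb_iff1)
    then obtain x where x: "x \<noteq> w" "x \<in> \<Union>(C \<inter> A)" "x \<in> \<Union>(C - A)" by auto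
    have "x \<in> ?F A" using x CE unfolding frontier_def by auto
    moreover have "x \<notin> \<Union>B" using x CE that'(2,5) unfolding part_of_def by blast
    moreover have "x \<notin> K" using x that'(7) by auto
    ultimately show ?thesis by auto
  qed
  have only1: "A' \<inter> B = A \<inter> B \<or> A' \<inter> C = A \<inter> C" if st: "step E T D (k + card K) A A'" for A A'
    using st
  proof cases
    case (pend e f u)
    then have p: "e \<in> E" "f \<in> E" "e \<noteq> f" "u \<in> e" "u \<in> f"
     "\<forall>g\<in>E. g \<inter> (e - {u}) \<noteq> {} \<longrightarrow> g = e"
      unfolding ok_pend_def by auto
    have "\<not> (e \<in> B \<and> f \<in> C)"
    proof
      assume "e \<in> B \<and> f \<in> C"
      then have "u = w" using p B(2) BC unfolding part_of_def by blast
      then show False using no_pendant_root[of B w e E] B p \<open>e \<in> B \<and> f \<in> C\<close>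
        unfolding rooted_block_def part_of_def by blast
    qed
    moreover have "\<not> (e \<in> C \<and> f \<in> B)"
    proof
      assume "e \<in> C \<and> f \<in> B"
      then have "u = w" using p C(2) BC unfolding part_of_def by blast
      then show False using no_pendant_root[of C w e E] C p \<open>e \<in> C \<and> f \<in> B\<close>
        unfolding rooted_block_def part_of_def by blast
    qed
    ultimately show ?thesis using pend BC by auto
  qed (use BC in auto)
  have np: "no_pendant B w" "no_pendant C w" using B C unfolding rooted_block_def by auto
  have wK: "w \<notin> K" using B(1) K unfolding rooted_block_def by auto
  have "steps E T D (k + card K) {} A \<Longrightarrow>
     (A \<inter> B = {} \<or> w \<in> \<Union>(A \<inter> B)) \<and> (A \<inter> C = {} \<or> w \<in> \<Union>(A \<inter> C)) \<and>
     \<not> B \<subseteq> A \<and> \<not> C \<subseteq> A \<and> steps B {w} {w} k {} (A \<inter> B) \<and> steps C {w} {w} k {} (A \<inter> C)" for A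
  proof (induction rule: rtranclp_induct)
    case base
    then show ?case using B C unfolding rooted_block_def by auto
  next
    case (step A A')
    have A: "A \<subseteq> E" "A' \<subseteq> E" using steps_edges[OF step(1)] step_edges[OF step(2)] by blast+
    have i: "A' \<inter> B = {} \<or> w \<in> \<Union>(A' \<inter> B)"
      by (rule project_inv[OF E B(2) TD(1) np(1) T(1) A(1) _ step(2)]) (use step in auto)
    have j: "A' \<inter> C = {} \<or> w \<in> \<Union>(A' \<inter> C)"
      by (rule project_inv[OF E C(2) TD(2) np(2) T(1) A(1) _ step(2)]) (use step in auto)
    have CB: "C \<inter> B = {}" using BC by auto
    have sB: "steps B {w} {w} k {} (A' \<inter> B) \<and> \<not> B \<subseteq> A'"
    proof (cases "A' \<inter> B = A \<inter> B")
      case True then show ?thesis using step by auto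
    next
      case False
      then have eq: "A' \<inter> C = A \<inter> C" using only1 step by auto
      then have nC: "\<not> C \<subseteq> A" "\<not> C \<subseteq> A'" using step by auto
      have "A' \<inter> B = A \<inter> B \<or> step B {w} {w} k (A \<inter> B) (A' \<inter> B)"
      proof (rule project_step[OF E B(2) TD(1) np(1) T A(1) _ K(1,2) wK _ _ step(2)])
        show "A \<inter> B = {} \<or> w \<in> \<Union>(A \<inter> B)" using step by auto
        show "\<exists>z\<in>?F A. z \<notin> \<Union>B - {w} \<and> z \<notin> K" if "A \<inter> B \<noteq> {}"
          by (rule guard[OF B C BC K(2,3) A(1) _ nC(1)]) (use step that in auto)
        show "\<exists>z\<in>?F A'. z \<notin> \<Union>B - {w} \<and> z \<notin> K" if "A' \<inter> B \<noteq> {}"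
          by (rule guard[OF B C BC K(2,3) A(2) _ nC(2)]) (use i that in auto)
      qed
      then have *: "steps B {w} {w} k {} (A' \<inter> B)" using False step(3) by (metis rtranclp.rtrancl_into_rtrancl)
      moreover have "\<not> B \<subseteq> A'"
      proof
        assume "B \<subseteq> A'"
        then have "A' \<inter> B = B" by auto
        then show False using * no unfolding search_def by auto
      qed
      ultimately show ?thesis by auto
    qed
    have sC: "steps C {w} {w} k {} (A' \<inter> C) \<and> \<not> C \<subseteq> A'"
    proof (cases "A' \<inter> C = A \<inter> C")
      case True then show ?thesis using step by auto
    next
      case False
      then have eq: "A' \<inter> B = A \<inter> B" using only1 step by auto
      then have nB: "\<not> B \<subseteq> A" "\<not> B \<subseteq> A'" using step by auto
      have "A' \<inter> C = A \<inter> C \<or> step C {w} {w} k (A \<inter> C) (A' \<inter> C)"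
      proof (rule project_step[OF E C(2) TD(2) np(2) T A(1) _ K(1,3) wK _ _ step(2)])
        show "A \<inter> C = {} \<or> w \<in> \<Union>(A \<inter> C)" using step by auto
        show "\<exists>z\<in>?F A. z \<notin> \<Union>C - {w} \<and> z \<notin> K" if "A \<inter> C \<noteq> {}"
          by (rule guard[OF C B CB K(3,2) A(1) _ nB(1)]) (use step that in auto)
        show "\<exists>z\<in>?F A'. z \<notin> \<Union>C - {w} \<and> z \<notin> K" if "A' \<inter> C \<noteq> {}"
          by (rule guard[OF C B CB K(3,2) A(2) _ nB(2)]) (use j that in auto)
      qed
      then have *: "steps C {w} {w} k {} (A' \<inter> C)" using False step(3) by (metis rtranclp.rtrancl_into_rtrancl)
      moreover have "\<not> C \<subseteq> A'"
      proof
        assume "C \<subseteq> A'"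
        then have "A' \<inter> C = C" by auto
        then show False using * no unfolding search_def by auto
      qed
      ultimately show ?thesis by auto
    qed
    show ?case using i j sB sC by auto
  qed
  from this[of E] s B(2) show False unfolding search_def part_of_def by blast
qed

section \<open>Blocks\<close>

text \<open>
  Contracts the edge \<open>e\<close> to its endpoint \<open>z\<close>. Keeping one of the old endpoints leaves the
  rest of the graph unchanged literally, not only up to isomorphism.
\<close>

definition collapse :: "'a set \<Rightarrow> 'a \<Rightarrow> 'a \<Rightarrow> 'a" where
  "collapse e z x = (if x \<in> e then z else x)"

text \<open>
  A recipe for a search, so that searches of concrete graphs can be checked by computation.
\<close>

datatype 'a cleaning = Add "'a set" | Along "'a set" 'a | Pendant "'a set" "'a set" 'a

primrec schedule ::
  "'a set set \<Rightarrow> 'a set \<Rightarrow> 'a set \<Rightarrow> nat \<Rightarrow> 'a cleaning list \<Rightarrow> 'a set set \<Rightarrow> bool" where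
  "schedule E T D k [] A \<longleftrightarrow> A = E"
| "schedule E T D k (c # cs) A \<longleftrightarrow>
     (case c of
        Add e \<Rightarrow> ok_add E T D k A e \<and> schedule E T D k cs (insert e A)
      | Along e u \<Rightarrow> ok_slide E T D k A e u \<and> schedule E T D k cs (insert e A)
      | Pendant e f u \<Rightarrow> ok_pend E T D k A e f u \<and> schedule E T D k cs (insert e (insert f A)))"

text \<open>
  A finite set of states that no step leaves certifies that a search is impossible.
\<close>

definition closed_under :: "'a set set \<Rightarrow> 'a set \<Rightarrow> 'a set \<Rightarrow> nat \<Rightarrow> 'a set set set \<Rightarrow> bool" where
  "closed_under E T D k R \<longleftrightarrow>
     (\<forall>A\<in>R. \<forall>e\<in>E. (ok_add E T D k A e \<longrightarrow> insert e A \<in> R) \<and>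
        (\<forall>u\<in>e. (ok_slide E T D k A e u \<longrightarrow> insert e A \<in> R) \<and>
           (\<forall>f\<in>E. ok_pend E T D k A e f u \<longrightarrow> insert e (insert f A) \<in> R)))"

lemma schedule_search: "schedule E T D k cs {} \<Longrightarrow> search E T D k"
proof -
  have "schedule E T D k cs A \<Longrightarrow> steps E T D k A E" for A
  proof (induction cs arbitrary: A)
    case (Cons c cs)
    obtain A' where "step E T D k A A'" "schedule E T D k cs A'"
    proof (cases c)
      case (Add e) then show ?thesis using Cons that[of "insert e A"] step.add by fastforce
    next
      case (Along e u) then show ?thesis using Cons that[of "insert e A"] step.slide by fastforce
    next
      case (Pendant e f u)
      then show ?thesis using Cons that[of "insert e (insert f A)"] step.pend by fastforce
    qed
    then show ?case using Cons.IH by (meson converse_rtranclp_into_rtranclp)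
  qed simp
  then show "schedule E T D k cs {} \<Longrightarrow> search E T D k" unfolding search_def by blast
qed

lemma closed_no_search:
  assumes "closed_under E T D k R" "{} \<in> R" "E \<notin> R"
  shows "\<not> search E T D k"
proof
  assume s: "search E T D k"
  have "steps E T D k {} A \<Longrightarrow> A \<in> R" for A
  proof (induction rule: rtranclp_induct)
    case (step A A')
    from step(2) show ?case
    proof cases
      case (add e) then show ?thesis using assms(1) step(3) unfolding closed_under_def ok_add_def by blast
    next
      case (slide e u)
      then show ?thesis using assms(1) step(3) unfolding closed_under_def ok_slide_def by blast
    next
      case (pend e f u)
      then have "e \<in> E" "f \<in> E" "u \<in> e" unfolding ok_pend_def by auto
      then show ?thesis using pend assms(1) step(3) unfolding closed_under_def by blast
    qed
  qed (use assms in auto)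
  then show False using s assms(3) unfolding search_def by blast
qed

lemma img_code [code]: "img \<phi> E = Set.filter (\<lambda>e. card e = 2) ((`) \<phi> ` E)"
  unfolding img_def by (auto simp: Set.filter_eq)

text \<open>
  The defining properties of a block, each with a witness that can be evaluated.
\<close>

definition certified ::
  "'a set set \<Rightarrow> 'a \<Rightarrow> nat \<Rightarrow> 'a cleaning list \<Rightarrow> 'a cleaning list \<Rightarrow> 'a set set set \<Rightarrow>
     ('a set \<times> 'a \<times> 'a cleaning list) list \<Rightarrow> bool" where
  "certified E r k outwards inwards R contr \<longleftrightarrow>
     (\<forall>e\<in>E. card e = 2) \<and> r \<in> \<Union>E \<and>
     (\<forall>A\<in>Pow E. A = {} \<or> A = E \<or> (\<exists>x\<in>\<Union>A \<inter> \<Union>(E - A). x \<noteq> r)) \<and>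
     (\<forall>g\<in>E. r \<in> g \<longrightarrow> (\<exists>h\<in>E. h \<noteq> g \<and> h \<inter> (g - {r}) \<noteq> {})) \<and>
     schedule E {r} {} k outwards {} \<and> schedule E {} {r} k inwards {} \<and>
     closed_under E {r} {r} k R \<and> {} \<in> R \<and> E \<notin> R \<and>
     E \<subseteq> fst ` set contr \<and>
     (\<forall>(e, z, cs)\<in>set contr. z \<in> e \<and> (r \<in> e \<longrightarrow> z = r) \<and>
        schedule (img (collapse e z) E) {r} {r} k cs {})"

text \<open>
  The five blocks of level \<open>2\<close> are, in this order: a triangle on a stalk; two triangles
  sharing an edge, rooted at a vertex of degree two; a path with five vertices hung at its
  middle; a star with three rays on a stalk; a triangle with two pendant edges at one
  vertex. In each of them, once the root is guarded, the remaining searcher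
  is caught on a vertex with two contaminated edges.
\<close>

lemma leaf0_certified:
  "certified ({{0, 1}, {1, 2}, {1, 3}, {2, 3}} :: nat set set) 0 2
     [Add {0, 1}, Add {1, 2}, Along {1, 3} 1, Add {2, 3}]
     [Add {1, 2}, Along {2, 3} 2, Add {1, 3}, Add {0, 1}]
     {{}, {{0, 1}}}
     [({0, 1}, 0, [Add {0, 2}, Along {2, 3} 2, Add {0, 3}]),
      ({1, 2}, 1, [Pendant {1, 3} {0, 1} 1]),
      ({1, 3}, 1, [Pendant {1, 2} {0, 1} 1]),
      ({2, 3}, 2, [Pendant {1, 2} {0, 1} 1])]"
  by code_simp

lemma leaf1_certified:
  "certified ({{0, 1}, {0, 2}, {1, 2}, {1, 3}, {2, 3}} :: nat set set) 0 2
     [Add {0, 1}, Along {0, 2} 0, Add {1, 2}, Along {1, 3} 1, Add {2, 3}]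
     [Add {1, 3}, Along {2, 3} 3, Add {1, 2}, Along {0, 1} 1, Add {0, 2}]
     {{}, {{0, 1}}, {{0, 2}}}
     [({0, 1}, 0, [Add {0, 2}, Along {2, 3} 2, Add {0, 3}]),
      ({0, 2}, 0, [Add {0, 1}, Along {1, 3} 1, Add {0, 3}]),
      ({1, 2}, 1, [Pendant {1, 3} {0, 1} 1]),
      ({1, 3}, 1, [Add {0, 1}, Along {1, 2} 1, Add {0, 2}]),
      ({2, 3}, 2, [Add {0, 1}, Along {1, 2} 1, Add {0, 2}])]"
  by code_simp

lemma leaf2_certified:
  "certified ({{0, 3}, {1, 2}, {2, 3}, {3, 4}, {4, 5}} :: nat set set) 0 2
     [Add {0, 3}, Pendant {1, 2} {2, 3} 2, Pendant {4, 5} {3, 4} 4]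
     [Add {1, 2}, Add {2, 3}, Pendant {4, 5} {3, 4} 4, Add {0, 3}]
     {{}, {{0, 3}}}
     [({0, 3}, 0, [Pendant {1, 2} {0, 2} 2, Pendant {4, 5} {0, 4} 4]),
      ({2, 3}, 2, [Pendant {1, 2} {0, 2} 2, Along {2, 4} 2, Along {4, 5} 4]),
      ({1, 2}, 1, [Pendant {1, 3} {0, 3} 3, Along {3, 4} 3, Along {4, 5} 4]),
      ({3, 4}, 3, [Pendant {3, 5} {0, 3} 3, Along {2, 3} 3, Along {1, 2} 2]),
      ({4, 5}, 4, [Pendant {3, 4} {0, 3} 3, Along {2, 3} 3, Along {1, 2} 2])]"
  by code_simp

lemma leaf3_certified:
  "certified ({{0, 1}, {1, 2}, {1, 3}, {1, 4}} :: nat set set) 0 2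
     [Pendant {1, 2} {0, 1} 1, Add {1, 3}, Add {1, 4}]
     [Add {1, 2}, Add {1, 3}, Add {0, 1}, Along {1, 4} 1]
     {{}, {{0, 1}}, {{0, 1}, {1, 2}}, {{0, 1}, {1, 3}}, {{0, 1}, {1, 4}}}
     [({0, 1}, 0, [Add {0, 2}, Add {0, 3}, Add {0, 4}]),
      ({1, 2}, 1, [Pendant {1, 3} {0, 1} 1, Along {1, 4} 1]),
      ({1, 3}, 1, [Pendant {1, 2} {0, 1} 1, Along {1, 4} 1]),
      ({1, 4}, 1, [Pendant {1, 2} {0, 1} 1, Along {1, 3} 1])]"
  by code_simp

lemma leaf4_certified:
  "certified ({{0, 1}, {0, 2}, {1, 2}, {1, 3}, {1, 4}} :: nat set set) 0 2
     [Pendant {1, 3} {0, 1} 1, Along {0, 2} 0, Add {1, 2}, Add {1, 4}]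
     [Add {1, 3}, Add {1, 2}, Along {0, 2} 2, Add {0, 1}, Along {1, 4} 1]
     {{}, {{0, 1}}, {{0, 2}}, {{0, 1}, {1, 3}}, {{0, 1}, {1, 4}}, {{0, 2}, {1, 2}}, {{0, 1}, {0, 2}, {1, 2}}}
     [({0, 1}, 0, [Add {0, 2}, Add {0, 3}, Add {0, 4}]),
      ({0, 2}, 0, [Pendant {1, 3} {0, 1} 1, Along {1, 4} 1]),
      ({1, 2}, 1, [Pendant {1, 3} {0, 1} 1, Along {1, 4} 1]),
      ({1, 3}, 1, [Pendant {1, 4} {0, 1} 1, Along {1, 2} 1, Add {0, 2}]),
      ({1, 4}, 1, [Pendant {1, 3} {0, 1} 1, Along {1, 2} 1, Add {0, 2}])]"
  by code_simp

text \<open>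
  The condition on \<open>z\<close> makes the root keep its name when an edge at the root is contracted.
\<close>

definition block :: "nat \<Rightarrow> 'a set set \<Rightarrow> 'a \<Rightarrow> bool" where
  "block k E r \<longleftrightarrow> rooted_block E r \<and> search E {r} {} k \<and> search E {} {r} k \<and> \<not> search E {r} {r} k \<and>
     (\<forall>e\<in>E. \<exists>z\<in>e. (r \<in> e \<longrightarrow> z = r) \<and> search (img (collapse e z) E) {r} {r} k)"

lemma certified_block:
  assumes c: "certified E r k os is R cs" and fin: "finite E"
  shows "block k E r"
proof -
  have c1: "\<forall>e\<in>E. card e = 2" "r \<in> \<Union>E"
    and c2: "\<forall>A\<in>Pow E. A = {} \<or> A = E \<or> (\<exists>x\<in>\<Union>A \<inter> \<Union>(E - A). x \<noteq> r)"
    and c3: "\<forall>g\<in>E. r \<in> g \<longrightarrow> (\<exists>h\<in>E. h \<noteq> g \<and> h \<inter> (g - {r}) \<noteq> {})"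
    and c4: "schedule E {r} {} k os {}" "schedule E {} {r} k is {}"
    and c5: "closed_under E {r} {r} k R" "{} \<in> R" "E \<notin> R"
    and c6: "E \<subseteq> fst ` set cs"
    and c7: "\<forall>(e, z, cs)\<in>set cs. z \<in> e \<and> (r \<in> e \<longrightarrow> z = r) \<and>
        schedule (img (collapse e z) E) {r} {r} k cs {}"
    using c unfolding certified_def by - (elim conjE, assumption)+
  have "indecomposable E r"
    unfolding indecomposable_def
  proof (intro allI impI)
    fix A assume "A \<subseteq> E \<and> A \<noteq> {} \<and> A \<noteq> E"
    then obtain x where "x\<in>\<Union>A \<inter> \<Union>(E - A)" "x \<noteq> r" using c2 by (meson PowI)
    then show "\<not> \<Union>A \<inter> \<Union>(E - A) \<subseteq> {r}" by auto
  qed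
  then have "rooted_block E r"
    using c1 c3 fin unfolding rooted_block_def edge_set_def no_pendant_def by simp
  moreover have "\<exists>z\<in>e. (r \<in> e \<longrightarrow> z = r) \<and> search (img (collapse e z) E) {r} {r} k" if "e \<in> E" for e
  proof -
    have "e \<in> fst ` set cs" using c6 that by blast
    then obtain z xs where *: "(e, z, xs) \<in> set cs" by auto
    from bspec[OF c7 *] show ?thesis using schedule_search by blast
  qed
  moreover have "search E {r} {} k" "search E {} {r} k"
    using c4 schedule_search by metis+
  moreover have "\<not> search E {r} {r} k"
    using c5 closed_no_search by metis
  ultimately show ?thesis unfolding block_def by simp
qed

lemma rooted_block_img:
  assumes B: "rooted_block B r" and inj: "inj_on \<phi> (\<Union>B)"
  shows "rooted_block (img \<phi> B) (\<phi> r)"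
proof -
  have E: "edge_set B" and r: "r \<in> \<Union>B" and i: "indecomposable B r" and n: "no_pendant B r"
    using B unfolding rooted_block_def by auto
  have im: "img \<phi> B = (`) \<phi> ` B" using img_inj[OF E inj] .
  have mem: "\<phi> x \<in> \<phi> ` e \<longleftrightarrow> x \<in> e" if "e \<in> B" "x \<in> \<Union>B" for x e
    by (rule inj_on_image_mem_iff[OF inj]) (use that in auto)
  have "indecomposable (img \<phi> B) (\<phi> r)"
    unfolding indecomposable_def
  proof (intro allI impI)
    fix A assume A: "A \<subseteq> img \<phi> B \<and> A \<noteq> {} \<and> A \<noteq> img \<phi> B"
    define A0 where "A0 = {e \<in> B. \<phi> ` e \<in> A}"
    have "A0 \<subseteq> B" "A0 \<noteq> {}" "A0 \<noteq> B" using A unfolding A0_def im by auto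
    then obtain x where x: "x \<in> \<Union>A0" "x \<in> \<Union>(B - A0)" "x \<noteq> r"
      using i unfolding indecomposable_def by blast
    have xB: "x \<in> \<Union>B" using x unfolding A0_def by auto
    have "\<phi> x \<in> \<Union>A" using x unfolding A0_def by auto
    moreover have "\<phi> x \<in> \<Union>(img \<phi> B - A)" using x unfolding A0_def im by auto
    moreover have "\<phi> x \<noteq> \<phi> r" using x(3) xB r inj unfolding inj_on_def by auto
    ultimately show "\<not> \<Union>A \<inter> \<Union>(img \<phi> B - A) \<subseteq> {\<phi> r}" by auto
  qed
  moreover have "no_pendant (img \<phi> B) (\<phi> r)"
    unfolding no_pendant_def
  proof (intro ballI impI)
    fix g' assume g': "g' \<in> img \<phi> B" "\<phi> r \<in> g'"
    then obtain g where g: "g \<in> B" "g' = \<phi> ` g" unfolding im by auto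
    then have "r \<in> g" using g' mem r by auto
    then obtain h x where h: "h \<in> B" "h \<noteq> g" "x \<in> h" "x \<in> g" "x \<noteq> r"
      using n g unfolding no_pendant_def by blast
    have "\<phi> ` h \<noteq> g'" using h(1,2) g inj_on_image_eq_iff[OF inj, of h g] by auto
    moreover have "\<phi> x \<noteq> \<phi> r" using h g r inj unfolding inj_on_def by auto
    ultimately show "\<exists>h\<in>img \<phi> B. h \<noteq> g' \<and> h \<inter> (g' - {\<phi> r}) \<noteq> {}"
      using h g unfolding im by (intro bexI[of _ "\<phi> ` h"]) auto
  qed
  ultimately show ?thesis unfolding rooted_block_def using edge_set_img[OF E, of \<phi>] r im by auto
qed

text \<open>
  Blocks are rooted graphs up to renaming. The converse renaming is needed for the
  impossibility of the guarded search.
\<close>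

lemma block_img:
  assumes B: "block k E r" and inj: "inj_on \<phi> (\<Union>E)" and k: "2 \<le> k"
  shows "block k (img \<phi> E) (\<phi> r)"
proof -
  have rb: "rooted_block E r" using B unfolding block_def by auto
  have E: "edge_set E" and r: "r \<in> \<Union>E" using rb unfolding rooted_block_def by auto
  have s: "search (img \<phi> E) (\<phi> ` T) (\<phi> ` D) k \<longleftrightarrow> search E T D k" if "T \<subseteq> {r}" "D \<subseteq> {r}" for T D
    by (rule search_inj[OF inj_on_subset[OF inj] E finite_subset[OF that(1)] k]) (use that r in auto)
  have im: "img \<phi> E = (`) \<phi> ` E" using img_inj[OF E inj] .
  have "\<exists>z\<in>e'. (\<phi> r \<in> e' \<longrightarrow> z = \<phi> r) \<and> search (img (collapse e' z) (img \<phi> E)) {\<phi> r} {\<phi> r} k"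
    if e': "e' \<in> img \<phi> E" for e'
  proof -
    obtain e where e: "e \<in> E" "e' = \<phi> ` e" using e' unfolding im by auto
    then obtain z where z: "z \<in> e" "r \<in> e \<longrightarrow> z = r" "search (img (collapse e z) E) {r} {r} k"
      using B unfolding block_def by blast
    have mem: "\<phi> x \<in> e' \<longleftrightarrow> x \<in> e" if "x \<in> \<Union>E" for x
      unfolding e(2) by (rule inj_on_image_mem_iff[OF inj]) (use that e in auto)
    have zE: "z \<in> \<Union>E" using e z by auto
    have cE: "edge_set (img (collapse e z) E)" by (rule edge_set_img[OF E])
    have sub: "\<Union>(img (collapse e z) E) \<subseteq> \<Union>E"
      using Union_img[of "collapse e z" E] zE unfolding collapse_def by auto
    have r': "collapse e z r = r" using z unfolding collapse_def by auto
    have "collapse e' (\<phi> z) (\<phi> x) = \<phi> (collapse e z x)" if "x \<in> \<Union>E" for x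
      using mem[OF that] unfolding collapse_def by auto
    then have eq: "img (collapse e' (\<phi> z)) (img \<phi> E) = img \<phi> (img (collapse e z) E)"
      unfolding img_comp[OF E] by (intro img_cong) auto
    have "inj_on \<phi> (\<Union>(img (collapse e z) E) \<union> ({r} \<union> {r}))"
      using inj_on_subset[OF inj, of "\<Union>(img (collapse e z) E) \<union> ({r} \<union> {r})"] sub r by auto
    from search_img[OF z(3) cE fibres_inj[OF this] _ k]
    have "search (img \<phi> (img (collapse e z) E)) {\<phi> r} {\<phi> r} k" by simp
    then show ?thesis using z e mem[OF r] unfolding eq[symmetric] by blast
  qed
  then show ?thesis
    unfolding block_def using B rooted_block_img[OF rb inj] s[of "{r}" "{}"] s[of "{}" "{r}"] s[of "{r}" "{r}"]
    unfolding block_def by simp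
qed

section \<open>Joining two blocks\<close>

lemma blockD:
  assumes "block k B a"
  shows "edge_set B" "a \<in> \<Union>B" "indecomposable B a" "no_pendant B a" "rooted_block B a"
    "search B {a} {} k" "search B {} {a} k" "\<not> search B {a} {a} k"
    "e \<in> B \<Longrightarrow> \<exists>z\<in>e. (a \<in> e \<longrightarrow> z = a) \<and> search (img (collapse e z) B) {a} {a} k"
  using assms unfolding block_def rooted_block_def by blast+

lemma edge_disjoint:
  assumes "edge_set B" "edge_set C" "\<Union>B \<inter> \<Union>C \<subseteq> {a}"
  shows "B \<inter> C = {}"
proof (rule ccontr)
  assume "B \<inter> C \<noteq> {}"
  then obtain e where e: "e \<in> B" "e \<in> C" by auto
  then have "e \<subseteq> {a}" using assms(3) by auto
  then have "card e \<le> 1" by (metis card_mono card.empty card_insert_disjoint empty_iff finite.emptyI finite_insert One_nat_def)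
  then show False using edge_setD(2)[OF assms(1) e(1)] by simp
qed

lemma search_single:
  assumes "v \<noteq> a" "T \<noteq> {}" "T \<subseteq> {v, a}"
  shows "search {{v, a}} T D 2"
proof -
  have "frontier {{v, a}} T D {} \<union> {v, a} = {v, a}" using assms unfolding frontier_def by auto
  then have "ok_add {{v, a}} T D 2 {} {v, a}" using assms unfolding ok_add_def touches_def by auto
  then have "step {{v, a}} T D 2 {} {{v, a}}" by (rule step.add)
  then show ?thesis unfolding search_def by auto
qed

lemmas union_simps = Union_insert Union_Un_distrib Union_empty Un_empty_right

text \<open>
  Cleans \<open>X\<close> after \<open>P\<close> and before \<open>Q\<close>. Compositions of searches are obtained by chaining such phases.
\<close>

lemma phase_split:
  assumes s: "search X T D k" and X: "edge_set X" and E: "E = P \<union> X \<union> Q"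
    and dis: "P \<inter> X = {}" "Q \<inter> (P \<union> X) = {}"
    and T: "T \<inter> \<Union>X = (\<Union>P \<union> T') \<inter> \<Union>X" and D: "D \<inter> \<Union>X = (\<Union>Q \<union> D') \<inter> \<Union>X"
    and start: "T = {} \<Longrightarrow> P = {} \<and> T' = {}" and fin: "finite T" "finite S"
    and S: "(\<Union>P \<union> T') \<inter> (\<Union>Q \<union> D') - \<Union>X \<subseteq> T \<inter> D \<union> S" and k: "k + card S \<le> k'"
  shows "steps E T' D' k' P (X \<union> P)"
proof -
  have Q: "E - X - P = Q" using dis unfolding E by blast
  have "X \<subseteq> E" "P \<subseteq> E - X" using dis unfolding E by blast+
  from phase[OF s X this, unfolded Q, OF T D start fin(1) S fin(2) k] show ?thesis .
qed

definition graft :: "'a \<Rightarrow> 'a \<Rightarrow> 'a set set \<Rightarrow> 'a set set \<Rightarrow> 'a set set" where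
  "graft v a B C = insert {v, a} (B \<union> C)"

lemma graft_commute: "graft v a B C = graft v a C B"
  unfolding graft_def by auto

lemma rooted_block_graft:
  assumes B: "rooted_block B a" and C: "rooted_block C a" and v: "v \<notin> \<Union>B" "v \<notin> \<Union>C"
  shows "rooted_block (graft v a B C) v"
proof -
  let ?E = "graft v a B C"
  have va: "v \<noteq> a" using B v unfolding rooted_block_def by auto
  have sub: "X \<subseteq> A" if X: "rooted_block X a" "v \<notin> \<Union>X" "X \<subseteq> ?E" and A: "{v, a} \<in> A"
    and AA: "\<Union>A \<inter> \<Union>(?E - A) \<subseteq> {v}" for X A
  proof (rule ccontr)
    assume n: "\<not> X \<subseteq> A"
    have a: "a \<notin> \<Union>(?E - A)" using A AA va by auto
    obtain g where g: "g \<in> X" "a \<in> g" using X(1) unfolding rooted_block_def by auto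
    then have "g \<in> A" using a X(3) by auto
    then have "X \<inter> A \<noteq> {}" "X \<inter> A \<noteq> X" using g n by auto
    then have "\<not> \<Union>(X \<inter> A) \<inter> \<Union>(X - X \<inter> A) \<subseteq> {a}"
      using X(1) unfolding rooted_block_def indecomposable_def by (meson Int_lower1)
    then obtain x where x: "x \<in> \<Union>(X \<inter> A)" "x \<in> \<Union>(X - X \<inter> A)" by auto
    then have "x \<in> \<Union>A \<inter> \<Union>(?E - A)" using X(3) by auto
    then show False using AA x X(2) by auto
  qed
  have full: "A = ?E" if A: "A \<subseteq> ?E" "{v, a} \<in> A" "\<Union>A \<inter> \<Union>(?E - A) \<subseteq> {v}" for A
    using sub[OF B v(1) _ A(2,3)] sub[OF C v(2) _ A(2,3)] A(1,2) unfolding graft_def by blast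
  have "indecomposable ?E v"
    unfolding indecomposable_def
  proof (intro allI impI notI)
    fix A assume A: "A \<subseteq> ?E \<and> A \<noteq> {} \<and> A \<noteq> ?E" and AA: "\<Union>A \<inter> \<Union>(?E - A) \<subseteq> {v}"
    show False
    proof (cases "{v, a} \<in> A")
      case True then show False using full A AA by blast
    next
      case False
      have *: "?E - (?E - A) = A" using A by auto
      have "?E - A = ?E"
        by (rule full) (use False AA in \<open>auto simp: * Int_commute graft_def\<close>)
      then show False using A by auto
    qed
  qed
  moreover have "no_pendant ?E v"
    unfolding no_pendant_def
  proof (intro ballI impI)
    fix g assume "g \<in> ?E" "v \<in> g"
    then have g: "g = {v, a}" using v unfolding graft_def by auto
    obtain h where h: "h \<in> B" "a \<in> h" using B unfolding rooted_block_def by auto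
    then have "h \<noteq> g" using v g by auto
    then show "\<exists>h\<in>?E. h \<noteq> g \<and> h \<inter> (g - {v}) \<noteq> {}"
      using h g va unfolding graft_def by (intro bexI[of _ h]) auto
  qed
  ultimately show ?thesis using B C va unfolding rooted_block_def edge_set_def graft_def by auto
qed

text \<open>
  With \<open>v\<close> guarded, the contracted block is cleaned while \<open>a\<close> is guarded too, and then the
  other one outwards from \<open>a\<close>.
\<close>

lemma graft_contract:
  assumes B: "block k B a" and C: "block k C a" and BC: "\<Union>B \<inter> \<Union>C \<subseteq> {a}"
    and v: "v \<notin> \<Union>B" "v \<notin> \<Union>C" and e: "e \<in> B" and k: "2 \<le> k"
  shows "\<exists>z\<in>e. (v \<in> e \<longrightarrow> z = v) \<and> search (img (collapse e z) (graft v a B C)) {v} {v} (Suc k)"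
proof -
  note B' = blockD[OF B] note C' = blockD[OF C]
  obtain z where z: "z \<in> e" "a \<in> e \<longrightarrow> z = a" "search (img (collapse e z) B) {a} {a} k" using B'(9) e by blast
  let ?B = "img (collapse e z) B" let ?E = "insert {v, a} (?B \<union> C)"
  have va: "v \<noteq> a" using v B' by auto
  have ve: "v \<notin> e" using v e by auto
  have fixc: "collapse e z x = x" if "x \<in> \<Union>C \<or> x = v \<or> x = a" for x
    using that BC e z(2) ve unfolding collapse_def by auto
  have "img (collapse e z) C = C" by (rule img_id[OF C'(1)]) (use fixc in auto)
  moreover have "collapse e z ` {v, a} = {v, a}" using fixc by auto
  ultimately have eq: "img (collapse e z) (graft v a B C) = ?E"
    using va unfolding graft_def by (simp add: img_insert img_Un)
  have UB: "\<Union>?B \<subseteq> \<Union>B" using Union_img[of "collapse e z" B] e z(1) unfolding collapse_def by auto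
  have dis: "?B \<inter> C = {}" by (rule edge_disjoint[OF edge_set_img[OF B'(1)] C'(1)]) (use UB BC in auto)
  have vn: "{v, a} \<notin> ?B" "{v, a} \<notin> C" using v UB by auto
  \<comment> \<open>Opaque names for the vertex sets keep the set reasoning below elementary.\<close>
  obtain VB VC VB' where V: "\<Union>B = VB" "\<Union>C = VC" "\<Union>?B = VB'" by blast
  note V' = v[unfolded V] UB[unfolded V] BC[unfolded V] va C'(2)[unfolded V]
  have "steps ?E {v} {v} (Suc k) {} ({{v, a}} \<union> {})"
    by (rule phase_split[where S = "{}" and D = "{v, a}" and T = "{v}" and k = 2 and Q = "?B \<union> C"])
      ((rule search_single; use va in blast), simp add: edge_set_def va, blast,
       use vn dis in blast, use vn dis in blast,
       use V' in \<open>unfold union_simps V; auto\<close>,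
       use V' in \<open>unfold union_simps V; auto\<close>, simp, simp, simp,
       use V' in \<open>unfold union_simps V; auto\<close>, use k in simp)
  moreover have "steps ?E {v} {v} (Suc k) {{v, a}} (?B \<union> {{v, a}})"
    by (rule phase_split[OF z(3) edge_set_img[OF B'(1)], where S = "{v}" and Q = "C"])
      (blast, use vn dis in blast, use vn dis in blast,
       use V' in \<open>unfold union_simps V; auto\<close>,
       use V' in \<open>unfold union_simps V; auto\<close>, simp, simp, simp,
       use V' in \<open>unfold union_simps V; auto\<close>, use k in simp)
  moreover have "steps ?E {v} {v} (Suc k) (?B \<union> {{v, a}}) (C \<union> (?B \<union> {{v, a}}))"
    by (rule phase_split[OF C'(6,1), where S = "{v}" and Q = "{}"])
      (blast, use vn dis in blast, use vn dis in blast,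
       use V' in \<open>unfold union_simps V; auto\<close>,
       use V' in \<open>unfold union_simps V; auto\<close>, simp, simp, simp,
       use V' in \<open>unfold union_simps V; auto\<close>, use k in simp)
  ultimately have "steps ?E {v} {v} (Suc k) {} (C \<union> (?B \<union> {{v, a}}))" by simp
  moreover have "C \<union> (?B \<union> {{v, a}}) = ?E" by auto
  ultimately have "search ?E {v} {v} (Suc k)" unfolding search_def by simp
  then have "search (img (collapse e z) (graft v a B C)) {v} {v} (Suc k)" unfolding eq .
  then show ?thesis using z(1) ve by blast
qed

text \<open>
  The guard on \<open>v\<close> uses up the additional searcher, so a guarded search would leave
  only \<open>k\<close> searchers for two blocks of level \<open>k\<close>. If the edge \<open>{v, a}\<close> is contracted, then \<open>v\<close> becomes
  the root of both blocks, and a guard on it stays there while both are cleaned outwards.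
\<close>

lemma block_graft:
  assumes B: "block k B a" and C: "block k C a" and BC: "\<Union>B \<inter> \<Union>C \<subseteq> {a}"
    and v: "v \<notin> \<Union>B" "v \<notin> \<Union>C" and k: "2 \<le> k"
  shows "block (Suc k) (graft v a B C) v"
proof -
  note B' = blockD[OF B] note C' = blockD[OF C]
  let ?E = "graft v a B C"
  have va: "v \<noteq> a" using v B' by auto
  have dis: "B \<inter> C = {}" by (rule edge_disjoint[OF B'(1) C'(1) BC])
  have vn: "{v, a} \<notin> B" "{v, a} \<notin> C" using v by auto
  have rb: "rooted_block ?E v" by (rule rooted_block_graft[OF B'(5) C'(5) v])
  note gB = guard_root[OF B'(6,1)] note gC = guard_root[OF C'(6,1)]
  obtain VB VC where V: "\<Union>B = VB" "\<Union>C = VC" by blast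
  note V' = v[unfolded V] BC[unfolded V] va C'(2)[unfolded V] B'(2)[unfolded V]
  have out: "search ?E {v} {} (Suc k)"
  proof -
    have "steps ?E {v} {} (Suc k) {} ({{v, a}} \<union> {})"
      by (rule phase_split[where S = "{}" and D = "{a}" and T = "{v}" and k = 2 and Q = "B \<union> C"])
        ((rule search_single; use va in blast), simp add: edge_set_def va,
         (unfold graft_def; blast), use vn dis in blast, use vn dis in blast,
         use V' in \<open>unfold union_simps V; auto\<close>,
         use V' in \<open>unfold union_simps V; auto\<close>, simp, simp, simp,
         use V' in \<open>unfold union_simps V; auto\<close>, use k in simp)
    moreover have "steps ?E {v} {} (Suc k) {{v, a}} (B \<union> {{v, a}})"
      by (rule phase_split[OF gB B'(1), where S = "{}" and Q = "C"])
        ((unfold graft_def; blast), use vn dis in blast, use vn dis in blast,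
         use V' in \<open>unfold union_simps V; auto\<close>,
         use V' in \<open>unfold union_simps V; auto\<close>, simp, simp, simp,
         use V' in \<open>unfold union_simps V; auto\<close>, use k in simp)
    moreover have "steps ?E {v} {} (Suc k) (B \<union> {{v, a}}) (C \<union> (B \<union> {{v, a}}))"
      by (rule phase_split[OF C'(6,1), where S = "{}" and Q = "{}"])
        ((unfold graft_def; blast), use vn dis in blast, use vn dis in blast,
         use V' in \<open>unfold union_simps V; auto\<close>,
         use V' in \<open>unfold union_simps V; auto\<close>, simp, simp, simp,
         use V' in \<open>unfold union_simps V; auto\<close>, use k in simp)
    ultimately have "steps ?E {v} {} (Suc k) {} (C \<union> (B \<union> {{v, a}}))" by simp
    moreover have "C \<union> (B \<union> {{v, a}}) = ?E" unfolding graft_def by auto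
    ultimately show ?thesis unfolding search_def by simp
  qed
  have inw: "search ?E {} {v} (Suc k)"
  proof -
    have "steps ?E {} {v} (Suc k) {} (B \<union> {})"
      by (rule phase_split[OF B'(7,1), where S = "{}" and Q = "insert {v, a} C"])
        ((unfold graft_def; blast), use vn dis in blast, use vn dis in blast,
         use V' in \<open>unfold union_simps V; auto\<close>,
         use V' in \<open>unfold union_simps V; auto\<close>, simp, simp, simp,
         use V' in \<open>unfold union_simps V; auto\<close>, use k in simp)
    moreover have "steps ?E {} {v} (Suc k) B (C \<union> B)"
      by (rule phase_split[OF gC C'(1), where S = "{}" and Q = "{{v, a}}"])
        ((unfold graft_def; blast), use vn dis in blast, use vn dis in blast,
         use V' in \<open>unfold union_simps V; auto\<close>,
         use V' in \<open>unfold union_simps V; auto\<close>, simp, simp, simp,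
         use V' in \<open>unfold union_simps V; auto\<close>, use k in simp)
    moreover have "steps ?E {} {v} (Suc k) (C \<union> B) ({{v, a}} \<union> (C \<union> B))"
      by (rule phase_split[where S = "{}" and D = "{v}" and T = "{a}" and k = 2 and Q = "{}"])
        ((rule search_single; use va in blast), simp add: edge_set_def va,
         (unfold graft_def; blast), use vn dis in blast, use vn dis in blast,
         use V' in \<open>unfold union_simps V; auto\<close>,
         use V' in \<open>unfold union_simps V; auto\<close>, simp, simp, simp,
         use V' in \<open>unfold union_simps V; auto\<close>, use k in simp)
    ultimately have "steps ?E {} {v} (Suc k) {} ({{v, a}} \<union> (C \<union> B))" by simp
    moreover have "{{v, a}} \<union> (C \<union> B) = ?E" unfolding graft_def by auto
    ultimately show ?thesis unfolding search_def by simp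
  qed
  have stuck: "\<not> search ?E {v} {v} (Suc k)"
  proof
    assume s: "search ?E {v} {v} (Suc k)"
    have "search B {a} {a} k \<or> search C {a} {a} k"
      by (rule two_blocks[where K = "{v}" and T = "{v}" and D = "{v}" and E = ?E])
        (use s rb B'(5) C'(5) dis v BC va in \<open>auto simp: part_of_def graft_def rooted_block_def\<close>)
    then show False using B'(8) C'(8) by auto
  qed
  have "\<exists>z\<in>e. (v \<in> e \<longrightarrow> z = v) \<and> search (img (collapse e z) ?E) {v} {v} (Suc k)" if e: "e \<in> ?E" for e
  proof -
    consider "e \<in> B" | "e \<in> C" | "e = {v, a}" using e unfolding graft_def by auto
    then show ?thesis
    proof cases
      case 1 then show ?thesis using graft_contract[OF B C BC v _ k] by blast
    next
      case 2
      have "\<Union>C \<inter> \<Union>B \<subseteq> {a}" using BC by auto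
      from graft_contract[OF C B this v(2,1) 2 k] show ?thesis unfolding graft_commute[of v a C B] .
    next
      case 3
      let ?f = "collapse {v, a} v"
      have inj: "inj_on ?f (\<Union>B)" "inj_on ?f (\<Union>C)" using v unfolding inj_on_def collapse_def by auto
      have fa: "?f a = v" unfolding collapse_def by auto
      have b: "block k (img ?f B) v" "block k (img ?f C) v"
        using block_img[OF B inj(1) k] block_img[OF C inj(2) k] fa by auto
      note b1 = blockD[OF b(1)] note b2 = blockD[OF b(2)]
      have eq: "img ?f ?E = img ?f B \<union> img ?f C"
        unfolding graft_def img_insert img_Un by (simp add: collapse_def)
      have U: "\<Union>(img ?f B) = ?f ` \<Union>B" "\<Union>(img ?f C) = ?f ` \<Union>C"
        using img_inj[OF B'(1) inj(1)] img_inj[OF C'(1) inj(2)] by auto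
      have int: "\<Union>(img ?f B) \<inter> \<Union>(img ?f C) \<subseteq> {v}"
        unfolding U using BC v unfolding collapse_def by (auto split: if_splits)
      have dis': "img ?f B \<inter> img ?f C = {}" by (rule edge_disjoint[OF b1(1) b2(1) int])
      let ?E' = "img ?f B \<union> img ?f C"
      obtain VB VC where V: "\<Union>(img ?f B) = VB" "\<Union>(img ?f C) = VC" by blast
      note V' = int[unfolded V] b1(2)[unfolded V] b2(2)[unfolded V]
      have "steps ?E' {v} {v} (Suc k) {} (img ?f B \<union> {})"
        by (rule phase_split[OF guard_root[OF b1(6,1)] b1(1), where S = "{}" and Q = "img ?f C"])
          (blast, use dis' in blast, use dis' in blast,
           use V' in \<open>unfold union_simps V; auto\<close>,
           use V' in \<open>unfold union_simps V; auto\<close>, simp, simp, simp,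
           use V' in \<open>unfold union_simps V; auto\<close>, use k in simp)
      moreover have "steps ?E' {v} {v} (Suc k) (img ?f B) (img ?f C \<union> img ?f B)"
        by (rule phase_split[OF guard_root[OF b2(6,1)] b2(1), where S = "{}" and Q = "{}"])
          (blast, use dis' in blast, use dis' in blast,
           use V' in \<open>unfold union_simps V; auto\<close>,
           use V' in \<open>unfold union_simps V; auto\<close>, simp, simp, simp,
           use V' in \<open>unfold union_simps V; auto\<close>, use k in simp)
      ultimately have "search ?E' {v} {v} (Suc k)" unfolding search_def by (simp add: Un_commute)
      then have "search (img (collapse e v) ?E) {v} {v} (Suc k)" unfolding 3 eq .
      then show ?thesis using 3 by blast
    qed
  qed
  then show ?thesis unfolding block_def using rb out inw stuck by blast
qed

section \<open>From searches to strategies\<close>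

text \<open>
  Connectedness as reachability is easier to handle than the paths without
  repetitions in \<open>graph_connected\<close>.
\<close>

definition linked :: "'a set set \<Rightarrow> bool" where
  "linked Q \<longleftrightarrow> (\<forall>x\<in>\<Union>Q. \<forall>y\<in>\<Union>Q. (x, y) \<in> {(s, t). {s, t} \<in> Q}\<^sup>*)"

lemma graph_path_rtrancl:
  assumes "graph_path G p"
  shows "(hd p, last p) \<in> {(s, t). {s, t} \<in> edges G \<and> s \<in> verts G \<and> t \<in> verts G}\<^sup>*"
proof -
  have "p \<noteq> [] \<Longrightarrow> set p \<subseteq> verts G \<Longrightarrow> successively (\<lambda>u v. {u, v} \<in> edges G) p \<Longrightarrow> ?thesis"
  proof (induction p)
    case (Cons a p)
    show ?case
    proof (cases p)
      case (Cons b q)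
      then have "(a, b) \<in> {(s, t). {s, t} \<in> edges G \<and> s \<in> verts G \<and> t \<in> verts G}"
        using Cons.prems by auto
      moreover have "(b, last p) \<in> {(s, t). {s, t} \<in> edges G \<and> s \<in> verts G \<and> t \<in> verts G}\<^sup>*"
        using Cons.IH Cons.prems Cons by auto
      ultimately show ?thesis using Cons by (auto intro: converse_rtrancl_into_rtrancl)
    qed simp
  qed simp
  then show ?thesis using assms unfolding graph_path_def by auto
qed

lemma rtrancl_graph_path:
  assumes "(x, y) \<in> {(s, t). {s, t} \<in> edges G \<and> s \<in> verts G \<and> t \<in> verts G}\<^sup>*" "x \<in> verts G"
  shows "\<exists>p. graph_path G p \<and> hd p = x \<and> last p = y"
  using assms(1)
proof (induction rule: rtrancl_induct)
  case base
  then show ?case using assms(2) by (intro exI[of _ "[x]"]) (auto simp: graph_path_def)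
next
  case (step y z)
  then obtain p where p: "graph_path G p" "hd p = x" "last p = y" by auto
  show ?case
  proof (cases "z \<in> set p")
    case True
    then obtain q r where q: "p = q @ z # r" by (meson split_list)
    have "graph_path G (q @ [z])" using p(1) unfolding graph_path_def q
      by (auto simp: successively_append_iff)
    moreover have "hd (q @ [z]) = x" using p(2) q by (cases q) auto
    ultimately show ?thesis by (intro exI[of _ "q @ [z]"]) auto
  next
    case False
    have "graph_path G (p @ [z])" using p False step(2) unfolding graph_path_def
      by (auto simp: successively_append_iff)
    moreover have "hd (p @ [z]) = x" using p unfolding graph_path_def by (cases p) auto
    ultimately show ?thesis by (intro exI[of _ "p @ [z]"]) auto
  qed
qed

lemma graph_connected_iff:
  "graph_connected G \<longleftrightarrow> (\<forall>x\<in>verts G. \<forall>y\<in>verts G.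
     (x, y) \<in> {(s, t). {s, t} \<in> edges G \<and> s \<in> verts G \<and> t \<in> verts G}\<^sup>*)"
  (is "_ \<longleftrightarrow> ?R")
proof
  assume c: "graph_connected G"
  show ?R
  proof (intro ballI)
    fix x y assume "x \<in> verts G" "y \<in> verts G"
    then obtain p where "graph_path G p" "hd p = x" "last p = y"
      using c unfolding graph_connected_def by blast
    then show "(x, y) \<in> {(s, t). {s, t} \<in> edges G \<and> s \<in> verts G \<and> t \<in> verts G}\<^sup>*"
      using graph_path_rtrancl by force
  qed
next
  assume ?R
  then show "graph_connected G" unfolding graph_connected_def by (simp add: rtrancl_graph_path)
qed

lemma linked_iff: "linked Q \<longleftrightarrow> graph_connected \<lparr>verts = \<Union>Q, edges = Q\<rparr>"
proof -
  have "{(s, t). {s, t} \<in> Q \<and> s \<in> \<Union>Q \<and> t \<in> \<Union>Q} = {(s, t). {s, t} \<in> Q}" by auto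
  then show ?thesis unfolding graph_connected_iff linked_def by simp
qed

text \<open>
  Makes it possible to split a move that cleans many edges.
\<close>

lemma linked_touch:
  assumes l: "linked Q" and A: "A \<subseteq> Q" "A \<noteq> Q" and ne: "\<forall>e\<in>Q. e \<noteq> {}"
  shows "\<exists>e\<in>Q - A. touches {} A e"
proof (rule ccontr)
  assume no: "\<not> ?thesis"
  obtain g y where g: "g \<in> Q - A" "y \<in> g" using A ne by blast
  have "A \<noteq> {}" using no g unfolding touches_def by auto
  then obtain a x where a: "a \<in> A" "x \<in> a" using A(1) ne by blast
  then have "(x, y) \<in> {(s, t). {s, t} \<in> Q}\<^sup>*" using l A(1) g unfolding linked_def by blast
  then have "y \<in> \<Union>A"
  proof (induction rule: rtrancl_induct)
    case base then show ?case using a by auto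
  next
    case (step s t)
    then have st: "{s, t} \<in> Q" "s \<in> \<Union>A" by auto
    have "{s, t} \<in> A"
    proof (rule ccontr)
      assume "{s, t} \<notin> A"
      then have "\<not> touches {} A {s, t}" using no st(1) by blast
      then show False using st(2) unfolding touches_def by simp
    qed
    then show ?case by auto
  qed
  then have "touches {} A g" using g unfolding touches_def by blast
  then show False using no g by blast
qed

lemma linked_insert:
  assumes l: "linked A" and t: "touches {} A e" and e: "card e = 2"
  shows "linked (insert e A)"
proof -
  let ?R = "{(s, t). {s, t} \<in> insert e A}"
  obtain a b where ab: "e = {a, b}" using e by (meson card_2_iff)
  have sym: "sym (?R\<^sup>*)" by (rule sym_rtrancl) (auto simp: sym_def insert_commute)
  have AA: "(x, y) \<in> ?R\<^sup>*" if "x \<in> \<Union>A" "y \<in> \<Union>A" for x y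
  proof -
    have "(x, y) \<in> {(s, t). {s, t} \<in> A}\<^sup>*" using l that unfolding linked_def by auto
    then show ?thesis by (rule subsetD[OF rtrancl_mono, rotated]) auto
  qed
  have abR: "(a, b) \<in> ?R\<^sup>*" "(b, a) \<in> ?R\<^sup>*" using ab by (auto simp: insert_commute)
  obtain c where c: "c \<in> e" "A = {} \<or> c \<in> \<Union>A" using t ab unfolding touches_def by auto
  have "(x, c) \<in> ?R\<^sup>*" if "x \<in> \<Union>(insert e A)" for x
  proof (cases "x \<in> e")
    case True then show ?thesis using c(1) ab abR by auto
  next
    case False then show ?thesis using that c AA by auto
  qed
  then show ?thesis unfolding linked_def using sym by (meson rtrancl_trans symD)
qed

lemma linked_closure: "linked A \<Longrightarrow> A \<subseteq> Q \<Longrightarrow> \<Union>Q = \<Union>A \<Longrightarrow> linked Q"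
proof -
  assume l: "linked A" and s: "A \<subseteq> Q" and u: "\<Union>Q = \<Union>A"
  have "{(s, t). {s, t} \<in> A}\<^sup>* \<subseteq> {(s, t). {s, t} \<in> Q}\<^sup>*" by (rule rtrancl_mono) (use s in auto)
  then show ?thesis using l u unfolding linked_def by auto
qed

lemma linked_step:
  assumes E: "edge_set E" and A: "linked A" and st: "step E {} D k A A'"
  shows "linked A'"
  using st
proof cases
  case (add e)
  then show ?thesis using linked_insert[OF A] edge_setD(2)[OF E] unfolding ok_add_def by auto
next
  case (slide e u)
  then have "touches {} A e" unfolding ok_slide_def touches_def frontier_def by auto
  then show ?thesis using slide linked_insert[OF A] edge_setD(2)[OF E] unfolding ok_slide_def by auto
next
  case (pend e f u)
  then have p: "e \<in> E" "f \<in> E" "u \<in> e" "u \<in> f" "touches {} A f" unfolding ok_pend_def touches_def by auto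
  have "linked (insert f A)" using linked_insert[OF A p(5)] edge_setD(2)[OF E p(2)] .
  moreover have "touches {} (insert f A) e" using p unfolding touches_def by auto
  ultimately show ?thesis using pend linked_insert edge_setD(2)[OF E p(1)] by auto
qed

lemma linked_steps: "steps E {} D k {} A \<Longrightarrow> edge_set E \<Longrightarrow> linked A"
proof (induction rule: rtranclp_induct)
  case base then show ?case unfolding linked_def by auto
next
  case (step A A') then show ?case using linked_step by blast
qed

definition inside :: "'a graph \<Rightarrow> 'a set \<Rightarrow> 'a set set" where
  "inside G P = {e \<in> edges G. e \<subseteq> P}"

lemma simple_graph_edge_set: "simple_graph G \<Longrightarrow> edge_set (edges G)"
proof -
  assume "simple_graph G"
  then have "edges G \<subseteq> Pow (verts G)" "finite (verts G)" "\<forall>e\<in>edges G. card e = 2"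
    unfolding simple_graph_def by auto
  then show ?thesis unfolding edge_set_def by (meson finite_Pow_iff finite_subset)
qed

lemma not_contaminated:
  assumes Q: "frontier (edges G) {} {} Q \<subseteq> X" and e: "e \<in> Q"
  shows "\<not> contaminated G X Q e"
proof
  assume "contaminated G X Q e"
  then obtain p where p: "graph_path G p" "2 \<le> length p" "{p ! 0, p ! 1} = e"
    "{p ! (length p - 2), p ! (length p - 1)} \<notin> Q"
    "\<And>j. 0 < j \<Longrightarrow> j < length p - 1 \<Longrightarrow> p ! j \<notin> X"
    unfolding contaminated_def by auto
  have ed: "{p ! j, p ! Suc j} \<in> edges G" if "Suc j < length p" for j
    using p(1) that unfolding graph_path_def successively_conv_nth by auto
  have "{p ! j, p ! Suc j} \<in> Q" if "Suc j < length p" for j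
    using that
  proof (induction j)
    case 0 then show ?case using p(3) e by auto
  next
    case (Suc j)
    show ?case
    proof (rule ccontr)
      assume "{p ! Suc j, p ! Suc (Suc j)} \<notin> Q"
      then have "p ! Suc j \<in> frontier (edges G) {} {} Q"
        using Suc ed[of "Suc j"] unfolding frontier_def by auto
      moreover have "Suc j < length p - 1" using Suc.prems by linarith
      ultimately show False using Q p(5)[of "Suc j"] by blast
    qed
  qed
  moreover have "Suc (length p - 2) < length p" "Suc (length p - 2) = length p - 1"
    using p(2) by linarith+
  ultimately show False using p(4) by metis
qed

lemma contaminated_frontier:
  assumes G: "simple_graph G" and QE: "Q \<subseteq> edges G" and x: "x \<in> frontier (edges G) {} {} Q" "x \<notin> X"
  shows "\<exists>e\<in>Q. contaminated G X Q e"
proof -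
  obtain e f where ef: "e \<in> Q" "x \<in> e" "f \<in> edges G" "f \<notin> Q" "x \<in> f"
    using x unfolding frontier_def by auto
  have c: "card e = 2" "card f = 2" "e \<subseteq> verts G" "f \<subseteq> verts G" using G QE ef unfolding simple_graph_def by auto
  obtain y where y: "e = {x, y}" "x \<noteq> y" using edge_other[OF c(1) ef(2)] by metis
  obtain z where z: "f = {x, z}" "x \<noteq> z" using edge_other[OF c(2) ef(5)] by metis
  have yz: "y \<noteq> z" using y z ef by auto
  have "graph_path G [y, x, z]"
    unfolding graph_path_def using y z yz c ef QE by (auto simp: insert_commute)
  then have "contaminated G X Q e"
    unfolding contaminated_def using x y z ef
    by (intro exI[of _ "[y, x, z]"]) (auto simp: less_Suc_eq nth_Cons' insert_commute)
  then show ?thesis using ef by auto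
qed

lemma searchers_append: "i \<le> length S \<Longrightarrow> searchers (S @ R) i = searchers S i"
  unfolding searchers_def by simp

lemma searchers_snoc: "searchers (S @ [m]) (Suc (length S)) = make_move m (searchers S (length S))"
  unfolding searchers_def by simp

lemma searchers_Suc: "i < length S \<Longrightarrow> searchers S (Suc i) = make_move (S ! i) (searchers S i)"
  unfolding searchers_def by (simp add: take_Suc_conv_app_nth)

lemma clean_append: "i \<le> length S \<Longrightarrow> clean_edges G (S @ R) i = clean_edges G S i"
proof (induction i)
  case (Suc i)
  then have "cleaned_edges G (S @ R) (Suc i) = cleaned_edges G S (Suc i)"
    unfolding cleaned_edges_def occupied_def by (simp add: searchers_append nth_append)
  then show ?case using Suc by (simp add: occupied_def searchers_append)
qed simp

definition cleans :: "'a graph \<Rightarrow> nat \<Rightarrow> 'a move list \<Rightarrow> 'a set set \<Rightarrow> 'a set \<Rightarrow> bool" where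
  "cleans G k S C P \<longleftrightarrow> search_strategy G S \<and> monotone_strategy G S \<and> connected_strategy G S \<and>
     (\<forall>i\<le>length S. size (searchers S i) \<le> k) \<and> finite P \<and> searchers S (length S) = mset_set P \<and>
     clean_edges G S (length S) = C"

lemma cleans_snoc:
  assumes c: "cleans G k S C P" and legal: "legal_move G (mset_set P) m"
    and mv: "make_move m (mset_set P) = mset_set P'" and P': "finite P'" "card P' \<le> k"
    and Q: "Q = C \<union> inside G P' \<union> (case m of Slide v u \<Rightarrow> {{v, u}} | _ \<Rightarrow> {})"
    and fr: "frontier (edges G) {} {} Q \<subseteq> P'" and l: "linked Q"
  shows "cleans G k (S @ [m]) Q P'"
proof -
  let ?S = "S @ [m]" let ?n = "length S"
  have C: "clean_edges G S ?n = C" "searchers S ?n = mset_set P" "finite P" using c unfolding cleans_def by auto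
  have s: "searchers ?S (Suc ?n) = mset_set P'" using C mv searchers_snoc by metis
  have occ: "occupied ?S (Suc ?n) = P'" unfolding occupied_def s using P' by simp
  have ce: "cleaned_edges G ?S (Suc ?n) = inside G P' \<union> (case m of Slide v u \<Rightarrow> {{v, u}} | _ \<Rightarrow> {})"
    unfolding cleaned_edges_def occ inside_def by simp
  have Q': "clean_edges G ?S ?n \<union> cleaned_edges G ?S (Suc ?n) = Q"
    unfolding ce using Q C clean_append[of ?n S G "[m]"] by auto
  have cl: "clean_edges G ?S (Suc ?n) = Q"
    using Q' not_contaminated[OF fr] by (auto simp: Let_def occ)
  have lenS: "length ?S = Suc ?n" by simp
  have "search_strategy G ?S"
    using c legal C unfolding cleans_def search_strategy_def
    by (auto simp: less_Suc_eq nth_append searchers_append)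
  moreover have "monotone_strategy G ?S"
    unfolding monotone_strategy_def
  proof
    fix i assume i: "i \<in> {1..length ?S}"
    show "\<not> recontamination_move G ?S i"
    proof (cases "i = Suc ?n")
      case True
      then show ?thesis unfolding recontamination_move_def using cl Q' by simp
    next
      case False
      then have i': "i \<in> {1..?n}" using i by auto
      then have "cleaned_edges G ?S i = cleaned_edges G S i"
        unfolding cleaned_edges_def occupied_def by (auto simp: searchers_append nth_append)
      then have "recontamination_move G ?S i = recontamination_move G S i"
        unfolding recontamination_move_def using i' by (auto simp: clean_append)
      then show ?thesis using c i' unfolding cleans_def monotone_strategy_def by auto
    qed
  qed
  moreover have "connected_strategy G ?S"
    unfolding connected_strategy_def
  proof (intro allI impI)
    fix i assume i: "i \<le> length ?S"
    show "graph_connected \<lparr>verts = \<Union> (clean_edges G ?S i), edges = clean_edges G ?S i\<rparr>"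
    proof (cases "i = Suc ?n")
      case True
      then show ?thesis using cl l linked_iff by metis
    next
      case False
      then have "i \<le> ?n" using i by auto
      then show ?thesis using c unfolding cleans_def connected_strategy_def by (metis clean_append)
    qed
  qed
  moreover have "size (searchers ?S i) \<le> k" if "i \<le> length ?S" for i
  proof (cases "i = Suc ?n")
    case True then show ?thesis using s P' by simp
  next
    case False
    then have "i \<le> ?n" using that by auto
    then show ?thesis using c unfolding cleans_def by (metis searchers_append)
  qed
  ultimately show ?thesis unfolding cleans_def using s cl P' by simp
qed

text \<open>
  Edges between two occupied vertices are cleaned by a strategy whether or not the search has
  reached them. They do no harm if all occupied vertices meet edges that the search has cleaned.
\<close>

lemma frontier_inside:
  assumes "P \<subseteq> \<Union>A"
  shows "frontier (edges G) {} {} (A \<union> inside G P) \<subseteq> frontier (edges G) {} {} A"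
    "\<Union>(A \<union> inside G P) = \<Union>A"
  using assms unfolding frontier_def inside_def by blast+

lemma linked_inside: "linked A \<Longrightarrow> P \<subseteq> \<Union>A \<Longrightarrow> linked (A \<union> inside G P)"
  by (rule linked_closure[of A]) (auto simp only: frontier_inside(2))

lemma mset_set_delete: "finite P \<Longrightarrow> x \<in> P \<Longrightarrow> mset_set P - {#x#} = mset_set (P - {x})"
  by (simp add: mset_set_Diff)

text \<open>
  A vertex off the frontier has only clean edges, so its searcher may leave.
\<close>

lemma cleans_trim:
  assumes "cleans G k S (A \<union> inside G P) P" "A \<subseteq> edges G" "linked A" "P \<subseteq> \<Union>A"
    "frontier (edges G) {} {} A \<subseteq> P"
  shows "\<exists>S'. cleans G k S' (A \<union> inside G (frontier (edges G) {} {} A)) (frontier (edges G) {} {} A)"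
  using assms
proof (induction "card P" arbitrary: S P rule: less_induct)
  case less
  let ?F = "frontier (edges G) {} {} A"
  show ?case
  proof (cases "P = ?F")
    case True then show ?thesis using less by auto
  next
    case False
    then obtain x where x: "x \<in> P" "x \<notin> ?F" using less by auto
    have fin: "finite P" "card P \<le> k" using less.prems(1) unfolding cleans_def by (auto dest: spec[of _ "length S"])
    let ?P = "P - {x}"
    have eq: "A \<union> inside G ?P = A \<union> inside G P"
      using x less.prems(4) unfolding inside_def frontier_def by blast
    have "cleans G k (S @ [Delete x]) (A \<union> inside G ?P) ?P"
    proof (rule cleans_snoc[OF less.prems(1)])
      show "legal_move G (mset_set P) (Delete x)" using x fin by simp
      show "make_move (Delete x) (mset_set P) = mset_set ?P" using x fin by (simp add: mset_set_delete)
      show "finite ?P" "card ?P \<le> k" using fin by (auto intro: order_trans[OF card_Diff1_le])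
      show "A \<union> inside G ?P = A \<union> inside G P \<union> inside G ?P \<union> (case Delete x of Slide v u \<Rightarrow> {{v, u}} | _ \<Rightarrow> {})"
        using eq by auto
      have "?P \<subseteq> \<Union>A" using less.prems by auto
      then show "linked (A \<union> inside G ?P)" by (rule linked_inside[OF less.prems(3)])
      show "frontier (edges G) {} {} (A \<union> inside G ?P) \<subseteq> ?P"
        using frontier_inside(1)[OF \<open>?P \<subseteq> \<Union>A\<close>, of G] less.prems(5) x(2) by blast
    qed
    moreover have "card ?P < card P" using card_Diff1_less[OF fin(1) x(1)] .
    ultimately show ?thesis using less.hyps[of ?P "S @ [Delete x]"] less.prems x by blast
  qed
qed

lemma cleans_place:
  assumes c: "cleans G k S C P" and x: "x \<notin> P" "x \<in> verts G" and k: "card P < k"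
    and Q: "Q = C \<union> inside G (insert x P)" and fr: "frontier (edges G) {} {} Q \<subseteq> insert x P"
    and l: "linked Q"
  shows "\<exists>S'. cleans G k S' Q (insert x P)"
proof -
  have fin: "finite P" using c unfolding cleans_def by auto
  have "cleans G k (S @ [Place x]) Q (insert x P)"
    by (rule cleans_snoc[OF c _ _ _ _ _ fr l]) (use x k fin Q in auto)
  then show ?thesis by blast
qed

text \<open>
  Between two steps the searchers occupy exactly the frontier. This restriction guarantees that an
  edge cleaned prematurely is not recontaminated: an endpoint is only left when all edges at it
  have been reached by the search.
\<close>

lemma cleans_step:
  assumes G: "simple_graph G" and A: "A \<subseteq> edges G" "linked A"
    and c: "cleans G k S (A \<union> inside G (frontier (edges G) {} {} A)) (frontier (edges G) {} {} A)"
    and st: "step (edges G) {} {} k A A'"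
  shows "\<exists>S'. cleans G k S' (A' \<union> inside G (frontier (edges G) {} {} A')) (frontier (edges G) {} {} A')"
proof -
  let ?E = "edges G" let ?F = "frontier ?E {} {}"
  have E: "edge_set ?E" by (rule simple_graph_edge_set[OF G])
  have V: "\<Union>?E \<subseteq> verts G" using G unfolding simple_graph_def by auto
  have A': "A' \<subseteq> ?E" "linked A'" using step_edges[OF st A(1)] linked_step[OF E A(2) st] by auto
  have finF: "finite (?F A)" using c unfolding cleans_def by auto
  have FA: "?F B \<subseteq> \<Union>B" for B unfolding frontier_def by auto
  have sz: "card (?F A) \<le> k" using c unfolding cleans_def by (auto dest: spec[of _ "length S"])
  have "\<exists>S' P. cleans G k S' (A' \<union> inside G P) P \<and> P \<subseteq> \<Union>A' \<and> ?F A' \<subseteq> P"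
    using st
  proof cases
    case (add e)
    then have e: "e \<in> ?E" "e \<notin> A" "touches {} A e" "card (?F A \<union> e) \<le> k" unfolding ok_add_def by auto
    have fine: "finite e" "card e = 2" "e \<subseteq> verts G" using edge_setD(2,3)[OF E e(1)] e(1) V by auto
    let ?P = "?F A \<union> e"
    have PA: "?P \<subseteq> \<Union>A'" using FA[of A] add by auto
    have F': "?F A' \<subseteq> ?P" using frontier_insert add by metis
    have eP: "A \<union> inside G ?P = A' \<union> inside G ?P" using add e unfolding inside_def by auto
    have "\<exists>S'. cleans G k S' (A' \<union> inside G ?P) ?P"
    proof (cases "A = {}")
      case False
      then obtain a where a: "a \<in> e" "a \<in> ?F A" using e unfolding touches_def frontier_def by blast
      obtain b where b: "e = {a, b}" "a \<noteq> b" using edge_other[OF fine(2) a(1)] by metis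
      show ?thesis
      proof (cases "b \<in> ?F A")
        case True
        then have "?P = ?F A" using a b by auto
        then show ?thesis using c eP by auto
      next
        case bn: False
        have P: "?P = insert b (?F A)" using a b by auto
        have *: "A' \<union> inside G ?P = A \<union> inside G (?F A) \<union> inside G (insert b (?F A))"
          using eP P unfolding inside_def by auto
        have "?F (A' \<union> inside G ?P) \<subseteq> ?P" using frontier_inside(1)[OF PA, of G] F' by blast
        moreover have "linked (A' \<union> inside G ?P)" by (rule linked_inside[OF A'(2) PA])
        moreover have "b \<in> verts G" "card (?F A) < k" using fine(3) b e(4) finF bn P by auto
        ultimately show ?thesis using cleans_place[OF c bn _ _ *] unfolding P by blast
      qed
    next
      case True
      obtain a b where b: "e = {a, b}" "a \<noteq> b" using fine(2) by (meson card_2_iff)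
      have F0: "?F A = {}" "?P = {b, a}" using True b unfolding frontier_def by auto
      have k2: "2 \<le> k" using e(4) F0 b by auto
      have i0: "inside G {} = {}" "inside G {a} = {}"
        using E subset_singletonD unfolding inside_def edge_set_def by fastforce+
      have c0: "cleans G k S {} {}" using c F0 True i0 by simp
      have "\<exists>S'. cleans G k S' {} {a}"
        by (rule cleans_place[OF c0]) (use fine(3) b k2 i0 in \<open>auto simp: frontier_def linked_def\<close>)
      then obtain S1 where S1: "cleans G k S1 {} {a}" by auto
      have "\<exists>S'. cleans G k S' (A' \<union> inside G ?P) {b, a}"
      proof (rule cleans_place[OF S1])
        show "A' \<union> inside G ?P = {} \<union> inside G {b, a}" using eP True F0 by simp
        show "?F (A' \<union> inside G ?P) \<subseteq> {b, a}"
          using frontier_inside(1)[OF PA, of G] F' F0 by auto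
        show "linked (A' \<union> inside G ?P)" by (rule linked_inside[OF A'(2) PA])
      qed (use fine b k2 in auto)
      then show ?thesis unfolding F0(2) .
    qed
    then show ?thesis using PA F' by blast
  next
    case (slide e u)
    then have e: "e \<in> ?E" "e \<notin> A" "u \<in> e" "u \<in> ?F A" "u \<notin> ?F A'" "card (?F A \<union> e - {u}) \<le> k"
      unfolding ok_slide_def by auto
    obtain w where w: "e = {u, w}" "u \<noteq> w" using edge_other[OF edge_setD(2)[OF E e(1)] e(3)] by metis
    have F': "?F A' \<subseteq> ?F A \<union> e - {u}" using frontier_insert[of ?E "{}" "{}" e A] e(5) slide by auto
    have AU: "\<Union>A' = \<Union>A \<union> e" using slide by auto
    show ?thesis
    proof (cases "w \<in> ?F A")
      case True
      have "e \<in> inside G (?F A)" using e(1,4) w True unfolding inside_def by auto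
      then have "A \<union> inside G (?F A) = A' \<union> inside G (?F A)" using slide by auto
      moreover have "?F A \<subseteq> \<Union>A'" using FA[of A] AU by blast
      moreover have "?F A' \<subseteq> ?F A" using F' True w by auto
      ultimately show ?thesis using c by metis
    next
      case False
      let ?P = "insert w (?F A - {u})"
      have P: "?P = ?F A \<union> e - {u}" using w by auto
      have PA: "?P \<subseteq> \<Union>A'" using FA[of A] AU w by blast
      have eq: "A' \<union> inside G ?P = A \<union> inside G (?F A) \<union> inside G ?P \<union> {{u, w}}"
      proof -
        have "g \<in> A' \<union> inside G ?P" if g: "g \<in> inside G (?F A)" for g
        proof (cases "u \<in> g")
          case True
          have "g \<in> A'"
          proof (rule ccontr)
            assume "g \<notin> A'"
            then have "u \<in> ?F A'" using True g AU e(3) unfolding frontier_def inside_def by blast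
            then show False using e(5) by simp
          qed
          then show ?thesis by simp
        next
          case False then show ?thesis using g unfolding inside_def by auto
        qed
        then have "inside G (?F A) \<subseteq> A' \<union> inside G ?P" by blast
        then show ?thesis using slide w by auto
      qed
      have "cleans G k (S @ [Slide u w]) (A' \<union> inside G ?P) ?P"
      proof (rule cleans_snoc[OF c])
        show "legal_move G (mset_set (?F A)) (Slide u w)" using e finF w by simp
        show "make_move (Slide u w) (mset_set (?F A)) = mset_set ?P"
          using e finF w False by (simp add: mset_set_delete)
        show "card ?P \<le> k" using e(6) P by simp
        show "?F (A' \<union> inside G ?P) \<subseteq> ?P" using frontier_inside(1)[OF PA, of G] F' P by blast
        show "linked (A' \<union> inside G ?P)" by (rule linked_inside[OF A'(2) PA])
      qed (use eq finF in auto)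
      then show ?thesis using PA F' P by blast
    qed
  next
    case (pend e f u)
    then have p: "e \<in> ?E" "e \<notin> A" "f \<in> ?E" "f \<notin> A" "e \<noteq> f" "u \<in> e" "u \<in> f" "u \<notin> \<Union>A"
     "f \<inter> \<Union>A \<noteq> {}" "\<And>g. g\<in>?E \<Longrightarrow> g \<inter> (e - {u}) \<noteq> {} \<Longrightarrow> g = e" "card (?F A \<union> f) \<le> k"
      unfolding ok_pend_def by auto
    obtain q where ep: "e = {u, q}" "u \<noteq> q" using edge_other edge_setD(2)[OF E p(1)] p(6) by metis
    obtain y where fy: "f = {u, y}" "u \<noteq> y" using edge_other edge_setD(2)[OF E p(3)] p(7) by metis
    have only: "g = e" if "g \<in> ?E" "q \<in> g" for g using p(10) that ep by auto
    have qA: "q \<notin> \<Union>A" using only A(1) p(2) by blast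
    have qF: "q \<notin> ?F A" "u \<notin> ?F A" using FA[of A] qA p(8) by blast+
    have yF: "y \<in> ?F A" using p(3,4,8,9) fy unfolding frontier_def by auto
    have fF: "?F A \<union> f = insert u (?F A)" using fy yF by auto
    have cF: "card (?F A) < k" using p(11) fF qF finF by simp
    let ?P = "insert u (?F A)"
    have AU: "\<Union>A' = \<Union>A \<union> e \<union> f" using pend by auto
    have PA: "?P \<subseteq> \<Union>A'" using FA[of A] AU p(6) by blast
    have F': "?F A' \<subseteq> ?P"
    proof
      fix x assume x: "x \<in> ?F A'"
      have "x \<noteq> q" using x only pend unfolding frontier_def by auto
      moreover have "x \<in> ?F A \<union> e \<union> f" using x pend unfolding frontier_def by auto
      ultimately show "x \<in> ?P" using ep fF by auto
    qed
    let ?C = "A \<union> inside G (?F A)"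
    have PA0: "?F A \<subseteq> \<Union>A" by (rule FA)
    have same: "?C \<union> inside G (insert q (?F A)) = ?C"
    proof -
      have "g \<in> inside G (?F A)" if g: "g \<in> inside G (insert q (?F A))" for g
      proof -
        have "q \<notin> g" using only[of g] g ep qF unfolding inside_def by auto
        then show ?thesis using g unfolding inside_def by auto
      qed
      then show ?thesis by blast
    qed
    have "\<exists>S'. cleans G k S' ?C (insert q (?F A))"
      by (rule cleans_place[OF c qF(1) _ cF same[symmetric]])
        (use p(1) V ep frontier_inside(1)[OF PA0, of G] linked_inside[OF A(2) PA0] in auto)
    then obtain S1 where S1: "cleans G k S1 ?C (insert q (?F A))" by auto
    have "cleans G k (S1 @ [Slide q u]) (A' \<union> inside G ?P) ?P"
    proof (rule cleans_snoc[OF S1])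
      show "legal_move G (mset_set (insert q (?F A))) (Slide q u)"
        using p(1) ep finF by (simp add: insert_commute)
      show "make_move (Slide q u) (mset_set (insert q (?F A))) = mset_set ?P"
        using finF qF by simp
      show "finite ?P" "card ?P \<le> k" using finF qF cF by auto
      have "f \<in> inside G ?P" using p(3) fy yF unfolding inside_def by auto
      moreover have "inside G (?F A) \<subseteq> inside G ?P" unfolding inside_def by auto
      moreover have "{q, u} = e" using ep by auto
      ultimately show "A' \<union> inside G ?P = ?C \<union> inside G ?P \<union> (case Slide q u of Slide v u \<Rightarrow> {{v, u}} | _ \<Rightarrow> {})"
        using pend by auto
      show "?F (A' \<union> inside G ?P) \<subseteq> ?P" using frontier_inside(1)[OF PA, of G] F' by blast
      show "linked (A' \<union> inside G ?P)" by (rule linked_inside[OF A'(2) PA])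
    qed
    then show ?thesis using PA F' by blast
  qed
  then obtain S' P where "cleans G k S' (A' \<union> inside G P) P" "P \<subseteq> \<Union>A'" "?F A' \<subseteq> P" by blast
  from cleans_trim[OF this(1) A' this(2,3)] show ?thesis .
qed

lemma search_strategy_exists:
  assumes G: "simple_graph G" and s: "search (edges G) {} {} k"
  shows "\<exists>S. search_strategy G S \<and> complete_strategy G S \<and> connected_strategy G S \<and>
     monotone_strategy G S \<and> searchers_used S \<le> k"
proof -
  let ?E = "edges G" let ?F = "frontier ?E {} {}"
  have E: "edge_set ?E" by (rule simple_graph_edge_set[OF G])
  have "steps ?E {} {} k {} A \<Longrightarrow> \<exists>S'. cleans G k S' (A \<union> inside G (?F A)) (?F A)" for A
  proof (induction rule: rtranclp_induct)
    case base
    have "inside G {} = {}" using E unfolding inside_def edge_set_def by fastforce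
    then have "cleans G k [] ({} \<union> inside G (?F {})) (?F {})"
      unfolding cleans_def search_strategy_def monotone_strategy_def connected_strategy_def searchers_def frontier_def
      by (simp add: graph_connected_def)
    then show ?case by blast
  next
    case (step A A')
    then obtain S where S: "cleans G k S (A \<union> inside G (?F A)) (?F A)" by blast
    have "A \<subseteq> ?E" using steps_edges[OF step(1)] by blast
    from cleans_step[OF G this linked_steps[OF step(1) E] S step(2)] show ?case .
  qed
  then obtain S where S: "cleans G k S (?E \<union> inside G (?F ?E)) (?F ?E)"
    using s unfolding search_def by blast
  have "?E \<union> inside G (?F ?E) = ?E" unfolding inside_def by auto
  then have "complete_strategy G S" using S unfolding cleans_def complete_strategy_def by auto
  moreover have "searchers_used S \<le> k" using S unfolding cleans_def searchers_used_def by auto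
  ultimately show ?thesis using S unfolding cleans_def by auto
qed

lemma cmms_le:
  assumes "simple_graph G" "search (edges G) {} {} k"
  shows "cmms G \<le> k"
proof -
  obtain S where S: "search_strategy G S" "complete_strategy G S" "connected_strategy G S"
     "monotone_strategy G S" "searchers_used S \<le> k" using search_strategy_exists[OF assms] by blast
  then have "cmms G \<le> searchers_used S" unfolding cmms_def by (intro Least_le) auto
  then show ?thesis using S by simp
qed

section \<open>From strategies to searches\<close>

lemma card_set_mset_le: "card (set_mset M) \<le> size M"
  by (induction M) (auto simp: card_insert_if)

text \<open>
  Since \<open>Q\<close> is connected, its edges can be added in an order in which each one touches the clean part, and
  none of them needs searchers other than those on \<open>P\<close>.
\<close>

lemma reach_inside:
  assumes Q: "Q \<subseteq> E" and E: "edge_set E" and l: "linked Q" and P: "card P \<le> k" "finite P"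
    and A: "A \<subseteq> Q" "frontier E {} {} A \<subseteq> P" "\<And>e. e \<in> Q \<Longrightarrow> e \<notin> A \<Longrightarrow> e \<subseteq> P"
  shows "steps E {} {} k A Q"
  using A
proof (induction "card (Q - A)" arbitrary: A rule: less_induct)
  case less
  have ne: "\<forall>e\<in>Q. e \<noteq> {}" using Q E unfolding edge_set_def by fastforce
  have finQ: "finite Q" using Q E unfolding edge_set_def by (auto intro: finite_subset)
  show ?case
  proof (cases "A = Q")
    case False
    then obtain e where e: "e \<in> Q" "e \<notin> A" "touches {} A e"
      using linked_touch[OF l less.prems(1) _ ne] by blast
    have eP: "e \<subseteq> P" using less.prems(3) e by auto
    have "frontier E {} {} A \<union> e \<subseteq> P" using eP less.prems by auto
    then have "card (frontier E {} {} A \<union> e) \<le> k" using P card_mono le_trans by blast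
    then have "ok_add E {} {} k A e" using e Q unfolding ok_add_def by auto
    then have st: "step E {} {} k A (insert e A)" by (rule step.add)
    have "frontier E {} {} (insert e A) \<subseteq> P" using frontier_insert[of E "{}" "{}" e A] less.prems(2) eP by blast
    moreover have "card (Q - insert e A) < card (Q - A)"
      by (rule psubset_card_mono) (use finQ e in auto)
    ultimately have "steps E {} {} k (insert e A) Q" using less e by blast
    then show ?thesis using st by (rule converse_rtranclp_into_rtranclp[rotated])
  qed simp
qed

text \<open>
  In a monotone strategy each move adds edges between occupied vertices and possibly the edge of
  the slide, so a search can follow. Only a slide whose origin is not occupied afterwards needs
  care. Its origin has no other contaminated edge, and if it meets no clean edge
  either, it is a pendant vertex.
\<close>

lemma strategy_search:
  assumes G: "simple_graph G" and S: "search_strategy G S" and mon: "monotone_strategy G S"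
    and con: "connected_strategy G S" and sz: "\<And>i. i \<le> length S \<Longrightarrow> size (searchers S i) \<le> k" and k: "2 \<le> k"
  shows "i \<le> length S \<Longrightarrow> steps (edges G) {} {} k {} (clean_edges G S i) \<and>
     frontier (edges G) {} {} (clean_edges G S i) \<subseteq> occupied S i \<and>
     inside G (occupied S i) \<subseteq> clean_edges G S i \<and> clean_edges G S i \<subseteq> edges G"
proof (induction i)
  case 0
  have "inside G {} = {}" using simple_graph_edge_set[OF G] unfolding inside_def edge_set_def by fastforce
  then show ?case unfolding occupied_def searchers_def frontier_def by simp
next
  case (Suc i)
  let ?E = "edges G" let ?F = "frontier (edges G) {} {}" let ?R = "steps (edges G) {} {} k"
  have E: "edge_set ?E" by (rule simple_graph_edge_set[OF G])
  have i: "i < length S" using Suc by auto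
  define A where "A = clean_edges G S i"
  define Q where "Q = clean_edges G S (Suc i)"
  define P where "P = occupied S i"
  define P' where "P' = occupied S (Suc i)"
  define m where "m = S ! i"
  have IH: "?R {} A" "?F A \<subseteq> P" "inside G P \<subseteq> A" "A \<subseteq> ?E" using Suc i unfolding A_def P_def by auto
  have Q': "Q = {e \<in> A \<union> cleaned_edges G S (Suc i). \<not> contaminated G P' (A \<union> cleaned_edges G S (Suc i)) e}"
    unfolding Q_def A_def P'_def by (simp add: Let_def)
  have "\<not> Q \<subset> A \<union> cleaned_edges G S (Suc i)"
  proof -
    have "\<not> recontamination_move G S (Suc i)" using mon i unfolding monotone_strategy_def by auto
    then show ?thesis unfolding recontamination_move_def Q_def A_def by (simp only: diff_Suc_1 not_False_eq_True)
  qed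
  then have Q: "Q = A \<union> cleaned_edges G S (Suc i)" using Q' by auto
  then have nc: "\<not> contaminated G P' Q e" if "e \<in> Q" for e using Q' that by auto
  have legal: "legal_move G (searchers S i) m" using S i unfolding search_strategy_def m_def by auto
  have ce: "cleaned_edges G S (Suc i) = inside G P' \<union> (case m of Slide v u \<Rightarrow> {{v, u}} | _ \<Rightarrow> {})"
    unfolding cleaned_edges_def P'_def inside_def m_def by simp
  have QE: "Q \<subseteq> ?E" using IH(4) legal unfolding Q ce inside_def by (auto split: move.splits)
  have FQ: "?F Q \<subseteq> P'" using contaminated_frontier[OF G QE] nc by blast
  have l: "linked Q" using con Suc.prems unfolding connected_strategy_def linked_iff Q_def by auto
  have P'm: "P' = set_mset (make_move m (searchers S i))"
    unfolding P'_def occupied_def m_def using searchers_Suc[OF i] by simp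
  have Pm: "P = set_mset (searchers S i)" unfolding P_def occupied_def ..
  have fin: "finite P" "finite P'" unfolding P_def P'_def occupied_def by auto
  have cP: "card P \<le> k" "card P' \<le> k"
    unfolding P_def P'_def occupied_def using card_set_mset_le sz Suc.prems i by (meson le_trans less_imp_le)+
  have cle: "card X \<le> k" if "X \<subseteq> P \<or> X \<subseteq> P'" for X
    using that card_mono[OF fin(1), of X] card_mono[OF fin(2), of X] cP by linarith
  note reach = reach_inside[OF QE E l cP(2) fin(2)]
  have "?R A Q"
  proof (cases m)
    case (Place v)
    then have "P \<subseteq> P'" unfolding Pm P'm by auto
    then show ?thesis using IH(2) unfolding Q ce Place inside_def
      by (intro reach[unfolded Q ce Place inside_def]) auto
  next
    case (Delete v)
    then have "P' \<subseteq> P" unfolding Pm P'm by (auto dest: in_diffD)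
    then have "Q = A" using IH(3) unfolding Q ce Delete inside_def by auto
    then show ?thesis by simp
  next
    case (Slide v u)
    let ?e = "{v, u}"
    have vu: "v \<in> P" "?e \<in> ?E" using legal Slide unfolding Pm by auto
    have c2: "card ?e = 2" using E vu edge_setD by blast
    then have ne: "v \<noteq> u" by auto
    have "x \<in># searchers S i - {#v#}" if "x \<in># searchers S i" "x \<noteq> v" for x
      using that by (metis diff_single_trivial insert_DiffM insert_noteq_member)
    then have uP': "u \<in> P'" "P - {v} \<subseteq> P'" "P' \<subseteq> insert u P"
      unfolding Pm P'm Slide by (auto dest: in_diffD)
    have eQ: "?e \<in> Q" unfolding Q ce Slide by auto
    have new: "g \<subseteq> P'" if "g \<in> Q" "g \<notin> A" "g \<noteq> ?e" for g
      using that unfolding Q ce Slide inside_def by auto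
    have AQ: "A \<subseteq> Q" unfolding Q by auto
    show ?thesis
    proof (cases "v \<in> P'")
      case True
      then have "P \<subseteq> P'" "?e \<subseteq> P'" using uP' by auto
      then show ?thesis using reach[OF AQ] IH(2) new by blast
    next
      case vn: False
      \<comment> \<open>Nobody stays at \<open>v\<close>, so monotonicity leaves no contaminated edge there.\<close>
      have dirty: "g = ?e" if "g \<in> ?E" "v \<in> g" "g \<notin> A" for g
      proof (rule ccontr)
        assume n: "g \<noteq> ?e"
        have "v \<in> \<Union>Q" using eQ by auto
        moreover have "v \<notin> ?F Q" using FQ vn by auto
        ultimately have "g \<in> Q" using that unfolding frontier_def by auto
        then show False using new[OF _ that(3) n] that(2) vn by auto
      qed
      have vF: "v \<notin> ?F B" if "A \<subseteq> B" "?e \<in> B" for B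
        using dirty that unfolding frontier_def by auto
      have PP: "X \<subseteq> P'" if "X \<subseteq> insert u P" "v \<notin> X" for X using that uP' by blast
      show ?thesis
      proof (cases "?e \<in> A")
        case True
        then have "?F A \<subseteq> P'" using vF IH(2) by (intro PP) auto
        then show ?thesis using reach[OF AQ] new True by blast
      next
        case eA: False
        have rest: "?R B Q" if "insert ?e A \<subseteq> B" "B \<subseteq> Q" "?F B \<subseteq> ?F A \<union> ?e \<union> X" "X \<subseteq> P'" for B X
        proof -
          have "v \<notin> ?F B" using vF that by auto
          moreover have "?F B \<subseteq> insert v (insert u P \<union> P')" using that IH(2) by auto
          ultimately have "?F B \<subseteq> P'" using uP' by blast
          then show ?thesis using reach[OF that(2)] new that(1) by blast
        qed
        have rest1: "?R (insert ?e A) Q"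
          by (rule rest[where X = "{}"]) (use AQ eQ frontier_insert[of ?E "{}" "{}" ?e A] in auto)
        have other: "u \<in> g" if "g \<in> Q" "g \<notin> A" "g \<noteq> ?e" for g
        proof (rule ccontr)
          assume "u \<notin> g"
          then have "g \<subseteq> P" using new[OF that] uP'(3) by auto
          then show False using IH(3) that(1,2) QE unfolding inside_def by auto
        qed
        show ?thesis
        proof (cases "v \<in> \<Union>A")
          case True
          have "v \<in> ?F A" using True eA vu unfolding frontier_def by auto
          moreover have "card (?F A \<union> ?e - {v}) \<le> k"
          proof -
            have "?F A \<union> ?e - {v} \<subseteq> P'" using IH(2) by (intro PP) auto
            then show ?thesis using cle by simp
          qed
          ultimately have "ok_slide ?E {} {} k A ?e v"
            using eA vu vF[of "insert ?e A"] unfolding ok_slide_def by auto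
          then have "step ?E {} {} k A (insert ?e A)" by (rule step.slide)
          then show ?thesis using rest1 by (rule converse_rtranclp_into_rtranclp)
        next
          case vA: False
          show ?thesis
          proof (cases "A = {} \<or> u \<in> \<Union>A")
            case True
            have "card (?F A \<union> ?e) \<le> k"
            proof (cases "A = {}")
              case True
              then have "?F A \<union> ?e = ?e" unfolding frontier_def by auto
              then show ?thesis using c2 k by simp
            next
              case False
              then have "u \<in> ?F A" using True eA vu unfolding frontier_def by auto
              then have "?F A \<union> ?e \<subseteq> P" using IH(2) vu by auto
              then show ?thesis using cle by simp
            qed
            then have "ok_add ?E {} {} k A ?e"
              using True eA vu unfolding ok_add_def touches_def by auto
            then have "step ?E {} {} k A (insert ?e A)" by (rule step.add)
            then show ?thesis using rest1 by (rule converse_rtranclp_into_rtranclp)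
          next
            case False
            have ne: "\<forall>e\<in>Q. e \<noteq> {}" using QE E unfolding edge_set_def by fastforce
            have "A \<noteq> Q" using eA eQ by auto
            then obtain f where f: "f \<in> Q" "f \<notin> A" "f \<inter> \<Union>A \<noteq> {}"
              using linked_touch[OF l AQ _ ne] False unfolding touches_def by blast
            have fe: "f \<noteq> ?e" using f(3) vA False by auto
            have fP: "f \<subseteq> P'" "u \<in> f" using new[OF f(1,2) fe] other[OF f(1,2) fe] by auto
            have "card (?F A \<union> f) \<le> k"
            proof -
              have "v \<notin> ?F A" using vA unfolding frontier_def by auto
              then have "?F A \<subseteq> P'" using IH(2) by (intro PP) auto
              then have "?F A \<union> f \<subseteq> P'" using fP by auto
              then show ?thesis using cle by simp
            qed
            then have cost: "card (?F A \<union> f) \<le> k" .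
            have only: "g = ?e" if "g \<in> ?E" "v \<in> g" for g using dirty[OF that] vA that(2) by blast
            have ev: "?e - {u} = {v}" using \<open>v \<noteq> u\<close> by auto
            have "ok_pend ?E {} {} k A ?e f u"
              unfolding ok_pend_def ev
            proof (intro conjI)
              show "f \<in> ?E" using f QE by blast
              show "u \<notin> \<Union>A \<union> {}" using False by blast
              show "f \<inter> (\<Union>A \<union> {}) \<noteq> {}" using f(3) by simp
              show "\<forall>g\<in>?E. g \<inter> {v} \<noteq> {} \<longrightarrow> g = ?e" using only by blast
              show "?e \<noteq> f" using fe by simp
              show "u \<in> ?e" "{v} \<inter> ({} \<union> {}) = {}" by simp_all
            qed (fact eA vu(2) f(2) fP(2) cost)+
            then have st: "step ?E {} {} k A (insert ?e (insert f A))" by (rule step.pend)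
            have "?R (insert ?e (insert f A)) Q"
            proof (rule rest[OF _ _ _ fP(1)])
              show "?F (insert ?e (insert f A)) \<subseteq> ?F A \<union> ?e \<union> f"
                using frontier_insert[of ?E "{}" "{}" ?e "insert f A"] frontier_insert[of ?E "{}" "{}" f A] by blast
            qed (use AQ f eQ in auto)
            with st show ?thesis by (rule converse_rtranclp_into_rtranclp)
          qed
        qed
      qed
    qed
  qed
  then have "?R {} Q" using IH(1) by (meson rtranclp_trans)
  then show ?case using FQ QE ce unfolding Q_def[symmetric] P'_def[symmetric] unfolding Q by auto
qed

text \<open>
  The second search only shows that the minimum defining \<open>cmms\<close> is attained.
\<close>

lemma cmms_gt:
  assumes G: "simple_graph G" and k: "2 \<le> k" and no: "\<not> search (edges G) {} {} k"
    and ex: "search (edges G) {} {} n"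
  shows "cmms G > k"
proof (rule ccontr)
  assume "\<not> cmms G > k"
  let ?P = "\<lambda>n. \<exists>S. search_strategy G S \<and> complete_strategy G S \<and> connected_strategy G S \<and>
     monotone_strategy G S \<and> searchers_used S = n"
  obtain m where "?P m" using search_strategy_exists[OF G ex] by blast
  then have "?P (cmms G)" unfolding cmms_def by (rule LeastI)
  then obtain S where S: "search_strategy G S" "complete_strategy G S" "connected_strategy G S"
     "monotone_strategy G S" "searchers_used S = cmms G" by blast
  have "size (searchers S i) \<le> k" if "i \<le> length S" for i
  proof -
    have "size (searchers S i) \<le> searchers_used S"
      unfolding searchers_used_def by (rule Max_ge) (use that in auto)
    then show ?thesis using S(5) \<open>\<not> cmms G > k\<close> by simp
  qed
  note aux = strategy_search[OF G S(1,4,3) this k]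
  obtain i where "i \<le> length S" "clean_edges G S i = edges G" using S(2) unfolding complete_strategy_def by auto
  then have "search (edges G) {} {} k" using aux[of i] unfolding search_def by auto
  then show False using no by simp
qed

section \<open>Proper contractions of graphs\<close>

lemma connected_fibre:
  assumes "graph_connected (induced_subgraph G X)" "x \<in> X" "y \<in> X"
  shows "(x, y) \<in> {(s, t). {s, t} \<in> edges G \<and> s \<in> X \<and> t \<in> X}\<^sup>*"
proof -
  have "(x, y) \<in> {(s, t). {s, t} \<in> edges (induced_subgraph G X) \<and> s \<in> verts (induced_subgraph G X) \<and> t \<in> verts (induced_subgraph G X)}\<^sup>*"
    using assms unfolding graph_connected_iff by (simp add: induced_subgraph_def)
  then show ?thesis by (rule subsetD[OF rtrancl_mono, rotated]) (auto simp: induced_subgraph_def)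
qed

text \<open>
  The union of two connected fibres is connected if and only if an edge joins them.
\<close>

lemma contraction_edges:
  assumes G: "simple_graph G" and H: "simple_graph H"
    and sur: "\<phi> ` verts G = verts H"
    and fib: "\<And>v. v\<in>verts H \<Longrightarrow> graph_connected (induced_subgraph G {x \<in> verts G. \<phi> x = v})"
    and adj: "\<And>u v. u\<in>verts H \<Longrightarrow> v\<in>verts H \<Longrightarrow> u \<noteq> v \<Longrightarrow> ({u, v} \<in> edges H \<longleftrightarrow>
            graph_connected (induced_subgraph G ({x \<in> verts G. \<phi> x = u} \<union> {x \<in> verts G. \<phi> x = v})))"
  shows "edges H = img \<phi> (edges G)"
proof (intro set_eqI iffI)
  fix h assume h: "h \<in> edges H"
  then have "card h = 2" "h \<subseteq> verts H" using H unfolding simple_graph_def by auto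
  then obtain u v where uv: "h = {u, v}" "u \<noteq> v" "u \<in> verts H" "v \<in> verts H" by (auto simp: card_2_iff)
  let ?X = "{x \<in> verts G. \<phi> x = u} \<union> {x \<in> verts G. \<phi> x = v}"
  obtain x y where xy: "x \<in> verts G" "\<phi> x = u" "y \<in> verts G" "\<phi> y = v" using uv sur by (metis imageE)
  have "graph_connected (induced_subgraph G ?X)" using adj[OF uv(3,4,2)] h uv(1) by simp
  from connected_fibre[OF this, of x y] xy
  have "(x, y) \<in> {(s, t). {s, t} \<in> edges G \<and> s \<in> ?X \<and> t \<in> ?X}\<^sup>*" by simp
  then have "\<phi> y = u \<or> (\<exists>s t. {s, t} \<in> edges G \<and> \<phi> s = u \<and> \<phi> t = v)"
  proof (induction rule: rtrancl_induct)
    case base then show ?case using xy by simp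
  next
    case (step s t) then show ?case by auto
  qed
  then obtain s t where "{s, t} \<in> edges G" "\<phi> s = u" "\<phi> t = v" using xy uv by auto
  then have "{s, t} \<in> edges G" "h = \<phi> ` {s, t}" "card (\<phi> ` {s, t}) = 2" using uv by auto
  then show "h \<in> img \<phi> (edges G)" unfolding img_def by blast
next
  fix h assume "h \<in> img \<phi> (edges G)"
  then obtain e where e: "e \<in> edges G" "h = \<phi> ` e" "card h = 2" unfolding img_def by auto
  have "card e = 2" "e \<subseteq> verts G" using G e unfolding simple_graph_def by auto
  then obtain x y where xy: "e = {x, y}" "x \<in> verts G" "y \<in> verts G" by (auto simp: card_2_iff)
  let ?u = "\<phi> x" let ?v = "\<phi> y"
  have uv: "?u \<in> verts H" "?v \<in> verts H" "?u \<noteq> ?v" using xy sur e by auto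
  let ?A = "{x \<in> verts G. \<phi> x = ?u}" let ?B = "{x \<in> verts G. \<phi> x = ?v}"
  let ?R = "{(s, t). {s, t} \<in> edges G \<and> s \<in> ?A \<union> ?B \<and> t \<in> ?A \<union> ?B}"
  have sym: "sym (?R\<^sup>*)" by (rule sym_rtrancl) (auto simp: sym_def insert_commute)
  have 1: "(s, x) \<in> ?R\<^sup>*" if "s \<in> ?A" for s
  proof -
    have "(s, x) \<in> {(s, t). {s, t} \<in> edges G \<and> s \<in> ?A \<and> t \<in> ?A}\<^sup>*"
      by (rule connected_fibre[OF fib[OF uv(1)]]) (use that xy in auto)
    then show ?thesis by (rule subsetD[OF rtrancl_mono, rotated]) auto
  qed
  have 2: "(s, y) \<in> ?R\<^sup>*" if "s \<in> ?B" for s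
  proof -
    have "(s, y) \<in> {(s, t). {s, t} \<in> edges G \<and> s \<in> ?B \<and> t \<in> ?B}\<^sup>*"
      by (rule connected_fibre[OF fib[OF uv(2)]]) (use that xy in auto)
    then show ?thesis by (rule subsetD[OF rtrancl_mono, rotated]) auto
  qed
  have "(y, x) \<in> ?R" using xy e by (auto simp: insert_commute)
  then have 3: "(s, x) \<in> ?R\<^sup>*" if "s \<in> ?A \<union> ?B" for s
    using 1 2 that by (meson UnE r_into_rtrancl rtrancl_trans)
  have 4: "(s, t) \<in> ?R\<^sup>*" if "s \<in> ?A \<union> ?B" "t \<in> ?A \<union> ?B" for s t
    using 3[OF that(1)] symD[OF sym 3[OF that(2)]] by (rule rtrancl_trans)
  have "{(s, t). {s, t} \<in> edges (induced_subgraph G (?A \<union> ?B)) \<and> s \<in> ?A \<union> ?B \<and> t \<in> ?A \<union> ?B} = ?R"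
    unfolding induced_subgraph_def by auto
  moreover have "verts (induced_subgraph G (?A \<union> ?B)) = ?A \<union> ?B" by (simp add: induced_subgraph_def)
  ultimately have "graph_connected (induced_subgraph G (?A \<union> ?B))"
    unfolding graph_connected_iff using 4 by simp
  then have "{?u, ?v} \<in> edges H" using adj[OF uv] by blast
  then show "h \<in> edges H" using e xy by simp
qed

text \<open>
  A contraction that is not an isomorphism identifies the ends of some edge, so it factors through
  the contraction of that edge.
\<close>

lemma proper_contraction_search:
  fixes G :: "'a graph" and H :: "'b graph"
  assumes G: "simple_graph G" and H: "simple_graph H" and pc: "proper_contraction H G"
    and con: "\<And>e. e \<in> edges G \<Longrightarrow> \<exists>z\<in>e. search (img (collapse e z) (edges G)) {} {} k" and k: "2 \<le> k"
  shows "search (edges H) {} {} k"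
proof -
  let ?E = "edges G"
  have E: "edge_set ?E" by (rule simple_graph_edge_set[OF G])
  have EV: "\<Union>?E \<subseteq> verts G" using G unfolding simple_graph_def by auto
  obtain \<phi> where sur: "\<phi> ` verts G = verts H"
    and fib: "\<And>v. v\<in>verts H \<Longrightarrow> graph_connected (induced_subgraph G {x \<in> verts G. \<phi> x = v})"
    and adj: "\<And>u v. u\<in>verts H \<Longrightarrow> v\<in>verts H \<Longrightarrow> u \<noteq> v \<Longrightarrow> ({u, v} \<in> edges H \<longleftrightarrow>
            graph_connected (induced_subgraph G ({x \<in> verts G. \<phi> x = u} \<union> {x \<in> verts G. \<phi> x = v})))"
    using pc unfolding proper_contraction_def contraction_def by blast
  have EH: "edges H = img \<phi> ?E" by (rule contraction_edges[OF G H sur fib adj])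
  let ?R = "{(s, t). {s, t} \<in> ?E \<and> \<phi> s = \<phi> t}"
  have path: "(x, y) \<in> ?R\<^sup>*" if "x \<in> verts G" "y \<in> verts G" "\<phi> x = \<phi> y" for x y
  proof -
    have "\<phi> x \<in> verts H" using sur that by auto
    from connected_fibre[OF fib[OF this], of x y] that
    have "(x, y) \<in> {(s, t). {s, t} \<in> ?E \<and> s \<in> {z \<in> verts G. \<phi> z = \<phi> x} \<and> t \<in> {z \<in> verts G. \<phi> z = \<phi> x}}\<^sup>*" by simp
    then show ?thesis by (rule subsetD[OF rtrancl_mono, rotated]) auto
  qed
  have ninj: "\<not> inj_on \<phi> (verts G)"
  proof
    assume inj: "inj_on \<phi> (verts G)"
    let ?f = "inv_into (verts G) \<phi>"
    have "bij_betw ?f (verts H) (verts G)"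
      using inj sur by (metis bij_betw_inv_into inj_on_imp_bij_betw)
    moreover have "{u, v} \<in> edges H \<longleftrightarrow> {?f u, ?f v} \<in> ?E" if uv: "u \<in> verts H" "v \<in> verts H" for u v
    proof
      assume "{u, v} \<in> edges H"
      then obtain e where e: "e \<in> ?E" "{u, v} = \<phi> ` e" unfolding EH img_def by auto
      have "e \<subseteq> verts G" using e EV by auto
      then have "e = ?f ` \<phi> ` e" using inj by (simp add: inv_into_image_cancel)
      then have "e = {?f u, ?f v}" using e(2) by (metis image_empty image_insert)
      then show "{?f u, ?f v} \<in> ?E" using e by simp
    next
      assume e: "{?f u, ?f v} \<in> ?E"
      have f: "\<phi> (?f u) = u" "\<phi> (?f v) = v" using uv sur by (simp_all add: f_inv_into_f)
      have "card {?f u, ?f v} = 2" using edge_setD(2)[OF E e] .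
      then have "u \<noteq> v" by auto
      then have im: "card (\<phi> ` {?f u, ?f v}) = 2" "\<phi> ` {?f u, ?f v} = {u, v}" using f by auto
      then have "\<phi> ` {?f u, ?f v} \<in> img \<phi> ?E" using e unfolding img_def by blast
      then show "{u, v} \<in> edges H" unfolding EH im(2) .
    qed
    ultimately have "graph_iso H G" unfolding graph_iso_def by blast
    then show False using pc unfolding proper_contraction_def by simp
  qed
  then obtain x y where xy: "x \<in> verts G" "y \<in> verts G" "\<phi> x = \<phi> y" "x \<noteq> y" unfolding inj_on_def by auto
  obtain t where t: "{x, t} \<in> ?E" "\<phi> x = \<phi> t"
    using path[OF xy(1-3)] xy(4) by (cases rule: converse_rtranclE) auto
  let ?e = "{x, t}"
  \<comment> \<open>The edge \<open>?e\<close> is contracted by \<open>\<phi>\<close>, so \<open>\<phi>\<close> factors through \<open>collapse ?e z\<close>.\<close>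
  obtain z where z: "z \<in> ?e" "search (img (collapse ?e z) ?E) {} {} k" using con[OF t(1)] by blast
  let ?c = "collapse ?e z"
  have cphi: "\<phi> (?c s) = \<phi> s" for s using z(1) t unfolding collapse_def by auto
  have idem: "?c (?c s) = ?c s" for s using z(1) unfolding collapse_def by auto
  have eq: "edges H = img \<phi> (img ?c ?E)"
    unfolding EH img_comp[OF E] by (rule img_cong) (simp add: cphi)
  have "fibres \<phi> (img ?c ?E) ({} \<union> {})"
    unfolding fibres_def
  proof (intro ballI impI)
    fix a b assume ab: "a \<in> \<Union>(img ?c ?E) \<union> ({} \<union> {})" "b \<in> \<Union>(img ?c ?E) \<union> ({} \<union> {})" "\<phi> a = \<phi> b"
    let ?R' = "{(s, t). {s, t} \<in> img ?c ?E \<and> \<phi> s = \<phi> t}"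
    have U: "\<Union>(img ?c ?E) \<subseteq> ?c ` \<Union>?E" by (rule Union_img)
    have cV: "?c s \<in> verts G" if "s \<in> \<Union>?E" for s using that z(1) t(1) EV unfolding collapse_def by auto
    obtain a' b' where a': "a' \<in> \<Union>?E" "a = ?c a'" "b' \<in> \<Union>?E" "b = ?c b'" using ab U by blast
    have ca: "?c a = a" "?c b = b" using a' idem by auto
    have "a \<in> verts G" "b \<in> verts G" using a' cV by auto
    from path[OF this ab(3)] have "(?c a, ?c b) \<in> ?R'\<^sup>*"
    proof (induction rule: rtrancl_induct)
      case (step s t')
      have "(?c s, ?c t') \<in> ?R'\<^sup>*"
      proof (cases "?c s = ?c t'")
        case False
        have im: "?c ` {s, t'} = {?c s, ?c t'}" "card (?c ` {s, t'}) = 2" using False by auto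
        moreover have "{s, t'} \<in> ?E" using step(2) by simp
        ultimately have "?c ` {s, t'} \<in> img ?c ?E" unfolding img_def by blast
        then have "{?c s, ?c t'} \<in> img ?c ?E" unfolding im(1) .
        moreover have "\<phi> (?c s) = \<phi> (?c t')" using step(2) cphi by simp
        ultimately show ?thesis by auto
      qed simp
      then show ?case using step(3) by (meson rtrancl_trans)
    qed simp
    then show "(a, b) \<in> ?R'\<^sup>*" unfolding ca .
  qed
  from search_img[OF z(2) edge_set_img[OF E] this _ k]
  have "search (img \<phi> (img ?c ?E)) {} {} k" by simp
  then show ?thesis unfolding eq .
qed

section \<open>Three blocks with a common root\<close>

text \<open>
  If the first clean edge is declared to be clean from the beginning, the search becomes one
  in which every later edge touches the clean part.
\<close>

lemma first_edge:
  assumes "steps E {} D k {} A" "edge_set E" "D = {}"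
  shows "A = {} \<or> (\<exists>e\<in>A. steps E e D k {} A)"
  using assms(1)
proof (induction rule: rtranclp_induct)
  case (step A A')
  show ?case
  proof (cases "A = {}")
    case True
    have no: "frontier E {} D {} = {}" unfolding frontier_def by simp
    from step(2) obtain e where e: "ok_add E {} D k {} e" "A' = {e}"
    proof cases
      case (add e) then show ?thesis using True that by auto
    next
      case (slide e u) then show ?thesis using True no unfolding ok_slide_def by auto
    next
      case (pend e f u) then show ?thesis using True unfolding ok_pend_def by auto
    qed
    have eE: "e \<in> E" "card e \<le> k" using e no unfolding ok_add_def by auto
    have "frontier E e D {} \<union> e = e" "e \<noteq> {}" using eE edge_setD(2)[OF assms(2) eE(1)] unfolding frontier_def by auto
    then have "ok_add E e D k {} e" using eE unfolding ok_add_def touches_def by auto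
    then have "step E e D k {} {e}" by (rule step.add)
    then show ?thesis using e(2) by auto
  next
    case False
    then obtain e where e: "e \<in> A" "steps E e D k {} A" using step by auto
    have fr: "frontier E e D B = frontier E {} D B" if "A \<subseteq> B" for B
      using that e(1) unfolding frontier_def by blast
    have U: "\<Union>A \<union> e = \<Union>A \<union> {}" using e(1) by auto
    have "step E e D k A A'"
      using step(2)
    proof cases
      case (add g)
      then have "ok_add E e D k A g" using fr[of A] False U unfolding ok_add_def touches_def by auto
      then show ?thesis using add step.add by fastforce
    next
      case (slide g u)
      then have "ok_slide E e D k A g u" using fr[of A] fr[of "insert g A"] unfolding ok_slide_def by auto
      then show ?thesis using slide step.slide by fastforce
    next
      case (pend g f u)
      then have q: "ok_pend E {} {} k A g f u" using assms(3) by simp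
      have "(g - {u}) \<inter> e = {}"
      proof (rule ccontr)
        assume "(g - {u}) \<inter> e \<noteq> {}"
        moreover have "e \<in> E" using e(1) steps_edges[OF step(1)] by blast
        ultimately have "e = g" using q unfolding ok_pend_def by blast
        then show False using q e(1) unfolding ok_pend_def by blast
      qed
      then have "(g - {u}) \<inter> (e \<union> {}) = {}" by simp
      then have "ok_pend E e {} k A g f u"
        using q unfolding ok_pend_def fr[OF subset_refl, unfolded assms(3)] U by (elim conjE) (intro conjI)
      then have "ok_pend E e D k A g f u" using assms(3) by simp
      then show ?thesis using pend step.pend by fastforce
    qed
    then have "steps E e D k {} A'" using e(2) by (meson rtranclp.rtrancl_into_rtrancl)
    moreover have "e \<in> A'" using e(1) step_mono[OF step(2)] by auto
    ultimately show ?thesis by auto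
  qed
qed simp

definition star :: "nat \<Rightarrow> 'a \<Rightarrow> 'a set set \<Rightarrow> 'a set set \<Rightarrow> 'a set set \<Rightarrow> bool" where
  "star k v X Y Z \<longleftrightarrow> block k X v \<and> block k Y v \<and> block k Z v \<and>
     \<Union>X \<inter> \<Union>Y \<subseteq> {v} \<and> \<Union>X \<inter> \<Union>Z \<subseteq> {v} \<and> \<Union>Y \<inter> \<Union>Z \<subseteq> {v}"

text \<open>
  The middle part \<open>Y\<close> is any graph that can be searched while its root is guarded: a contracted
  block, or a block with one additional searcher.
\<close>

lemma star_search:
  assumes X: "block k X v" and Z: "block k Z v" and k: "2 \<le> k"
    and Y: "edge_set Y" "search Y {v} {v} m" and km: "k \<le> m"
    and d: "\<Union>X \<inter> \<Union>Y \<subseteq> {v}" "\<Union>X \<inter> \<Union>Z \<subseteq> {v}" "\<Union>Y \<inter> \<Union>Z \<subseteq> {v}"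
  shows "search (X \<union> Y \<union> Z) {} {} m"
proof -
  note X' = blockD[OF X] note Z' = blockD[OF Z]
  have dis: "X \<inter> Y = {}" "X \<inter> Z = {}" "Y \<inter> Z = {}"
    using edge_disjoint X'(1) Z'(1) Y(1) d by metis+
  let ?E = "X \<union> Y \<union> Z"
  obtain VX VY VZ where V: "\<Union>X = VX" "\<Union>Y = VY" "\<Union>Z = VZ" by blast
  note d' = d[unfolded V] X'(2)[unfolded V] Z'(2)[unfolded V]
  have "steps ?E {} {} m {} (X \<union> {})"
    by (rule phase_split[OF X'(7,1), where S = "{}" and Q = "Y \<union> Z"])
      (blast, blast, use dis in blast, simp,
       use d' in \<open>unfold union_simps V; auto\<close>, simp, simp, simp, simp,
       use km in simp)
  moreover have "steps ?E {} {} m X (Y \<union> X)"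
    by (rule phase_split[OF Y(2,1), where S = "{}" and Q = "Z"])
      (blast, use dis in blast, use dis in blast,
       use d' in \<open>unfold union_simps V; auto\<close>,
       use d' in \<open>unfold union_simps V; auto\<close>, simp, simp, simp,
       use d' in \<open>unfold union_simps V; auto\<close>, simp)
  moreover have "steps ?E {} {} m (Y \<union> X) (Z \<union> (Y \<union> X))"
    by (rule phase_split[OF Z'(6,1), where S = "{}" and Q = "{}"])
      (blast, use dis in blast, use dis in blast,
       use d' in \<open>unfold union_simps V; auto\<close>, simp, simp, simp, simp, simp,
       use km in simp)
  ultimately have "steps ?E {} {} m {} (Z \<union> (Y \<union> X))" by simp
  moreover have "Z \<union> (Y \<union> X) = ?E" by auto
  ultimately show ?thesis unfolding search_def by simp
qed

lemma starD:
  assumes "star k v X Y Z"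
  shows "block k X v" "block k Y v" "block k Z v"
    "\<Union>X \<inter> \<Union>Y \<subseteq> {v}" "\<Union>X \<inter> \<Union>Z \<subseteq> {v}" "\<Union>Y \<inter> \<Union>Z \<subseteq> {v}"
  using assms unfolding star_def by auto

lemma star_rotate: "star k v X Y Z \<Longrightarrow> star k v Y Z X" "star k v X Y Z \<Longrightarrow> star k v Y X Z"
  unfolding star_def by auto

lemma star_edge_set:
  assumes s: "star k v X Y Z"
  shows "edge_set (X \<union> Y \<union> Z)"
  using blockD(1)[OF starD(1)[OF s]] blockD(1)[OF starD(2)[OF s]] blockD(1)[OF starD(3)[OF s]]
  unfolding edge_set_def by auto

lemma star_disjoint:
  assumes s: "star k v X Y Z"
  shows "X \<inter> Y = {} \<and> X \<inter> Z = {} \<and> Y \<inter> Z = {}"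
  using edge_disjoint[OF _ _ starD(4)[OF s]] edge_disjoint[OF _ _ starD(5)[OF s]]
    edge_disjoint[OF _ _ starD(6)[OF s]] blockD(1)[OF starD(1)[OF s]]
    blockD(1)[OF starD(2)[OF s]] blockD(1)[OF starD(3)[OF s]] by simp

lemma star_part: "star k v X Y Z \<Longrightarrow> part_of X v (X \<union> Y \<union> Z)"
  unfolding star_def part_of_def by blast

text \<open>
  The two blocks without the first clean edge are entered through the root, so \<open>two_blocks\<close> applies to them.
\<close>

lemma star_stuck:
  assumes s: "star k v X Y Z"
  shows "\<not> search (X \<union> Y \<union> Z) {} {} k"
proof
  let ?E = "X \<union> Y \<union> Z"
  assume "search ?E {} {} k"
  moreover have "?E \<noteq> {}" using blockD(2)[OF starD(1)[OF s]] by auto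
  ultimately obtain e where e: "e \<in> ?E" "steps ?E e {} k {} ?E"
    using first_edge[OF _ star_edge_set[OF s]] unfolding search_def by blast
  have no: False if t: "star k v A B C" "A \<union> B \<union> C = ?E" "e \<in> A" for A B C
  proof -
    have pB: "part_of B v ?E" using star_part[OF star_rotate(1)[OF t(1)]] t(2) by (simp add: Un_ac)
    have pC: "part_of C v ?E" using star_part[OF star_rotate(1)[OF star_rotate(1)[OF t(1)]]] t(2) by (simp add: Un_ac)
    note D = starD[OF t(1)]
    have fe: "finite e" "e \<noteq> {}" using edge_setD(2,3)[OF star_edge_set[OF s] e(1)] by auto
    have eA: "e \<subseteq> \<Union>A" using t(3) by auto
    have "search B {v} {v} k \<or> search C {v} {v} k"
    proof (rule two_blocks[OF star_edge_set[OF s] blockD(5)[OF D(2)] pB blockD(5)[OF D(3)] pC, where T = e and D = "{}" and K = "{}"])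
      show "B \<inter> C = {}" using star_disjoint[OF t(1)] by simp
      show "(e \<union> {}) \<inter> \<Union>B \<subseteq> {v}" "(e \<union> {}) \<inter> \<Union>C \<subseteq> {v}" using D(4,5) eA by blast+
      show "search ?E e {} (k + card {})" using e(2) unfolding search_def by simp
    qed (use fe in auto)
    then show False using blockD(8)[OF D(2)] blockD(8)[OF D(3)] by auto
  qed
  consider "e \<in> X" | "e \<in> Y" | "e \<in> Z" using e(1) by auto
  then show False
  proof cases
    case 1 then show ?thesis using no[OF s] by simp
  next
    case 2 then show ?thesis using no[OF star_rotate(1)[OF s]] by (simp add: Un_ac)
  next
    case 3 then show ?thesis using no[OF star_rotate(1)[OF star_rotate(1)[OF s]]] by (simp add: Un_ac)
  qed
qed

lemma star_contract:
  assumes s: "star k v X Y Z" and k: "2 \<le> k" and e: "e \<in> X \<union> Y \<union> Z"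
  shows "\<exists>z\<in>e. search (img (collapse e z) (X \<union> Y \<union> Z)) {} {} k"
proof -
  have yes: "\<exists>z\<in>e. search (img (collapse e z) (A \<union> B \<union> C)) {} {} k" if t: "star k v A B C" and eB: "e \<in> B" for A B C
  proof -
    note D = starD[OF t]
    obtain z where z: "z \<in> e" "v \<in> e \<longrightarrow> z = v" "search (img (collapse e z) B) {v} {v} k"
      using blockD(9)[OF D(2) eB] by blast
    have fixc: "collapse e z x = x" if "x \<in> \<Union>A \<or> x \<in> \<Union>C" for x
    proof -
      have "x \<in> e \<Longrightarrow> x = v" using that eB D(4,6) by blast
      then show ?thesis using z(2) unfolding collapse_def by auto
    qed
    have i: "img (collapse e z) A = A" "img (collapse e z) C = C"
      using img_id[OF blockD(1)[OF D(1)]] img_id[OF blockD(1)[OF D(3)]] fixc by blast+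
    have U: "\<Union>(img (collapse e z) B) \<subseteq> \<Union>B" using Union_img[of "collapse e z" B] eB z(1) unfolding collapse_def by auto
    have "search (A \<union> img (collapse e z) B \<union> C) {} {} k"
      by (rule star_search[OF D(1,3) k edge_set_img[OF blockD(1)[OF D(2)]] z(3)]) (use D(4-6) U in blast)+
    then have "search (img (collapse e z) (A \<union> B \<union> C)) {} {} k" unfolding img_Un i .
    then show ?thesis using z(1) by blast
  qed
  consider "e \<in> X" | "e \<in> Y" | "e \<in> Z" using e by auto
  then show ?thesis
  proof cases
    case 1
    then show ?thesis using yes[OF star_rotate(2)[OF s]] by (simp add: Un_ac)
  next
    case 2 then show ?thesis using yes[OF s] by simp
  next
    case 3 then show ?thesis using yes[OF star_rotate(1)[OF s]] by (simp add: Un_ac)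
  qed
qed

lemma star_obstruction:
  fixes X Y Z :: "nat set set"
  assumes s: "star k v X Y Z" and k: "2 \<le> k"
  shows "\<lparr>verts = \<Union>(X \<union> Y \<union> Z), edges = X \<union> Y \<union> Z\<rparr> \<in> obs_cmms k"
proof -
  let ?E = "X \<union> Y \<union> Z" let ?G = "\<lparr>verts = \<Union>?E, edges = ?E\<rparr>"
  note D = starD[OF s]
  have E: "edge_set ?E" by (rule star_edge_set[OF s])
  have G: "simple_graph ?G"
    using E edge_set_finite_Union[OF E] unfolding simple_graph_def edge_set_def by auto
  have ex: "search ?E {} {} (Suc k)"
    by (rule star_search[OF D(1,3) k blockD(1)[OF D(2)] guard_root[OF blockD(6,1)[OF D(2)]] _ D(4-6)]) simp
  have "linked ?E" using linked_steps[OF _ E] ex unfolding search_def by blast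
  then have "graph_connected ?G" unfolding linked_iff .
  moreover have "cmms ?G > k"
    by (rule cmms_gt[OF G k]) (use star_stuck[OF s] ex in simp_all)
  moreover have "cmms H \<le> k" if "simple_graph H" "proper_contraction H ?G" for H :: "nat graph"
    by (rule cmms_le[OF that(1) proper_contraction_search[OF G that _ k]])
      (use star_contract[OF s k] in simp)
  ultimately show ?thesis using G unfolding obs_cmms_def by blast
qed

section \<open>Recovering the blocks from the graph\<close>

definition leaf :: "nat \<Rightarrow> nat set set" where
  "leaf i = [{{0, 1}, {1, 2}, {1, 3}, {2, 3}},
     {{0, 1}, {0, 2}, {1, 2}, {1, 3}, {2, 3}},
     {{0, 3}, {1, 2}, {2, 3}, {3, 4}, {4, 5}},
     {{0, 1}, {1, 2}, {1, 3}, {1, 4}},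
     {{0, 1}, {0, 2}, {1, 2}, {1, 3}, {1, 4}}] ! i"

lemma leaf_cases: "i < 5 \<Longrightarrow> i \<in> {0, 1, 2, 3, 4 :: nat}"
  by auto

lemma block_leaf:
  assumes "i < 5"
  shows "block 2 (leaf i) 0"
  using leaf_cases[OF assms] leaf0_certified leaf1_certified leaf2_certified leaf3_certified leaf4_certified
  by (auto simp: leaf_def intro: certified_block)

lemma leaf_size:
  "\<forall>i\<in>{0..<5}. \<forall>j\<in>{0..<5}.
     card (leaf i) = card (leaf j) \<longrightarrow> card (\<Union>(leaf i)) = card (\<Union>(leaf j)) \<longrightarrow> i = j"
  by code_simp

text \<open>
  Describes how a block is built. The order of the two blocks in a graft is not
  recorded, as it cannot be recovered from the graph.
\<close>

datatype code = Leaf nat | Node "code multiset"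

inductive tree :: "nat \<Rightarrow> code \<Rightarrow> 'a set set \<Rightarrow> 'a \<Rightarrow> bool" where
  Leaf: "i < 5 \<Longrightarrow> inj_on f (\<Union>(leaf i)) \<Longrightarrow> tree 0 (Leaf i) (img f (leaf i)) (f 0)"
| Node: "tree n c B a \<Longrightarrow> tree n d C a \<Longrightarrow> \<Union>B \<inter> \<Union>C \<subseteq> {a} \<Longrightarrow> v \<notin> \<Union>B \<Longrightarrow> v \<notin> \<Union>C \<Longrightarrow>
    tree (Suc n) (Node {#c, d#}) (graft v a B C) v"

lemma tree_block: "tree n c E r \<Longrightarrow> block (n + 2) E r"
proof (induction rule: tree.induct)
  case (Leaf i f)
  then show ?case using block_img[OF block_leaf[OF Leaf(1)] Leaf(2)] by (simp add: numeral_2_eq_2)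
next
  case (Node n c B a d C v)
  then show ?case using block_graft[of "n + 2" B a C v] by simp
qed

lemma tree_img: "tree n c E r \<Longrightarrow> inj_on \<phi> (\<Union>E) \<Longrightarrow> tree n c (img \<phi> E) (\<phi> r)"
proof (induction rule: tree.induct)
  case (Leaf i f)
  have E: "edge_set (leaf i)" using blockD(1)[OF block_leaf[OF Leaf(1)]] .
  have "\<Union>(img f (leaf i)) = f ` \<Union>(leaf i)" using img_inj[OF E Leaf(2)] by auto
  then have "inj_on (\<phi> \<circ> f) (\<Union>(leaf i))" using Leaf by (intro comp_inj_on) auto
  from tree.Leaf[OF Leaf(1) this] show ?case unfolding img_comp[OF E] by simp
next
  case (Node n c B a d C v)
  note b = tree_block[OF Node.hyps(1)] tree_block[OF Node.hyps(2)]
  have U: "\<Union>(graft v a B C) = {v, a} \<union> \<Union>B \<union> \<Union>C" unfolding graft_def by auto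
  have "v \<noteq> a" using Node.hyps(4) blockD(2)[OF b(1)] by blast
  then have inj: "inj_on \<phi> (\<Union>B)" "inj_on \<phi> (\<Union>C)" "\<phi> v \<noteq> \<phi> a"
    using Node.prems unfolding U by (auto simp: inj_on_def)
  have UB: "\<Union>(img \<phi> B) = \<phi> ` \<Union>B" "\<Union>(img \<phi> C) = \<phi> ` \<Union>C"
    using img_inj[OF blockD(1)[OF b(1)] inj(1)] img_inj[OF blockD(1)[OF b(2)] inj(2)] by auto
  have "\<phi> ` \<Union>B \<inter> \<phi> ` \<Union>C = \<phi> ` (\<Union>B \<inter> \<Union>C)"
    by (rule inj_on_image_Int[symmetric, OF Node.prems]) (auto simp: U)
  then have 1: "\<Union>(img \<phi> B) \<inter> \<Union>(img \<phi> C) \<subseteq> {\<phi> a}" unfolding UB using Node.hyps(3) by blast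
  have vU: "\<phi> v \<in> \<phi> ` X \<longleftrightarrow> v \<in> X" if "X \<subseteq> {v, a} \<union> \<Union>B \<union> \<Union>C" for X
    by (rule inj_on_image_mem_iff[OF Node.prems]) (use that in \<open>auto simp: U\<close>)
  have 2: "\<phi> v \<notin> \<Union>(img \<phi> B)" "\<phi> v \<notin> \<Union>(img \<phi> C)" unfolding UB
    using vU[of "\<Union>B"] vU[of "\<Union>C"] Node.hyps(4,5) by blast+
  have "img \<phi> (graft v a B C) = graft (\<phi> v) (\<phi> a) (img \<phi> B) (img \<phi> C)"
    unfolding graft_def img_insert img_Un using inj(3) by simp
  then show ?case using tree.Node[OF Node.IH(1)[OF inj(1)] Node.IH(2)[OF inj(2)] 1 2] by simp
qed

lemma indecomposable_family:
  assumes F: "\<And>B. B \<in> \<F> \<Longrightarrow> indecomposable B r \<and> B \<noteq> {}"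
    and G: "\<And>B C. B \<in> \<G> \<Longrightarrow> C \<in> \<G> \<Longrightarrow> B \<noteq> C \<Longrightarrow> \<Union>B \<inter> \<Union>C \<subseteq> {r}"
    and eq: "\<Union>\<F> \<subseteq> \<Union>\<G>" and B: "B \<in> \<F>"
  shows "\<exists>C\<in>\<G>. B \<subseteq> C"
proof -
  obtain e where e: "e \<in> B" using F[OF B] by auto
  then obtain C where C: "C \<in> \<G>" "e \<in> C" using eq B by blast
  have "B \<inter> C = B"
  proof (rule ccontr)
    assume "B \<inter> C \<noteq> B"
    then have "\<not> \<Union>(B \<inter> C) \<inter> \<Union>(B - B \<inter> C) \<subseteq> {r}"
      using F[OF B] e C(2) unfolding indecomposable_def by (metis Int_iff Int_lower1 empty_iff)
    then obtain x g h where x: "x \<noteq> r" "x \<in> g" "g \<in> C" "x \<in> h" "h \<in> B" "h \<notin> C" by blast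
    then obtain C' where C': "C' \<in> \<G>" "h \<in> C'" using eq B by blast
    then have "C \<noteq> C'" using x by auto
    from G[OF C(1) C'(1) this] show False using x C' by blast
  qed
  then show ?thesis using C by blast
qed

definition fan :: "'a set set set \<Rightarrow> 'a \<Rightarrow> bool" where
  "fan \<F> r \<longleftrightarrow> (\<forall>B\<in>\<F>. rooted_block B r) \<and> (\<forall>B\<in>\<F>. \<forall>C\<in>\<F>. B \<noteq> C \<longrightarrow> \<Union>B \<inter> \<Union>C \<subseteq> {r})"

lemma fan_sub:
  assumes F: "fan \<F> r" and G: "fan \<G> r" and eq: "\<Union>\<F> = \<Union>\<G>"
  shows "\<F> \<subseteq> \<G>"
proof
  fix B assume B: "B \<in> \<F>"
  have ne: "indecomposable B r \<and> B \<noteq> {}" if "B \<in> \<F> \<union> \<G>" for B using F G that unfolding fan_def rooted_block_def by auto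
  have p: "\<And>B C. B \<in> \<F> \<Longrightarrow> C \<in> \<F> \<Longrightarrow> B \<noteq> C \<Longrightarrow> \<Union>B \<inter> \<Union>C \<subseteq> {r}"
    "\<And>B C. B \<in> \<G> \<Longrightarrow> C \<in> \<G> \<Longrightarrow> B \<noteq> C \<Longrightarrow> \<Union>B \<inter> \<Union>C \<subseteq> {r}"
    using F G unfolding fan_def by auto
  obtain C where C: "C \<in> \<G>" "B \<subseteq> C"
    using indecomposable_family[of \<F> r \<G> B] ne p(2) eq B by blast
  obtain B' where B': "B' \<in> \<F>" "C \<subseteq> B'"
    using indecomposable_family[of \<G> r \<F> C] ne p(1) eq C(1) by blast
  have "B = B'"
  proof (rule ccontr)
    assume n: "B \<noteq> B'"
    have "edge_set B" "edge_set B'" using F B B' unfolding fan_def rooted_block_def by auto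
    from edge_disjoint[OF this p(1)[OF B B'(1) n]] show False using C B' ne[of B] B by auto
  qed
  then show "B \<in> \<G>" using C B' by auto
qed

text \<open>
  An indecomposable block cannot be spread over several blocks with the same root, so each
  block of one family is contained in a block of the other one.
\<close>

lemma fan_unique: "fan \<F> r \<Longrightarrow> fan \<G> r \<Longrightarrow> \<Union>\<F> = \<Union>\<G> \<Longrightarrow> \<F> = \<G>"
  using fan_sub[of \<F> r \<G>] fan_sub[of \<G> r \<F>] by auto

text \<open>
  The root \<open>v\<close> of a graft has degree one, so \<open>a\<close> is determined, and then so is the pair of blocks.
\<close>

lemma tree_unique: "tree n c E r \<Longrightarrow> tree n c' E r \<Longrightarrow> c = c'"
proof (induction arbitrary: c' rule: tree.induct)
  case (Leaf i f)
  from Leaf(3) obtain j g where j: "c' = Leaf j" "j < 5" "inj_on g (\<Union>(leaf j))" "img f (leaf i) = img g (leaf j)"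
    by (auto elim: tree.cases)
  have sz: "card (img h (leaf l)) = card (leaf l)" "card (\<Union>(img h (leaf l))) = card (\<Union>(leaf l))"
    if "l < 5" "inj_on h (\<Union>(leaf l))" for h :: "nat \<Rightarrow> 'b" and l
  proof -
    have E: "edge_set (leaf l)" using blockD(1)[OF block_leaf[OF that(1)]] .
    have i: "img h (leaf l) = (`) h ` leaf l" by (rule img_inj[OF E that(2)])
    show "card (img h (leaf l)) = card (leaf l)" unfolding i
      by (rule card_image, rule inj_onI) (use inj_on_image_eq_iff[OF that(2)] in blast)
    have "\<Union>(img h (leaf l)) = h ` \<Union>(leaf l)" unfolding i by auto
    then show "card (\<Union>(img h (leaf l))) = card (\<Union>(leaf l))" using card_image[OF that(2)] by simp
  qed
  have "card (leaf i) = card (leaf j)" "card (\<Union>(leaf i)) = card (\<Union>(leaf j))"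
    using sz[OF Leaf(1,2)] sz[OF j(2,3)] j(4) by simp_all
  then have "i = j" using leaf_size Leaf(1) j(2) by simp
  then show ?case using j by simp
next
  case (Node n c B a d C v)
  from Node.prems obtain c1 d1 B' C' a' where N: "c' = Node {#c1, d1#}" "graft v a B C = graft v a' B' C'"
    "tree n c1 B' a'" "tree n d1 C' a'" "\<Union>B' \<inter> \<Union>C' \<subseteq> {a'}" "v \<notin> \<Union>B'" "v \<notin> \<Union>C'"
    by (cases rule: tree.cases) blast
  have rb: "rooted_block B a" "rooted_block C a" "rooted_block B' a'" "rooted_block C' a'"
    using Node.hyps(1,2) N(3,4) by (blast intro: blockD(5)[OF tree_block])+
  have n: "{v, a} \<notin> B \<union> C" "{v, a'} \<notin> B' \<union> C'" using Node N by auto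
  have "{v, a'} \<in> graft v a B C" using N(2) unfolding graft_def by auto
  then have "{v, a'} = {v, a}" using Node unfolding graft_def by auto
  then have aa: "a' = a" by (auto simp: doubleton_eq_iff)
  have "B \<union> C = B' \<union> C'" using N(2) n unfolding graft_def aa by (metis insert_ident)
  moreover have "fan {B, C} a" "fan {B', C'} a"
    using rb Node.hyps(3) N(5) unfolding fan_def aa by auto
  ultimately have "{B, C} = {B', C'}" using fan_unique[of "{B, C}" a "{B', C'}"] by auto
  then consider "B = B'" "C = C'" | "B = C'" "C = B'" by (auto simp: doubleton_eq_iff)
  then show ?case
  proof cases
    case 1
    then have "c = c1" "d = d1" using Node.IH(1)[of c1] Node.IH(2)[of d1] N(3,4) aa by auto
    then show ?thesis using N by simp
  next
    case 2
    then have "c = d1" "d = c1" using Node.IH(1)[of d1] Node.IH(2)[of c1] N(3,4) aa by auto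
    then show ?thesis using N by simp
  qed
qed

lemma star_pick:
  assumes "star k v X Y Z" "w \<in> \<Union>(X \<union> Y \<union> Z)"
  obtains A B C where "star k v A B C" "A \<union> B \<union> C = X \<union> Y \<union> Z" "w \<in> \<Union>A"
proof -
  have "w \<in> \<Union>X \<or> w \<in> \<Union>Y \<or> w \<in> \<Union>Z" using assms(2) by auto
  then show ?thesis
  proof (elim disjE)
    assume "w \<in> \<Union>X" then show ?thesis using that[OF assms(1)] by simp
  next
    assume "w \<in> \<Union>Y" then show ?thesis using that[OF star_rotate(1)[OF assms(1)]] by (simp add: Un_ac)
  next
    assume "w \<in> \<Union>Z" then show ?thesis
      using that[OF star_rotate(1)[OF star_rotate(1)[OF assms(1)]]] by (simp add: Un_ac)
  qed
qed

text \<open>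
  If \<open>v \<noteq> w\<close>, the blocks \<open>Y'\<close> and \<open>Z'\<close> at \<open>w\<close> lie inside the block \<open>X\<close> at \<open>v\<close>. Contracting an edge of \<open>Z'\<close>
  does not affect \<open>Y'\<close>, so \<open>X\<close> stays unsearchable with \<open>v\<close> guarded, contrary to the minimality of \<open>X\<close>.
\<close>

lemma star_centre:
  assumes s: "star k v X Y Z" and t: "star k w X' Y' Z'" and eq: "X \<union> Y \<union> Z = X' \<union> Y' \<union> Z'"
    and w: "w \<in> \<Union>X" and v: "v \<in> \<Union>X'"
  shows "v = w"
proof (rule ccontr)
  assume vw: "v \<noteq> w"
  note S = starD[OF s] note T = starD[OF t]
  have vY: "v \<notin> \<Union>Y'" "v \<notin> \<Union>Z'" using T(4,5) v vw by blast+
  have wY: "w \<notin> \<Union>Y" "w \<notin> \<Union>Z" using S(4,5) w vw by blast+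
  have sub: "B \<subseteq> X" if B: "block k B w" "B \<subseteq> X \<union> Y \<union> Z" "v \<notin> \<Union>B" for B
  proof (rule ccontr)
    assume n: "\<not> B \<subseteq> X"
    obtain g where g: "g \<in> B" "w \<in> g" using blockD(2)[OF B(1)] by auto
    then have "g \<in> X" using B(2) wY by blast
    then have "B \<inter> X \<noteq> {}" "B \<inter> X \<noteq> B" using g n by blast+
    then have "\<not> \<Union>(B \<inter> X) \<inter> \<Union>(B - B \<inter> X) \<subseteq> {w}"
      using blockD(3)[OF B(1)] unfolding indecomposable_def by (metis Int_lower1)
    then obtain x g h where x: "x \<in> g" "g \<in> X" "x \<in> h" "h \<in> B" "h \<notin> X" by blast
    then have "h \<in> Y \<or> h \<in> Z" using B(2) by blast
    then have "x = v" using x S(4,5) by blast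
    then show False using x B(3) by blast
  qed
  have YX: "Y' \<subseteq> X" by (rule sub[OF T(2) _ vY(1)]) (use eq in blast)
  have ZX: "Z' \<subseteq> X" by (rule sub[OF T(3) _ vY(2)]) (use eq in blast)
  \<comment> \<open>As no edge at \<open>w\<close> is pendant in \<open>Z'\<close>, some edge of \<open>Z'\<close> avoids \<open>w\<close>.\<close>
  obtain g where g: "g \<in> Z'" "w \<in> g" using blockD(2)[OF T(3)] by auto
  then obtain e where e: "e \<in> Z'" "e \<noteq> g" "e \<inter> (g - {w}) \<noteq> {}"
    using blockD(4)[OF T(3)] unfolding no_pendant_def by blast
  have c2: "card e = 2" "card g = 2" using edge_setD(2)[OF blockD(1)[OF T(3)]] e(1) g(1) by auto
  have we: "w \<notin> e"
  proof
    assume we: "w \<in> e"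
    obtain x where x: "x \<in> e" "x \<in> g" "x \<noteq> w" using e(3) by auto
    obtain a where "e = {w, a}" using edge_other[OF c2(1) we] by metis
    moreover obtain b where "g = {w, b}" using edge_other[OF c2(2) g(2)] by metis
    ultimately show False using x e(2) by auto
  qed
  have ve: "v \<notin> e" using vY e(1) by auto
  have eX: "e \<in> X" using ZX e(1) by auto
  obtain z where z: "z \<in> e" "search (img (collapse e z) X) {v} {v} k" using blockD(9)[OF S(1) eX] by blast
  let ?E = "img (collapse e z) X"
  have zY: "z \<notin> \<Union>Y'" using z(1) e(1) T(6) we by blast
  have fixc: "collapse e z x = x" if "x \<in> \<Union>Y'" for x
  proof -
    have "x \<notin> e" using that e(1) T(6) we by blast
    then show ?thesis unfolding collapse_def by simp
  qed
  have iY: "img (collapse e z) Y' = Y'" by (rule img_id[OF blockD(1)[OF T(2)] fixc])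
  have YE: "Y' \<subseteq> ?E" using img_mono[OF YX, of "collapse e z"] unfolding iY .
  have "\<Union>Y' \<inter> \<Union>(?E - Y') \<subseteq> {w}"
  proof
    fix x assume x: "x \<in> \<Union>Y' \<inter> \<Union>(?E - Y')"
    then obtain h where h: "h \<in> ?E" "h \<notin> Y'" "x \<in> h" by auto
    then obtain h' where h': "h' \<in> X" "h = collapse e z ` h'" "card h = 2" unfolding img_def by auto
    have "h' \<notin> Y'"
    proof
      assume "h' \<in> Y'"
      then have "h \<in> img (collapse e z) Y'" using h' unfolding img_def by auto
      then show False using iY h(2) by simp
    qed
    then have hh: "h' \<in> X' \<or> h' \<in> Z'" using h'(1) eq by blast
    obtain y where y: "y \<in> h'" "x = collapse e z y" using h' h(3) by auto
    have "x \<noteq> z" using x zY by auto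
    then have "x = y" using y(2) unfolding collapse_def by (auto split: if_splits)
    then show "x \<in> {w}" using x y hh T(4,6) by blast
  qed
  then have part: "part_of Y' w ?E" using YE unfolding part_of_def by simp
  have "search Y' {w} {w} k"
    by (rule one_block[OF edge_set_img[OF blockD(1)[OF S(1)]] part blockD(4)[OF T(2)] _ z(2)]) (use vY in simp)
  then show False using blockD(8)[OF T(2)] by simp
qed

lemma star_centre_unique:
  assumes s: "star k v X Y Z" and t: "star k w X' Y' Z'" and eq: "X \<union> Y \<union> Z = X' \<union> Y' \<union> Z'"
  shows "v = w"
proof -
  have "w \<in> \<Union>(X \<union> Y \<union> Z)" unfolding eq using blockD(2)[OF starD(1)[OF t]] by auto
  from star_pick[OF s this] obtain A B C where A: "star k v A B C" "A \<union> B \<union> C = X \<union> Y \<union> Z" "w \<in> \<Union>A" .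
  have "v \<in> \<Union>(X' \<union> Y' \<union> Z')" unfolding eq[symmetric] using blockD(2)[OF starD(1)[OF s]] by auto
  from star_pick[OF t this] obtain A' B' C' where A': "star k w A' B' C'" "A' \<union> B' \<union> C' = X' \<union> Y' \<union> Z'" "v \<in> \<Union>A'" .
  show ?thesis using star_centre[OF A(1) A'(1) _ A(3) A'(3)] A(2) A'(2) eq by simp
qed

definition coded_star :: "nat \<Rightarrow> code multiset \<Rightarrow> 'a set set \<Rightarrow> bool" where
  "coded_star n M E \<longleftrightarrow> (\<exists>v X Y Z a b c. E = X \<union> Y \<union> Z \<and> M = {#a, b, c#} \<and>
     tree n a X v \<and> tree n b Y v \<and> tree n c Z v \<and>
     \<Union>X \<inter> \<Union>Y \<subseteq> {v} \<and> \<Union>X \<inter> \<Union>Z \<subseteq> {v} \<and> \<Union>Y \<inter> \<Union>Z \<subseteq> {v})"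

lemma coded_star_unique:
  assumes "coded_star n M E" "coded_star n M' E"
  shows "M = M'"
proof -
  obtain v X Y Z a b c where 1: "E = X \<union> Y \<union> Z" "M = {#a, b, c#}"
    "tree n a X v" "tree n b Y v" "tree n c Z v"
    "\<Union>X \<inter> \<Union>Y \<subseteq> {v}" "\<Union>X \<inter> \<Union>Z \<subseteq> {v}" "\<Union>Y \<inter> \<Union>Z \<subseteq> {v}"
    using assms(1) unfolding coded_star_def by blast
  obtain w X' Y' Z' a' b' c' where 2: "E = X' \<union> Y' \<union> Z'" "M' = {#a', b', c'#}"
    "tree n a' X' w" "tree n b' Y' w" "tree n c' Z' w"
    "\<Union>X' \<inter> \<Union>Y' \<subseteq> {w}" "\<Union>X' \<inter> \<Union>Z' \<subseteq> {w}" "\<Union>Y' \<inter> \<Union>Z' \<subseteq> {w}"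
    using assms(2) unfolding coded_star_def by blast
  have s: "star (n + 2) v X Y Z" unfolding star_def using 1 tree_block[OF 1(3)] tree_block[OF 1(4)] tree_block[OF 1(5)] by blast
  have t: "star (n + 2) w X' Y' Z'" unfolding star_def using 2 tree_block[OF 2(3)] tree_block[OF 2(4)] tree_block[OF 2(5)] by blast
  have w: "w = v" using star_centre_unique[OF s t] 1(1) 2(1) by simp
  have "fan {X, Y, Z} v" unfolding fan_def using starD[OF s] blockD(5) by auto
  moreover have "fan {X', Y', Z'} v" unfolding fan_def using starD[OF t] blockD(5) w by auto
  moreover have "\<Union>{X, Y, Z} = \<Union>{X', Y', Z'}" using 1(1) 2(1) by auto
  ultimately have eq: "{X, Y, Z} = {X', Y', Z'}" by (rule fan_unique)
  have ne: "A \<noteq> B" if "block (n + 2) A v" "A \<inter> B = {}" for A B using blockD(2)[OF that(1)] that(2) by auto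
  have d: "X \<noteq> Y" "X \<noteq> Z" "Y \<noteq> Z"
    using star_disjoint[OF s] ne[OF starD(1)[OF s], of Y] ne[OF starD(1)[OF s], of Z]
      ne[OF starD(2)[OF s], of Z] by simp_all
  have t': "star (n + 2) v X' Y' Z'" using t w by simp
  have d': "X' \<noteq> Y'" "X' \<noteq> Z'" "Y' \<noteq> Z'"
    using star_disjoint[OF t'] ne[OF starD(1)[OF t'], of Y'] ne[OF starD(1)[OF t'], of Z']
      ne[OF starD(2)[OF t'], of Z'] by simp_all
  define cd where "cd B = (THE c. tree n c B v)" for B
  have cd: "cd B = c" if "tree n c B v" for B c
    unfolding cd_def by (rule the_equality) (rule that, rule tree_unique[OF _ that])
  have "M = image_mset cd (mset_set {X, Y, Z})"
    using d by (simp add: 1(2) cd[OF 1(3)] cd[OF 1(4)] cd[OF 1(5)])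
  also have "\<dots> = image_mset cd (mset_set {X', Y', Z'})" using eq by simp
  also have "\<dots> = M'"
    using d' by (simp add: 2(2) cd[OF 2(3)[unfolded w]] cd[OF 2(4)[unfolded w]] cd[OF 2(5)[unfolded w]])
  finally show ?thesis .
qed

lemma coded_star_img:
  assumes c: "coded_star n M E" and inj: "inj_on \<phi> (\<Union>E)"
  shows "coded_star n M (img \<phi> E)"
proof -
  obtain v X Y Z a b c where 1: "E = X \<union> Y \<union> Z" "M = {#a, b, c#}"
    "tree n a X v" "tree n b Y v" "tree n c Z v"
    "\<Union>X \<inter> \<Union>Y \<subseteq> {v}" "\<Union>X \<inter> \<Union>Z \<subseteq> {v}" "\<Union>Y \<inter> \<Union>Z \<subseteq> {v}"
    using c unfolding coded_star_def by blast
  have E: "edge_set X" "edge_set Y" "edge_set Z" using 1(3-5) by (blast intro: blockD(1)[OF tree_block])+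
  have sub: "\<Union>X \<subseteq> \<Union>E" "\<Union>Y \<subseteq> \<Union>E" "\<Union>Z \<subseteq> \<Union>E" using 1 by auto
  have i: "inj_on \<phi> (\<Union>X)" "inj_on \<phi> (\<Union>Y)" "inj_on \<phi> (\<Union>Z)" using inj_on_subset[OF inj] sub by blast+
  have U: "\<Union>(img \<phi> A) = \<phi> ` \<Union>A" if "edge_set A" "inj_on \<phi> (\<Union>A)" for A using img_inj[OF that] by auto
  have int: "\<Union>(img \<phi> A) \<inter> \<Union>(img \<phi> B) \<subseteq> {\<phi> v}"
    if "edge_set A" "inj_on \<phi> (\<Union>A)" "edge_set B" "inj_on \<phi> (\<Union>B)" "\<Union>A \<inter> \<Union>B \<subseteq> {v}" "\<Union>A \<subseteq> \<Union>E" "\<Union>B \<subseteq> \<Union>E" for A B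
  proof -
    have "\<Union>(img \<phi> A) \<inter> \<Union>(img \<phi> B) = \<phi> ` (\<Union>A \<inter> \<Union>B)"
      unfolding U[OF that(1,2)] U[OF that(3,4)] by (rule inj_on_image_Int[symmetric, OF inj that(6,7)])
    then show ?thesis using that(5) by blast
  qed
  have "img \<phi> E = img \<phi> X \<union> img \<phi> Y \<union> img \<phi> Z" unfolding 1(1) img_Un ..
  then show ?thesis unfolding coded_star_def
    using 1(2) tree_img[OF 1(3) i(1)] tree_img[OF 1(4) i(2)] tree_img[OF 1(5) i(3)]
      int[OF E(1) i(1) E(2) i(2) 1(6) sub(1,2)] int[OF E(1) i(1) E(3) i(3) 1(7) sub(1,3)]
      int[OF E(2) i(2) E(3) i(3) 1(8) sub(2,3)] by blast
qed

definition edge_graph :: "'a set set \<Rightarrow> 'a graph" where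
  "edge_graph E = \<lparr>verts = \<Union>E, edges = E\<rparr>"

lemma coded_star_edge_set: "coded_star n M E \<Longrightarrow> edge_set E"
proof -
  assume "coded_star n M E"
  then obtain v X Y Z a b c where 1: "E = X \<union> Y \<union> Z"
    "tree n a X v" "tree n b Y v" "tree n c Z v"
    unfolding coded_star_def by blast
  have "edge_set X" "edge_set Y" "edge_set Z" using 1(2-4) by (blast intro: blockD(1)[OF tree_block])+
  then show ?thesis unfolding 1(1) edge_set_def by auto
qed

lemma coded_star_iso:
  assumes M: "coded_star n M E" and M': "coded_star n M' E'" and iso: "graph_iso (edge_graph E) (edge_graph E')"
  shows "M = M'"
proof -
  obtain f where f: "bij_betw f (\<Union>E) (\<Union>E')"
    "\<And>u v. u \<in> \<Union>E \<Longrightarrow> v \<in> \<Union>E \<Longrightarrow> {u, v} \<in> E \<longleftrightarrow> {f u, f v} \<in> E'"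
    using iso unfolding graph_iso_def edge_graph_def by (simp only: graph.simps) blast
  have inj: "inj_on f (\<Union>E)" and sur: "f ` \<Union>E = \<Union>E'" using f(1) unfolding bij_betw_def by auto
  have E: "edge_set E" "edge_set E'" using M M' coded_star_edge_set by blast+
  have "img f E = E'"
    unfolding img_inj[OF E(1) inj]
  proof (intro set_eqI iffI)
    fix h assume "h \<in> (`) f ` E"
    then obtain e where e: "e \<in> E" "h = f ` e" by auto
    obtain a b where ab: "e = {a, b}" using edge_setD(2)[OF E(1) e(1)] by (meson card_2_iff)
    then show "h \<in> E'" using f(2)[of a b] e by auto
  next
    fix h assume h: "h \<in> E'"
    obtain a b where ab: "h = {a, b}" using edge_setD(2)[OF E(2) h] by (meson card_2_iff)
    then have "a \<in> f ` \<Union>E" "b \<in> f ` \<Union>E" unfolding sur using h by auto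
    then obtain a' b' where a': "a' \<in> \<Union>E" "b' \<in> \<Union>E" "a = f a'" "b = f b'" by blast
    then have "{a', b'} \<in> E" "h = f ` {a', b'}" using f(2)[OF a'(1,2)] h ab by auto
    then show "h \<in> (`) f ` E" by blast
  qed
  then have "coded_star n M E'" using coded_star_img[OF M inj] by simp
  then show ?thesis using coded_star_unique M' by blast
qed

section \<open>Counting\<close>

primrec codes :: "nat \<Rightarrow> code set" where
  "codes 0 = Leaf ` {0..<5}"
| "codes (Suc n) = (\<lambda>(c, d). Node {#c, d#}) ` (codes n \<times> codes n)"

lemma finite_codes: "finite (codes n)"
  by (induction n) auto

text \<open>
  The set \<open>W\<close> of forbidden names makes it possible to choose blocks that share only their root.
\<close>

lemma tree_exists:
  "c \<in> codes n \<Longrightarrow> finite W \<Longrightarrow> \<exists>E. tree n c E (r :: nat) \<and> \<Union>E \<inter> W \<subseteq> {r}"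
proof (induction n arbitrary: c W r)
  case 0
  then obtain i where i: "c = Leaf i" "i < 5" by auto
  define m where "m = Max (insert r W)"
  have m: "x \<le> m" if "x \<in> insert r W" for x using that 0(2) unfolding m_def by auto
  \<comment> \<open>Names above \<open>m\<close> are fresh, and the root gets its prescribed name.\<close>
  define f where "f x = (if x = 0 then r else m + x)" for x :: nat
  have inj: "inj f" unfolding f_def inj_def using m[of r] by auto
  have E: "edge_set (leaf i)" using blockD(1)[OF block_leaf[OF i(2)]] .
  have "tree 0 (Leaf i) (img f (leaf i)) (f 0)"
    by (rule tree.Leaf[OF i(2)]) (use inj in \<open>auto intro: inj_on_subset\<close>)
  moreover have "f 0 = r" unfolding f_def by simp
  moreover have "f x \<in> W \<Longrightarrow> f x = r" for x using m[of "f x"] unfolding f_def by (auto split: if_splits)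
  then have "\<Union>(img f (leaf i)) \<inter> W \<subseteq> {r}" using Union_img[of f "leaf i"] by blast
  ultimately show ?case using i by auto
next
  case (Suc n)
  then obtain c1 d where c: "c = Node {#c1, d#}" "c1 \<in> codes n" "d \<in> codes n" by auto
  obtain a where a: "a \<notin> insert r W" using Suc(3) ex_new_if_finite[of "insert r W"] by auto
  obtain B where B: "tree n c1 B a" "\<Union>B \<inter> insert r W \<subseteq> {a}" using Suc.IH[OF c(2), of "insert r W" a] Suc(3) by auto
  have "finite (insert r W \<union> \<Union>B)" using Suc(3) edge_set_finite_Union[OF blockD(1)[OF tree_block[OF B(1)]]] by simp
  then obtain C where C: "tree n d C a" "\<Union>C \<inter> (insert r W \<union> \<Union>B) \<subseteq> {a}" using Suc.IH[OF c(3)] by blast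
  have n: "r \<notin> \<Union>B" "r \<notin> \<Union>C" using B(2) C(2) a by blast+
  have "tree (Suc n) (Node {#c1, d#}) (graft r a B C) r"
    by (rule tree.Node[OF B(1) C(1) _ n]) (use C(2) in blast)
  moreover have "\<Union>(graft r a B C) = {r, a} \<union> \<Union>B \<union> \<Union>C" unfolding graft_def by auto
  then have "\<Union>(graft r a B C) \<inter> W \<subseteq> {r}" using B(2) C(2) a by blast
  ultimately show ?case using c by blast
qed

definition triples :: "nat \<Rightarrow> code multiset set" where
  "triples n = (\<lambda>(a, b, c). {#a, b, c#}) ` (codes n \<times> codes n \<times> codes n)"

lemma coded_star_exists:
  assumes "M \<in> triples n"
  shows "\<exists>E :: nat set set. coded_star n M E"
proof -
  obtain a b c where M: "M = {#a, b, c#}" "a \<in> codes n" "b \<in> codes n" "c \<in> codes n"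
    using assms unfolding triples_def by auto
  have fin: "finite (\<Union>E)" if "tree n c E r" for c and E :: "nat set set" and r
    using edge_set_finite_Union[OF blockD(1)[OF tree_block[OF that]]] .
  obtain X where X: "tree n a X (0 :: nat)" using tree_exists[OF M(2), of "{}"] by auto
  obtain Y where Y: "tree n b Y (0 :: nat)" "\<Union>Y \<inter> \<Union>X \<subseteq> {0}" using tree_exists[OF M(3) fin[OF X]] by blast
  have "finite (\<Union>X \<union> \<Union>Y)" using fin[OF X] fin[OF Y(1)] by simp
  then obtain Z where Z: "tree n c Z (0 :: nat)" "\<Union>Z \<inter> (\<Union>X \<union> \<Union>Y) \<subseteq> {0}" using tree_exists[OF M(4)] by blast
  have "\<Union>X \<inter> \<Union>Y \<subseteq> {0}" "\<Union>X \<inter> \<Union>Z \<subseteq> {0}" "\<Union>Y \<inter> \<Union>Z \<subseteq> {0}" using Y(2) Z(2) by blast+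
  then show ?thesis unfolding coded_star_def using M(1) X Y(1) Z(1) by blast
qed

lemma coded_star_obstruction:
  fixes E :: "nat set set"
  assumes "coded_star n M E"
  shows "edge_graph E \<in> obs_cmms (n + 2)"
proof -
  obtain v X Y Z a b c where 1: "E = X \<union> Y \<union> Z"
    "tree n a X v" "tree n b Y v" "tree n c Z v"
    "\<Union>X \<inter> \<Union>Y \<subseteq> {v}" "\<Union>X \<inter> \<Union>Z \<subseteq> {v}" "\<Union>Y \<inter> \<Union>Z \<subseteq> {v}"
    using assms unfolding coded_star_def by blast
  have "star (n + 2) v X Y Z" unfolding star_def
    using 1(5-7) tree_block[OF 1(2)] tree_block[OF 1(3)] tree_block[OF 1(4)] by blast
  from star_obstruction[OF this] show ?thesis unfolding edge_graph_def 1(1) by simp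
qed

lemma card_le_fibres:
  assumes "finite A" "\<And>y. y \<in> f ` A \<Longrightarrow> card {x \<in> A. f x = y} \<le> n"
  shows "card A \<le> n * card (f ` A)"
proof -
  have "card A = (\<Sum>x\<in>A. 1)" by simp
  also have "\<dots> = (\<Sum>y\<in>f ` A. \<Sum>x\<in>{x \<in> A. f x = y}. 1)" by (rule sum.image_gen[OF assms(1)])
  also have "\<dots> = (\<Sum>y\<in>f ` A. card {x \<in> A. f x = y})" by simp
  also have "\<dots> \<le> (\<Sum>y\<in>f ` A. n)" by (rule sum_mono) (use assms in simp)
  finally show ?thesis by (simp add: mult.commute)
qed

lemma card_le_length: "A \<subseteq> set xs \<Longrightarrow> card A \<le> length xs"
  by (meson List.finite_set card_length card_mono le_trans)

lemma card_codes_Suc: "card (codes n) ^ 2 \<le> 2 * card (codes (Suc n))"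
proof -
  let ?f = "\<lambda>(c, d). Node {#c, d#}"
  have "card (codes n \<times> codes n) \<le> 2 * card (?f ` (codes n \<times> codes n))"
  proof (rule card_le_fibres)
    fix y assume "y \<in> ?f ` (codes n \<times> codes n)"
    then obtain a b where "y = Node {#a, b#}" by auto
    then have "{x \<in> codes n \<times> codes n. ?f x = y} \<subseteq> set [(a, b), (b, a)]"
      by (auto simp: add_eq_conv_ex)
    from card_le_length[OF this] show "card {x \<in> codes n \<times> codes n. ?f x = y} \<le> 2" by simp
  qed (simp add: finite_codes)
  then show ?thesis by (simp add: card_cartesian_product power2_eq_square)
qed

lemma card_triples: "card (codes n) ^ 3 \<le> 6 * card (triples n)"
proof -
  let ?f = "\<lambda>(a, b, c). {#a, b, c#}" let ?A = "codes n \<times> codes n \<times> codes n"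
  have "card ?A \<le> 6 * card (?f ` ?A)"
  proof (rule card_le_fibres)
    fix y assume "y \<in> ?f ` ?A"
    then obtain a b c where "y = {#a, b, c#}" by auto
    then have "{x \<in> ?A. ?f x = y} \<subseteq>
        set [(a, b, c), (a, c, b), (b, a, c), (b, c, a), (c, a, b), (c, b, a)]"
      by (auto simp: add_eq_conv_ex)
    from card_le_length[OF this] show "card {x \<in> ?A. ?f x = y} \<le> 6" by simp
  qed (simp add: finite_codes)
  then show ?thesis unfolding triples_def by (simp add: card_cartesian_product power3_eq_cube)
qed

text \<open>
  Dividing by \<open>2\<close> turns the recursion into repeated squaring, starting with \<open>5 / 2\<close>.
\<close>

lemma card_codes: "(5 / 2) ^ (2 ^ n) \<le> real (card (codes n)) / 2"
proof (induction n)
  case 0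
  have "card (Leaf ` {0..<5}) = 5" by (subst card_image) (auto simp: inj_on_def)
  then show ?case by simp
next
  case (Suc n)
  have "(5 / 2 :: real) ^ (2 ^ Suc n) = ((5 / 2) ^ (2 ^ n)) ^ 2" by (simp add: power_mult[symmetric] mult.commute)
  also have "\<dots> \<le> (real (card (codes n)) / 2) ^ 2" by (rule power_mono[OF Suc]) simp
  also have "\<dots> = real (card (codes n) ^ 2) / 4" by (simp add: power_divide)
  also have "\<dots> \<le> real (2 * card (codes (Suc n))) / 4"
    using card_codes_Suc[of n] by (intro divide_right_mono of_nat_mono) auto
  finally show ?case by simp
qed

theorem mainTheorem5:
  fixes k :: nat
  assumes "k \<ge> 2"
  shows "\<exists>F. finite F \<and> F \<subseteq> obs_cmms k \<and>
           (\<forall>G\<in>F. \<forall>H\<in>F. G \<noteq> H \<longrightarrow> \<not> graph_iso G H) \<and>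
           real (card F) \<ge> 4 / 3 * (5 / 2) ^ (3 * 2 ^ (k - 2))"
proof -
  define n where "n = k - 2"
  have k: "k = n + 2" using assms unfolding n_def by simp
  define g where "g M = edge_graph (SOME E :: nat set set. coded_star n M E)" for M
  have g: "\<exists>E. g M = edge_graph E \<and> coded_star n M E" if "M \<in> triples n" for M
    unfolding g_def using someI_ex[OF coded_star_exists[OF that]] by blast
  have iso: "M = M'" if "M \<in> triples n" "M' \<in> triples n" "graph_iso (g M) (g M')" for M M'
    using g[OF that(1)] g[OF that(2)] that(3) coded_star_iso by metis
  have refl: "graph_iso G G" for G :: "nat graph"
    unfolding graph_iso_def by (rule exI[of _ id]) simp
  have inj: "inj_on g (triples n)" by (rule inj_onI) (metis iso refl)
  have "finite (triples n)" unfolding triples_def by (simp add: finite_codes)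
  then have "finite (g ` triples n)" by simp
  moreover have "g ` triples n \<subseteq> obs_cmms k"
    unfolding k using g coded_star_obstruction by fastforce
  moreover have "\<forall>G\<in>g ` triples n. \<forall>H\<in>g ` triples n. G \<noteq> H \<longrightarrow> \<not> graph_iso G H"
    using iso by blast
  moreover have "4 / 3 * (5 / 2) ^ (3 * 2 ^ (k - 2)) \<le> real (card (g ` triples n))"
  proof -
    let ?N = "real (card (codes n))"
    have "(5 / 2 :: real) ^ (3 * 2 ^ (k - 2)) = ((5 / 2) ^ (2 ^ n)) ^ 3"
      by (simp add: k power_mult[symmetric] mult.commute)
    also have "\<dots> \<le> (?N / 2) ^ 3" by (rule power_mono[OF card_codes]) simp
    finally have "4 / 3 * (5 / 2) ^ (3 * 2 ^ (k - 2)) \<le> 4 / 3 * (?N / 2) ^ 3" by simp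
    also have "\<dots> = real (card (codes n) ^ 3) / 6" by (simp add: power_divide)
    also have "\<dots> \<le> real (6 * card (triples n)) / 6"
      using card_triples[of n] by (intro divide_right_mono of_nat_mono) auto
    also have "\<dots> = real (card (g ` triples n))" using card_image[OF inj] by simp
    finally show ?thesis .
  qed
  ultimately show ?thesis by blast
qed

end
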